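(* Let $n\in\mathbb{N}$, $n<\alpha<n+1$, and suppose $B$ is an $A^\alpha$-interpolating Blaschke product with zeros $\{z_j\}_{j\in\mathbb{N}}$. For $k\in\mathbb{N}$ let $\mathcal{J}_k:=\{f\in A^\alpha:\ fB^k\in A^\alpha\}$, and for $j\in\mathbb{N}$ let $d_j:=\inf\{|z_j-z_l|:\ l\in\mathbb{N}\setminus\{j\}\}$. The following are equivalent: (i) The ideals $\mathcal{J}_1,\dots,\mathcal{J}_n$ are all nonideal (as subspaces of $A^\alpha$). (ii) The inclusions $\mathcal{J}_1\supset\dots\supset\mathcal{J}_n\supset\mathcal{J}_{n+1}$ are all proper. (iii) $\mathcal{J}_n$ is nonideal (as a subspace of $A^\alpha$). (iv) $\mathcal{J}_{n+1}\ne\mathcal{J}_n$. (v) One has $\displaystyle\sup_j\frac{d_j}{1-|z_j|}=\infty$.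
   Context: Notation: $\mathbb{N}=\{1,2,\dots\}$, $\mathbb{D}=\{z\in\mathbb{C}:|z|<1\}$, $\mathbb{T}=\partial\mathbb{D}$; $H^\infty$ is the algebra of bounded analytic functions on $\mathbb{D}$. For $\alpha>0$, $A^\alpha$ is the set of all $f\in H^\infty$ such that $|f^{(m)}(z)|=O((1-|z|)^{\alpha-m})$, $z\in\mathbb{D}$, for some (equivalently, any) integer $m>\alpha$. It is an algebra under pointwise multiplication. If $n<\alpha<n+1$ with $n$ a nonnegative integer, then for $f\in A^\alpha$ the derivatives $f,f',\dots,f^{(n)}$ extend continuously to $\mathrm{clos}\,\mathbb{D}$, and their values on $\mathbb{T}$ are understood in this sense. The sets $\mathcal{J}_k$ are (possibly nonclosed) ideals of the algebra $A^\alpha$, and the (not necessarily strict) inclusions $\mathcal{J}_k\supset\mathcal{J}_{k+1}$ always hold. Ideal subspaces: a linear subspace $X$ (not necessarily closed) of $A^\alpha$ is an ideal subspace of $A^\alpha$ if, whenever $f\in X$, $g\in A^\alpha$ and $|g|\le|f|$ everywhere on $\mathbb{D}$, it follows that $g\in X$. An ideal of $A^\alpha$ is called nonideal if it is not an ideal subspace of $A^\alpha$. Blaschke product: for a sequence $\{z_j\}\subset\mathbb{D}$ with $\sum_j(1-|z_j|)<\infty$, the Blaschke product with zeros $\{z_j\}$ is $B(z)=\prod_j\frac{\bar z_j}{|z_j|}\frac{z_j-z}{1-\bar z_jz}$ (with the factor interpreted as $z$ if $z_j=0$). $A^\alpha$-interpolating sets (for $n<\alpha<n+1$, $n$ a nonnegative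 integer): a closed set $E\subset\mathrm{clos}\,\mathbb{D}$ is an $A^\alpha$-interpolating set if, for all functions $\varphi_0,\dots,\varphi_n:E\to\mathbb{C}$ satisfying, with some constant $C>0$, $$\left|\varphi_s(z)-\sum_{m=0}^{n-s}\frac{\varphi_{s+m}(w)}{m!}(z-w)^m\right|\le C|z-w|^{\alpha-s}\qquad(z,w\in E,\ s=0,\dots,n),$$ there exists $g\in A^\alpha$ with $g|_E=\varphi_0,\ g'|_E=\varphi_1,\ \dots,\ g^{(n)}|_E=\varphi_n$. A Blaschke product $B$ with zeros $\{z_j\}$ is an $A^\alpha$-interpolating Blaschke product if its zeros $z_j$ are all simple (so the $z_j$ are pairwise distinct) and $\mathrm{clos}\{z_j\}$ is an $A^\alpha$-interpolating set. *)

theory Defs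
  imports "HOL-Analysis.Analysis"
begin

text \<open>
  Functions on the open unit disc are total functions on \<^typ>\<open>complex\<close> of which only the values
  on \<^term>\<open>ball (0::complex) 1\<close> matter: membership in every space below depends only on those
  values (in particular, the iterated \<^const>\<open>deriv\<close> is only taken at points of the open disc).
\<close>

definition H_infinity :: "(complex \<Rightarrow> complex) set" where
  "H_infinity = {f. f holomorphic_on ball 0 1 \<and> bounded (f ` ball 0 1)}"

definition A_space :: "real \<Rightarrow> (complex \<Rightarrow> complex) set" where
  "A_space \<alpha> = {f \<in> H_infinity. \<exists>m::nat. real m > \<alpha> \<and>
     (\<exists>C. \<forall>z\<in>ball 0 1. norm ((deriv ^^ m) f z) \<le> C * (1 - norm z) powr (\<alpha> - real m))}"

definition linear_subspace_of_A :: "real \<Rightarrow> (complex \<Rightarrow> complex) set \<Rightarrow> bool" where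
  "linear_subspace_of_A \<alpha> X \<longleftrightarrow>
     X \<subseteq> A_space \<alpha> \<and> (\<lambda>z. 0) \<in> X \<and>
     (\<forall>f\<in>X. \<forall>g\<in>X. (\<lambda>z. f z + g z) \<in> X) \<and>
     (\<forall>c. \<forall>f\<in>X. (\<lambda>z. c * f z) \<in> X)"

definition ideal_of_A :: "real \<Rightarrow> (complex \<Rightarrow> complex) set \<Rightarrow> bool" where
  "ideal_of_A \<alpha> I \<longleftrightarrow>
     linear_subspace_of_A \<alpha> I \<and> (\<forall>f\<in>I. \<forall>g\<in>A_space \<alpha>. (\<lambda>z. f z * g z) \<in> I)"

definition ideal_subspace_of_A :: "real \<Rightarrow> (complex \<Rightarrow> complex) set \<Rightarrow> bool" where
  "ideal_subspace_of_A \<alpha> X \<longleftrightarrow>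
     linear_subspace_of_A \<alpha> X \<and>
     (\<forall>f\<in>X. \<forall>g\<in>A_space \<alpha>. (\<forall>z\<in>ball 0 1. norm (g z) \<le> norm (f z)) \<longrightarrow> g \<in> X)"

definition nonideal_ideal_of_A :: "real \<Rightarrow> (complex \<Rightarrow> complex) set \<Rightarrow> bool" where
  "nonideal_ideal_of_A \<alpha> I \<longleftrightarrow> ideal_of_A \<alpha> I \<and> \<not> ideal_subspace_of_A \<alpha> I"

definition blaschke_factor :: "complex \<Rightarrow> complex \<Rightarrow> complex" where
  "blaschke_factor a z =
     (if a = 0 then z else cnj a / of_real (norm a) * ((a - z) / (1 - cnj a * z)))"

definition blaschke_sequence :: "(nat \<Rightarrow> complex) \<Rightarrow> bool" where
  "blaschke_sequence z \<longleftrightarrow> range z \<subseteq> ball 0 1 \<and> summable (\<lambda>j. 1 - norm (z j))"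

definition blaschke_product :: "(nat \<Rightarrow> complex) \<Rightarrow> complex \<Rightarrow> complex" where
  "blaschke_product z w = (\<Prod>j. blaschke_factor (z j) w)"

text \<open>
  The value at \<open>w\<close> of a function \<open>h\<close> on the open disc that extends continuously to the closed
  disc: the actual value inside the disc, the boundary limit on the circle.
\<close>

definition has_disc_value :: "(complex \<Rightarrow> complex) \<Rightarrow> complex \<Rightarrow> complex \<Rightarrow> bool" where
  "has_disc_value h w c \<longleftrightarrow>
     (if w \<in> ball 0 1 then h w = c else (h \<longlongrightarrow> c) (at w within ball 0 1))"

text \<open>
  The definition is meant for \<open>n < \<alpha> < n + 1\<close>. In the case \<open>z = w\<close> the Taylor condition is void,
  both sides being \<open>0\<close>.
\<close>

definition A_interpolating_set :: "nat \<Rightarrow> real \<Rightarrow> complex set \<Rightarrow> bool" where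
  "A_interpolating_set n \<alpha> E \<longleftrightarrow>
     closed E \<and> E \<subseteq> cball 0 1 \<and>
     (\<forall>\<phi> :: nat \<Rightarrow> complex \<Rightarrow> complex.
        (\<exists>C>0. \<forall>z\<in>E. \<forall>w\<in>E. \<forall>s\<le>n.
           norm (\<phi> s z - (\<Sum>m=0..n - s. \<phi> (s + m) w / fact m * (z - w) ^ m))
             \<le> C * norm (z - w) powr (\<alpha> - real s)) \<longrightarrow>
        (\<exists>g\<in>A_space \<alpha>. \<forall>s\<le>n. \<forall>w\<in>E. has_disc_value ((deriv ^^ s) g) w (\<phi> s w)))"

definition A_interpolating_blaschke_product ::
    "nat \<Rightarrow> real \<Rightarrow> (complex \<Rightarrow> complex) \<Rightarrow> (nat \<Rightarrow> complex) \<Rightarrow> bool" where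
  "A_interpolating_blaschke_product n \<alpha> B z \<longleftrightarrow>
     blaschke_sequence z \<and> (\<forall>w\<in>ball 0 1. B w = blaschke_product z w) \<and>
     inj z \<and> A_interpolating_set n \<alpha> (closure (range z))"

definition J_ideal :: "real \<Rightarrow> (complex \<Rightarrow> complex) \<Rightarrow> nat \<Rightarrow> (complex \<Rightarrow> complex) set" where
  "J_ideal \<alpha> B k = {f \<in> A_space \<alpha>. (\<lambda>w. f w * B w ^ k) \<in> A_space \<alpha>}"

definition sep_dist :: "(nat \<Rightarrow> complex) \<Rightarrow> nat \<Rightarrow> real" where
  "sep_dist z j = (INF l\<in>UNIV - {j}. norm (z j - z l))"

end

theory Submission
  imports Defs "HOL-Complex_Analysis.Complex_Analysis"
begin

text \<open>
  For a finite Blaschke product \<open>b\<close> the function \<open>1 / b\<close> is bounded and holomorphic outside the disc and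
  coincides on the circle with the conjugate of \<open>b\<close>. Two consequences of Cauchy's theorem in the
  exterior carry the proof. First, dividing an element of \<open>A\<^sup>\<alpha>\<close> by \<open>b\<close> stays in \<open>A\<^sup>\<alpha>\<close>, with constants
  independent of \<open>b\<close>, so that infinite products are reached by normal families. Second, if \<open>f\<close> and
  \<open>F = f b\<^sup>m\<close> are in \<open>A\<^sup>\<alpha>\<close> and \<open>P\<close>, \<open>Q\<close> are their Taylor polynomials at \<open>x\<close>, then \<open>P - Q / b\<^sup>m\<close> is
  \<open>O((1 - \<bar>x\<bar>)\<^sup>\<alpha>)\<close> at the points outside the disc near \<open>x\<close>.

  If (v) holds, interpolate jets at the zeros that vanish except in order \<open>k\<close>, where the value is
  \<open>d\<^sub>j\<close> to the power \<open>\<alpha> - k\<close>. The quotient of the resulting function \<open>f\<close> by \<open>B\<^sup>k\<close> lies in \<open>J\<^sub>k\<close>; if it were in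
  \<open>J\<^sub>k\<^sub>+\<^sub>1\<close>, then \<open>f B\<close> would be in \<open>A\<^sup>\<alpha>\<close>, and the second fact at the reflection of \<open>z\<^sub>j\<close>, where
  \<open>1 / B\<close> vanishes, would bound \<open>d\<^sub>j / (1 - \<bar>z\<^sub>j\<bar>)\<close>. If moreover \<open>f \<in> J\<^sub>k - J\<^sub>k\<^sub>+\<^sub>1\<close>, then \<open>f B\<close> is
  dominated by \<open>f\<close> and not in \<open>J\<^sub>k\<close>, so proper inclusions give nonideal ideals.

  If (v) fails, every zero has another one within bounded hyperbolic distance. For \<open>f \<in> J\<^sub>n\<close> the second
  fact makes the Taylor polynomial of degree \<open>n\<close> vanish approximately to order \<open>n\<close> at two reflected
  zeros, hence \<open>f\<close> is \<open>O((1 - \<bar>x\<bar>)\<^sup>\<alpha>)\<close> wherever \<open>\<bar>B\<bar>\<close> is small. This is inherited by every function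
  dominated by \<open>f\<close>, and it suffices for membership in \<open>J\<^sub>n\<close>: on a disc where \<open>\<bar>b\<bar>\<close> is bounded below,
  reflection bounds the derivatives of \<open>b\<close>, and near its edge the function is small.
\<close>

section \<open>Contour integrals over circles in the disc and its exterior\<close>

text \<open>The zeros of \<open>B\<close> accumulate on the circle, so \<open>1 / B\<close> is
  holomorphic on no annulus around it, and a contour just inside the disc has no room. Every
  estimate is therefore made for finite products, with constants that depend neither on the number
  nor on the position of the zeros; only such bounds pass to the limit.

  That two zeros are needed is a matter of degree. A Taylor polynomial has degree at most
  \<open>n\<close>, while \<open>1 / b ^ n\<close> vanishes to order \<open>n\<close> at each
  reflected zero. One such zero still admits a multiple of an \<open>n\<close>-th power; a second
  one at bounded hyperbolic distance excludes it, with an estimate that does not degenerate when the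
  two zeros merge.

  The estimates contain the polynomial on both sides: it is bounded by itself times
  \<open>1 / b ^ n\<close>, up to an admissible error, and is absorbed where \<open>1 / b\<close> is
  small. Away from the zeros, smallness of \<open>1 / b\<close> outside the disc has to be deduced
  from smallness of \<open>b\<close> inside; this transfer loses a fixed power only, whatever the
  number of zeros.\<close>

lemma norm_circle_integral_le:
  fixes g :: "complex \<Rightarrow> complex"
  assumes cont: "continuous_on (sphere 0 r) g" and zr: "norm z < r"
    and bd: "\<And>\<zeta>. norm \<zeta> = r \<Longrightarrow> norm (g \<zeta>) \<le> M / norm (\<zeta> - z) ^ 2"
  shows "norm (contour_integral (circlepath 0 r) g) \<le> 2 * pi * M / (r - norm z)"
proof -
  have r0: "r > 0" using zr norm_ge_zero[of z] by linarith
  have M0: "M \<ge> 0"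
  proof -
    have "0 \<le> M / norm (of_real r - z) ^ 2"
      by (rule order_trans[OF norm_ge_zero bd[of "of_real r"]]) (use r0 in auto)
    moreover have "norm (of_real r - z) ^ 2 > 0" using zr r0 by auto
    ultimately show ?thesis by (simp add: zero_le_divide_iff)
  qed
  \<comment> \<open>On the circle \<open>r^2 = \<zeta> * cnj \<zeta>\<close>, so
    \<open>h \<zeta> / (\<zeta> - z)\<close> times the velocity is \<open>\<i>\<close> times
    \<open>2 * pi / norm (\<zeta> - z)^2\<close>. Cauchy's formula for \<open>h\<close> at
    \<open>z\<close> thus gives the exact mean of the Poisson kernel. Length times maximum would
    lose a further factor \<open>r - norm z\<close>, which the exponents below cannot
    afford.\<close>
  define h where "h = (\<lambda>\<zeta>. 1 / (of_real (r^2) - cnj z * \<zeta>))"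
  have nz: "of_real (r^2) - cnj z * \<zeta> \<noteq> 0" if "norm \<zeta> \<le> r" for \<zeta>
  proof
    assume "of_real (r^2) - cnj z * \<zeta> = 0"
    hence "norm (complex_of_real (r^2)) = norm (cnj z * \<zeta>)" by simp
    hence "r^2 = norm z * norm \<zeta>" by (simp only: norm_of_real norm_mult complex_mod_cnj) simp
    also have "\<dots> \<le> norm z * r" using that by (intro mult_left_mono) auto
    also have "\<dots> < r * r" using zr r0 by simp
    finally show False by (simp add: power2_eq_square)
  qed
  have hol: "h holomorphic_on ball 0 r" and conth: "continuous_on (cball 0 r) h"
    unfolding h_def using nz by (auto intro!: holomorphic_intros continuous_intros)
  have "((\<lambda>u. h u / (u - z)) has_contour_integral (2 * of_real pi * \<i> * h z)) (circlepath 0 r)"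
    by (rule Cauchy_integral_circlepath[OF conth hol]) (use zr in auto)
  hence I1: "((\<lambda>t. h (circlepath 0 r t) / (circlepath 0 r t - z) *
        vector_derivative (circlepath 0 r) (at t within {0..1})) has_integral (2 * of_real pi * \<i> * h z)) {0..1}"
    unfolding has_contour_integral_def .
  have nm: "norm (circlepath 0 r t) = r" for t
    using r0 by (simp add: circlepath norm_mult)
  have key: "h \<zeta> / (\<zeta> - z) * (2 * pi * \<i> * \<zeta>) = of_real (2 * pi / norm (\<zeta> - z)^2) * \<i>" if "norm \<zeta> = r" for \<zeta>
  proof -
    have "\<zeta> \<noteq> 0" "\<zeta> \<noteq> z" using that zr r0 by auto
    have e: "of_real (r^2) = \<zeta> * cnj \<zeta>" using that complex_norm_square[of \<zeta>] by simp
    have "of_real (norm (\<zeta> - z)^2) = (\<zeta> - z) * cnj (\<zeta> - z)" by (rule complex_norm_square)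
    have nn: "complex_of_real (r^2) - cnj z * \<zeta> = \<zeta> * cnj (\<zeta> - z)" unfolding e by (simp add: algebra_simps)
    show ?thesis unfolding h_def nn of_real_divide \<open>of_real (norm (\<zeta> - z)^2) = _\<close>
      using \<open>\<zeta> \<noteq> 0\<close> \<open>\<zeta> \<noteq> z\<close> by (simp del: complex_cnj_diff add: divide_simps)
  qed
  have vd: "vector_derivative (circlepath 0 r) (at t within {0..1}) = 2 * pi * \<i> * circlepath 0 r t" if "t \<in> {0..1}" for t
    using that vector_derivative_circlepath01[of t 0 r] by (simp add: circlepath)
  have I2: "((\<lambda>t. of_real (2 * pi / norm (circlepath 0 r t - z)^2) * \<i>) has_integral (2 * of_real pi * \<i> * h z)) {0..1}"
    by (rule has_integral_eq[OF _ I1]) (use vd key nm in auto)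
  have hz: "h z = of_real (1 / (r^2 - norm z ^ 2))"
    unfolding h_def of_real_divide of_real_diff complex_norm_square[of z] by (simp add: mult.commute)
  from has_integral_linear[OF I2 bounded_linear_Im]
  have I3: "((\<lambda>t. 2 * pi / norm (circlepath 0 r t - z)^2) has_integral (2 * pi / (r^2 - norm z ^ 2))) {0..1}"
    by (simp add: o_def hz)
  have I4: "((\<lambda>t. M * r * (2 * pi / norm (circlepath 0 r t - z)^2)) has_integral (M * r * (2 * pi / (r^2 - norm z ^ 2)))) {0..1}"
    by (rule has_integral_mult_right[OF I3])
  have "g contour_integrable_on circlepath 0 r"
    by (rule contour_integrable_continuous_circlepath) (use cont r0 in auto)
  hence I5: "((\<lambda>t. g (circlepath 0 r t) * vector_derivative (circlepath 0 r) (at t within {0..1})) has_integral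
      contour_integral (circlepath 0 r) g) {0..1}"
    using has_contour_integral_integral unfolding has_contour_integral_def by blast
  have "norm (contour_integral (circlepath 0 r) g) \<le> M * r * (2 * pi / (r^2 - norm z ^ 2))"
    unfolding integral_unique[OF I5, symmetric] integral_unique[OF I4, symmetric]
  proof (rule integral_norm_bound_integral)
    fix t :: real assume t: "t \<in> {0..1}"
    have "norm (g (circlepath 0 r t) * vector_derivative (circlepath 0 r) (at t within {0..1})) = norm (g (circlepath 0 r t)) * (2 * pi * r)"
      using vd[OF t] nm by (simp add: norm_mult)
    also have "\<dots> \<le> M / norm (circlepath 0 r t - z)^2 * (2 * pi * r)"
      by (intro mult_right_mono bd) (use nm r0 in auto)
    finally show "norm (g (circlepath 0 r t) * vector_derivative (circlepath 0 r) (at t within {0..1}))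
        \<le> M * r * (2 * pi / norm (circlepath 0 r t - z)^2)" by (simp add: mult_ac)
  qed (use I4 I5 in auto)
  also have "r^2 - norm z^2 = (r - norm z) * (r + norm z)" by (simp add: power2_eq_square algebra_simps)
  also have "M * r * (2 * pi / ((r - norm z) * (r + norm z))) = 2 * pi * M / (r - norm z) * (r / (r + norm z))"
    by simp
  also have "\<dots> \<le> 2 * pi * M / (r - norm z) * 1"
    using M0 r0 zr add_pos_nonneg[OF r0 norm_ge_zero[of z]] by (intro mult_left_mono) (simp_all add: divide_le_eq_1_pos)
  finally show ?thesis by simp
qed

text \<open>The circle is moved radially to infinity, where decay of order two beats its
  length.\<close>

lemma exterior_circle_integral_zero:
  fixes H :: "complex \<Rightarrow> complex"
  assumes hol: "H holomorphic_on {\<zeta>. \<rho> < norm \<zeta>}" and \<rho>: "0 \<le> \<rho>" "\<rho> < r"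
    and bd: "\<And>\<zeta>. R \<le> norm \<zeta> \<Longrightarrow> norm (H \<zeta>) \<le> C / norm \<zeta> ^ 2"
  shows "contour_integral (circlepath 0 r) H = 0"
proof -
  have op: "open {\<zeta>::complex. \<rho> < norm \<zeta>}" by (intro open_Collect_less continuous_intros)
  have eq: "contour_integral (circlepath 0 r) H = contour_integral (circlepath 0 s) H" if "s \<ge> r" for s
  proof (rule Cauchy_theorem_homotopic_loops[OF _ op hol])
    show "homotopic_loops {\<zeta>. \<rho> < norm \<zeta>} (circlepath 0 r) (circlepath 0 s)"
    proof (rule homotopic_loops_linear)
      fix t :: real assume "t \<in> {0..1}"
      show "closed_segment (circlepath 0 r t) (circlepath 0 s t) \<subseteq> {\<zeta>. \<rho> < norm \<zeta>}"
      proof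
        fix x assume "x \<in> closed_segment (circlepath 0 r t) (circlepath 0 s t)"
        then obtain u where u: "0 \<le> u" "u \<le> 1" "x = (1 - u) *\<^sub>R circlepath 0 r t + u *\<^sub>R circlepath 0 s t"
          by (auto simp: in_segment)
        have "x = of_real ((1-u) * r + u * s) * exp (2 * of_real pi * \<i> * of_real t)"
          using u(3) by (simp add: circlepath scaleR_conv_of_real algebra_simps)
        hence "norm x = \<bar>(1-u) * r + u * s\<bar>" by (simp add: norm_mult del: of_real_add of_real_mult)
        also have "\<dots> \<ge> (1-u) * r + u * r" using u that mult_left_mono[of r s u] by linarith
        finally show "x \<in> {\<zeta>. \<rho> < norm \<zeta>}" using \<rho> by (simp add: algebra_simps)
      qed
    qed auto
  qed auto
  have lim: "norm (contour_integral (circlepath 0 r) H) \<le> 2 * pi * \<bar>C\<bar> / s" if "s \<ge> max r (max R 1)" for s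
  proof -
    have s: "s \<ge> r" "s \<ge> R" "s \<ge> 1" using that by auto
    have "continuous_on (path_image (circlepath 0 s)) H"
      by (rule holomorphic_on_imp_continuous_on, rule holomorphic_on_subset[OF hol]) (use s \<rho> in auto)
    hence "(H has_contour_integral (contour_integral (circlepath 0 s) H)) (circlepath 0 s)"
      by (intro has_contour_integral_integral contour_integrable_continuous_circlepath)
    hence "norm (contour_integral (circlepath 0 s) H) \<le> \<bar>C\<bar> / s^2 * (2 * pi * s)"
    proof (rule has_contour_integral_bound_circlepath)
      fix x assume "norm (x - (0::complex)) = s"
      hence "norm x = s" by simp
      show "norm (H x) \<le> \<bar>C\<bar> / s^2"
        using bd[of x] s \<open>norm x = s\<close> by (auto intro!: order_trans[OF bd[of x]] divide_right_mono)
    qed (use s in auto)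
    also have "\<dots> = 2 * pi * \<bar>C\<bar> / s" using s by (simp add: power2_eq_square)
    finally show ?thesis using eq[OF s(1)] by simp
  qed
  have "((\<lambda>s. 2 * pi * \<bar>C\<bar> / s) \<longlongrightarrow> 0) at_top"
    by (intro tendsto_divide_0[OF tendsto_const] filterlim_at_top_imp_at_infinity filterlim_ident)
  hence "norm (contour_integral (circlepath 0 r) H) \<le> 0"
    by (rule tendsto_lowerbound) (use lim in \<open>auto simp: eventually_at_top_linorder intro!: exI[of _ "max r (max R 1)"]\<close>)
  thus ?thesis by simp
qed

lemma exterior_Cauchy_formula:
  fixes g :: "complex \<Rightarrow> complex"
  assumes hol: "g holomorphic_on {\<zeta>. \<rho> < norm \<zeta>}" and \<rho>: "0 \<le> \<rho>" "\<rho> < r" and v: "r < norm v"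
    and bd: "\<And>\<zeta>. R \<le> norm \<zeta> \<Longrightarrow> norm (g \<zeta>) \<le> C / norm \<zeta>"
  shows "contour_integral (circlepath 0 r) (\<lambda>\<zeta>. g \<zeta> / (\<zeta> - v)) = - 2 * pi * \<i> * g v"
proof -
  define S where "S = {\<zeta>::complex. \<rho> < norm \<zeta>}"
  have op: "open S" unfolding S_def by (intro open_Collect_less continuous_intros)
  have vS: "v \<in> S" and S0: "0 \<notin> S" using \<rho> v unfolding S_def by auto
  \<comment> \<open>Subtracting the constant \<open>g v\<close> would destroy the decay at infinity;
    the multiple of \<open>1 / \<zeta>\<close> with the same value at \<open>v\<close> keeps it. The
    quotient by \<open>\<zeta> - v\<close> is then holomorphic and decays to order two, so only the
    subtracted term contributes, through its pole at \<open>0\<close>.\<close>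
  define k where "k = (\<lambda>\<zeta>. g \<zeta> - g v * v / \<zeta>)"
  have holk: "k holomorphic_on S" unfolding k_def
    by (intro holomorphic_intros) (use hol S0 in \<open>auto simp: S_def\<close>)
  have kv: "k v = 0" using S0 vS unfolding k_def by auto
  define H where "H = (\<lambda>z. if z = v then deriv k v else (k z - k v) / (z - v))"
  have holH: "H holomorphic_on S" unfolding H_def
    by (rule pole_lemma[OF holk]) (use op vS in \<open>simp add: interior_open\<close>)
  define R' where "R' = max (max R 1) (2 * norm v)"
  have bH: "norm (H \<zeta>) \<le> (2 * (C + norm (g v * v))) / norm \<zeta>^2" if "R' \<le> norm \<zeta>" for \<zeta>
  proof -
    have z: "norm \<zeta> \<ge> R" "norm \<zeta> \<ge> 1" "norm \<zeta> \<ge> 2 * norm v" using that by (auto simp: R'_def)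
    have "norm v > 0" using v \<rho> by auto
    hence ne: "\<zeta> \<noteq> v" "\<zeta> \<noteq> 0" using z by auto
    have "norm (\<zeta> - v) \<ge> norm \<zeta> - norm v" by (rule norm_triangle_ineq2)
    hence a: "norm (\<zeta> - v) \<ge> norm \<zeta> / 2" using z by linarith
    have "norm (k \<zeta>) \<le> norm (g \<zeta>) + norm (g v * v / \<zeta>)" unfolding k_def by (rule norm_triangle_ineq4)
    also have "\<dots> \<le> C / norm \<zeta> + norm (g v * v) / norm \<zeta>" using bd[OF z(1)] by (simp add: norm_divide)
    finally have b: "norm (k \<zeta>) \<le> (C + norm (g v * v)) / norm \<zeta>" by (simp add: add_divide_distrib)
    have "norm (H \<zeta>) = norm (k \<zeta>) / norm (\<zeta> - v)" using ne kv by (simp add: H_def norm_divide)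
    also have "\<dots> \<le> ((C + norm (g v * v)) / norm \<zeta>) / (norm \<zeta> / 2)"
      using b a ne order_trans[OF norm_ge_zero b] by (intro frac_le) auto
    finally show ?thesis by (simp add: power2_eq_square mult_ac)
  qed
  have Z: "contour_integral (circlepath 0 r) H = 0"
    by (rule exterior_circle_integral_zero[OF holH[unfolded S_def] \<rho> bH])
  have r0: "r > 0" using \<rho> by linarith
  have "((\<lambda>u. (g v * v / (u - v)) / (u - 0)) has_contour_integral (2 * of_real pi * \<i> * (g v * v / (0 - v)))) (circlepath 0 r)"
    by (rule Cauchy_integral_circlepath) (use v r0 in \<open>auto intro!: continuous_intros holomorphic_intros\<close>)
  hence A: "((\<lambda>u. (g v * v / (u - v)) / u) has_contour_integral (- 2 * of_real pi * \<i> * g v)) (circlepath 0 r)"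
    using v r0 by (cases "v = 0") (auto simp: mult_ac)
  have "continuous_on (path_image (circlepath 0 r)) H"
    by (rule holomorphic_on_imp_continuous_on, rule holomorphic_on_subset[OF holH]) (use r0 \<rho> in \<open>auto simp: S_def\<close>)
  hence B: "(H has_contour_integral 0) (circlepath 0 r)"
    using has_contour_integral_integral[OF contour_integrable_continuous_circlepath] Z by metis
  have "((\<lambda>u. H u + (g v * v / (u - v)) / u) has_contour_integral (0 + (- 2 * of_real pi * \<i> * g v))) (circlepath 0 r)"
    by (rule has_contour_integral_add[OF B A])
  hence "((\<lambda>\<zeta>. g \<zeta> / (\<zeta> - v)) has_contour_integral (0 + (- 2 * of_real pi * \<i> * g v))) (circlepath 0 r)"
  proof (rule has_contour_integral_eq)
    fix x assume "x \<in> path_image (circlepath 0 r)"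
    hence "norm x = r" using r0 by simp
    hence "x \<noteq> v" "x \<noteq> 0" using v r0 by auto
    thus "H x + g v * v / (x - v) / x = g x / (x - v)"
      using kv unfolding H_def k_def by (simp add: divide_simps)
  qed
  thus ?thesis by (simp add: contour_integral_unique)
qed

section \<open>Growth of derivatives in the disc\<close>

text \<open>A quantitative form of membership in \<open>A_space \<alpha>\<close>, with the least
  order \<open>n + 1\<close> that exceeds \<open>\<alpha>\<close>. One constant bounds both the
  function and the derivative, so that uniformity over families can be stated, as the passage to
  infinite products requires.\<close>

definition holder_bounded :: "nat \<Rightarrow> real \<Rightarrow> real \<Rightarrow> (complex \<Rightarrow> complex) \<Rightarrow> bool" where
  "holder_bounded n \<alpha> C f \<longleftrightarrow> f holomorphic_on ball 0 1 \<and> (\<forall>z\<in>ball 0 1. norm (f z) \<le> C) \<and>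
     (\<forall>z\<in>ball 0 1. norm ((deriv ^^ Suc n) f z) \<le> C * (1 - norm z) powr (\<alpha> - real (Suc n)))"

text \<open>The bound on the derivative is integrated along a radius. Both signs of
  \<open>\<beta>\<close> are used: a positive one gives Hoelder continuity up to the circle, a
  negative one the growth of a derivative from that of the next.\<close>

lemma radial_growth:
  fixes g :: "complex \<Rightarrow> complex"
  assumes hol: "g holomorphic_on ball 0 1" and \<beta>: "\<beta> \<noteq> 0"
    and bd: "\<And>z. z \<in> ball 0 1 \<Longrightarrow> norm (deriv g z) \<le> C * (1 - norm z) powr (\<beta> - 1)"
    and z: "z \<in> ball 0 1" and t: "0 \<le> t" "t \<le> 1"
  shows "norm (g z - g (of_real t * z)) \<le> C / \<beta> * ((1 - t * norm z) powr \<beta> - (1 - norm z) powr \<beta>)"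
proof (cases "t = 1")
  case False
  hence t1: "t < 1" using t by simp
  have inb: "of_real x * z \<in> ball 0 1" if "x \<in> {t..1}" for x :: real
  proof -
    have "\<bar>x\<bar> * norm z \<le> 1 * norm z" using that t by (intro mult_right_mono) auto
    thus ?thesis using z by (simp add: norm_mult)
  qed
  have pos: "1 - x * norm z > 0" if "x \<in> {t..1}" for x :: real
    using inb[OF that] that t by (simp add: norm_mult)
  define \<phi> where "\<phi> = (\<lambda>x. - (C / \<beta>) * (1 - x * norm z) powr \<beta>)"
  have "norm (g (of_real 1 * z) - g (of_real t * z)) \<le> \<phi> 1 - \<phi> t"
  proof (rule differentiable_bound_general[OF t1, where f = "\<lambda>x. g (of_real x * z)"
        and f' = "\<lambda>x. deriv g (of_real x * z) * z" and \<phi>' = "\<lambda>x. C * norm z * (1 - x * norm z) powr (\<beta> - 1)"])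
    show "continuous_on {t..1} (\<lambda>x. g (of_real x * z))"
      by (rule continuous_on_compose2[OF holomorphic_on_imp_continuous_on[OF hol]])
         (use inb in \<open>auto intro!: continuous_intros\<close>)
    show "continuous_on {t..1} \<phi>" unfolding \<phi>_def
      by (intro continuous_intros) (use pos in force)
  next
    fix x assume x: "t < x" "x < 1"
    hence xi: "x \<in> {t..1}" by auto
    have D: "(g has_field_derivative deriv g (of_real x * z)) (at (of_real x * z))"
      by (rule holomorphic_derivI[OF hol _ inb[OF xi]]) auto
    have "((\<lambda>u. of_real u * z) has_vector_derivative z) (at x)"
      by (auto intro!: derivative_eq_intros simp: has_vector_derivative_def scaleR_conv_of_real)
    from field_vector_diff_chain_at[OF this D]
    show "((\<lambda>x. g (of_real x * z)) has_vector_derivative deriv g (of_real x * z) * z) (at x)"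
      by (simp add: o_def mult.commute)
    have "(\<phi> has_real_derivative C * norm z * (1 - x * norm z) powr (\<beta> - 1)) (at x)"
      unfolding \<phi>_def using pos[OF xi] \<beta>
      by (auto intro!: derivative_eq_intros)
    thus "(\<phi> has_vector_derivative C * norm z * (1 - x * norm z) powr (\<beta> - 1)) (at x)"
      by (simp add: has_real_derivative_iff_has_vector_derivative)
    have "norm (deriv g (of_real x * z)) \<le> C * (1 - norm (of_real x * z)) powr (\<beta> - 1)"
      by (rule bd[OF inb[OF xi]])
    also have "norm (of_real x * z) = x * norm z" using x t by (simp add: norm_mult)
    finally show "norm (deriv g (of_real x * z) * z) \<le> C * norm z * (1 - x * norm z) powr (\<beta> - 1)"
      unfolding norm_mult using mult_right_mono[of _ _ "norm z"] by (fastforce simp: mult_ac)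
  qed
  thus ?thesis unfolding \<phi>_def by (simp add: algebra_simps)
qed simp

lemma powr_diff_le:
  fixes a b :: real
  assumes "0 \<le> b" "b \<le> a" "0 < \<beta>" "\<beta> \<le> 1"
  shows "a powr \<beta> - b powr \<beta> \<le> (a - b) powr \<beta>"
proof (cases "b = 0 \<or> a = b")
  case False
  hence ab: "0 < b" "b < a" using assms by auto
  have e: "x powr \<beta> = x * x powr (\<beta> - 1)" if "x > 0" for x :: real
    using that by (simp add: powr_diff)
  have "a powr \<beta> = b * a powr (\<beta> - 1) + (a - b) * a powr (\<beta> - 1)"
    using e[of a] ab by (simp add: algebra_simps)
  also have "\<dots> \<le> b * b powr (\<beta> - 1) + (a - b) * (a - b) powr (\<beta> - 1)"
    using ab assms by (intro add_mono mult_left_mono powr_mono2') auto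
  also have "\<dots> = b powr \<beta> + (a - b) powr \<beta>" using e[of b] e[of "a-b"] ab by simp
  finally show ?thesis by simp
qed (use assms in auto)

text \<open>Hardy and Littlewood: move both points radially inwards by their distance.\<close>
lemma holder_of_deriv_bound:
  fixes g :: "complex \<Rightarrow> complex"
  assumes hol: "g holomorphic_on ball 0 1" and \<beta>: "0 < \<beta>" "\<beta> < 1"
    and bd: "\<And>z. z \<in> ball 0 1 \<Longrightarrow> norm (deriv g z) \<le> C * (1 - norm z) powr (\<beta> - 1)"
    and z: "z \<in> ball 0 1" and w: "w \<in> ball 0 1"
  shows "norm (g z - g w) \<le> (2 / \<beta> + 1) * C * norm (z - w) powr \<beta>"
proof (cases "z = w")
  case False
  have C0: "C \<ge> 0" using order_trans[OF norm_ge_zero bd[of 0]] by simp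
  define h where "h = norm (z - w)"
  have h0: "h > 0" using False by (simp add: h_def)
  define t where "t = (if h < 1 then 1 - h else 0)"
  have t: "0 \<le> t" "t \<le> 1" "1 - t \<le> h" using h0 by (auto simp: t_def)
  have rad: "norm (g u - g (of_real t * u)) \<le> C / \<beta> * h powr \<beta>" if u: "u \<in> ball 0 1" for u
  proof -
    have "norm (g u - g (of_real t * u)) \<le> C / \<beta> * ((1 - t * norm u) powr \<beta> - (1 - norm u) powr \<beta>)"
      by (rule radial_growth[OF hol _ bd u]) (use \<beta> t in auto)
    also have "(1 - t * norm u) powr \<beta> - (1 - norm u) powr \<beta> \<le> ((1 - t * norm u) - (1 - norm u)) powr \<beta>"
      using u t \<beta> mult_right_mono[of t 1 "norm u"] by (intro powr_diff_le) auto
    also have "\<dots> \<le> h powr \<beta>"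
    proof (rule powr_mono2)
      have "(1 - t) * norm u \<le> h * 1" using t u h0 by (intro mult_mono) auto
      thus "1 - t * norm u - (1 - norm u) \<le> h" by (simp add: algebra_simps)
      show "0 \<le> 1 - t * norm u - (1 - norm u)" using mult_right_mono[of t 1 "norm u"] t by simp
    qed (use \<beta> in auto)
    finally show ?thesis using C0 \<beta> by (simp add: mult_left_mono divide_right_mono)
  qed
  have mid: "norm (g (of_real t * z) - g (of_real t * w)) \<le> C * h powr \<beta>"
  proof (cases "h < 1")
    case True
    have cb: "cball 0 t \<subseteq> ball (0::complex) 1" using True h0 by (auto simp: t_def)
    have "norm (g (of_real t * z) - g (of_real t * w)) \<le> C * h powr (\<beta> - 1) * norm (of_real t * z - of_real t * w)"
    proof (rule field_differentiable_bound[of "cball 0 t" g "deriv g"])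
      fix x :: complex assume x: "x \<in> cball 0 t"
      thus "(g has_field_derivative deriv g x) (at x within cball 0 t)"
        using cb holomorphic_derivI[OF hol, of x] by (meson has_field_derivative_at_within open_ball subsetD)
      have "norm (deriv g x) \<le> C * (1 - norm x) powr (\<beta> - 1)" using x cb by (intro bd) auto
      also have "\<dots> \<le> C * h powr (\<beta> - 1)"
        using x True h0 \<beta> C0 by (intro mult_left_mono powr_mono2') (auto simp: t_def)
      finally show "norm (deriv g x) \<le> C * h powr (\<beta> - 1)" .
    next
      have m: "norm (of_real t * u) \<le> t" if "u \<in> ball 0 1" for u :: complex
        using that t mult_left_mono[of "norm u" 1 t] by (simp add: norm_mult)
      show "of_real t * z \<in> cball 0 t" "of_real t * w \<in> cball 0 t" using m[OF z] m[OF w] by auto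
    qed auto
    also have "norm (of_real t * z - of_real t * w) = t * h"
      using t by (simp add: h_def norm_mult flip: right_diff_distrib)
    also have "C * h powr (\<beta> - 1) * (t * h) = t * (C * h powr \<beta>)" using h0 by (simp add: powr_diff)
    also have "\<dots> \<le> 1 * (C * h powr \<beta>)" using t C0 by (intro mult_right_mono) auto
    finally show ?thesis by simp
  qed (use C0 in \<open>auto simp: t_def\<close>)
  have "norm (g z - g w) \<le> norm (g z - g (of_real t * z)) + norm (g (of_real t * z) - g (of_real t * w)) + norm (g w - g (of_real t * w))"
    by norm
  also have "\<dots> \<le> C / \<beta> * h powr \<beta> + C * h powr \<beta> + C / \<beta> * h powr \<beta>"
    by (intro add_mono rad mid z w)
  also have "\<dots> = (2 / \<beta> + 1) * C * h powr \<beta>" using \<beta> by (simp add: field_simps)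
  finally show ?thesis by (simp add: h_def)
qed simp

lemma higher_deriv_holomorphic_ball:
  "f holomorphic_on ball (0::complex) 1 \<Longrightarrow> (deriv ^^ k) f holomorphic_on ball 0 1"
  by (intro holomorphic_higher_deriv) auto

lemma Cauchy_estimate:
  fixes f :: "complex \<Rightarrow> complex"
  assumes hol: "f holomorphic_on ball z r" and r: "0 < r" and bd: "\<And>w. w \<in> ball z r \<Longrightarrow> norm (f w) \<le> B"
  shows "norm ((deriv ^^ k) f z) \<le> fact k * B / r ^ k"
proof -
  have ev: "norm ((deriv ^^ k) f z) \<le> fact k * B / s ^ k" if "s \<in> {0<..<r}" for s
    by (rule Cauchy_inequality)
       (use that hol in \<open>auto intro!: holomorphic_on_imp_continuous_on bd simp: dist_norm elim: holomorphic_on_subset\<close>)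
  have "((\<lambda>s. fact k * B / s ^ k) \<longlongrightarrow> fact k * B / r ^ k) (at_left r)"
    using r by (intro tendsto_intros) auto
  moreover have "eventually (\<lambda>s. norm ((deriv ^^ k) f z) \<le> fact k * B / s ^ k) (at_left r)"
    using eventually_at_left_real[OF r] ev by (auto elim: eventually_mono)
  ultimately show ?thesis by (intro tendsto_lowerbound[of "\<lambda>s. fact k * B / s ^ k"]) auto
qed

lemma ball_shrink_subset: "z \<in> ball 0 1 \<Longrightarrow> r \<le> 1 - norm z \<Longrightarrow> ball z r \<subseteq> ball (0::complex) 1"
proof
  fix x assume "z \<in> ball 0 1" "r \<le> 1 - norm z" "x \<in> ball z r"
  thus "x \<in> ball 0 1" using norm_triangle_sub[of x z] by (simp add: dist_norm norm_minus_commute)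
qed

lemma powr_deriv_bound_down:
  assumes hol: "g holomorphic_on ball 0 1" and \<gamma>: "\<gamma> < 0"
    and bd: "\<And>z. z \<in> ball 0 1 \<Longrightarrow> norm (deriv g z) \<le> C * (1 - norm z) powr (\<gamma> - 1)"
    and z: "z \<in> ball 0 1"
  shows "norm (g z) \<le> (norm (g 0) + C / (-\<gamma>)) * (1 - norm z) powr \<gamma>"
proof -
  have C0: "C \<ge> 0" using order_trans[OF norm_ge_zero bd[of 0]] by simp
  have p1: "(1 - norm z) powr \<gamma> \<ge> 1"
    using z \<gamma> powr_mono2'[of \<gamma> "1 - norm z" 1] by auto
  have "norm (g z - g (of_real 0 * z)) \<le> C / \<gamma> * ((1 - 0 * norm z) powr \<gamma> - (1 - norm z) powr \<gamma>)"
    by (rule radial_growth[OF hol _ bd z]) (use \<gamma> in auto)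
  also have "\<dots> = C / (-\<gamma>) * ((1 - norm z) powr \<gamma> - 1)" using \<gamma> by (simp add: field_simps)
  also have "\<dots> \<le> C / (-\<gamma>) * (1 - norm z) powr \<gamma>"
    using C0 \<gamma> by (intro mult_left_mono) (auto simp: divide_nonneg_neg)
  finally have "norm (g z) \<le> norm (g 0) + C / (-\<gamma>) * (1 - norm z) powr \<gamma>"
    using norm_triangle_sub[of "g z" "g 0"] by simp
  also have "\<dots> \<le> norm (g 0) * (1 - norm z) powr \<gamma> + C / (-\<gamma>) * (1 - norm z) powr \<gamma>"
    using p1 mult_left_mono[OF p1, of "norm (g 0)"] by simp
  finally show ?thesis by (simp add: algebra_simps)
qed

lemma higher_deriv_0_bound:
  assumes "f holomorphic_on ball 0 1" "\<And>z. z \<in> ball 0 1 \<Longrightarrow> norm (f z) \<le> C"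
  shows "norm ((deriv ^^ k) f 0) \<le> fact k * C"
  using Cauchy_estimate[of f 0 1 C k] assms by simp

lemma holder_bounded_nonneg: "holder_bounded n \<alpha> C f \<Longrightarrow> 0 \<le> C"
  unfolding holder_bounded_def using norm_ge_zero order_trans by (metis centre_in_ball zero_less_one)

lemma holder_bounded_holomorphic: "holder_bounded n \<alpha> C f \<Longrightarrow> f holomorphic_on ball 0 1"
  by (simp add: holder_bounded_def)

lemma holder_bounded_mono:
  assumes "holder_bounded n \<alpha> C f" "C \<le> C'" shows "holder_bounded n \<alpha> C' f"
proof -
  have "C * (1 - norm z) powr (\<alpha> - real (Suc n)) \<le> C' * (1 - norm z) powr (\<alpha> - real (Suc n))" for z :: complex
    using assms(2) by (intro mult_right_mono) auto
  thus ?thesis using assms unfolding holder_bounded_def by (meson order_trans)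
qed

lemma holder_bounded_cong:
  assumes "holder_bounded n \<alpha> C f" "\<And>z. z \<in> ball 0 1 \<Longrightarrow> f z = g z"
  shows "holder_bounded n \<alpha> C g"
proof -
  have f: "f holomorphic_on ball 0 1" using assms(1) by (rule holder_bounded_holomorphic)
  hence g: "g holomorphic_on ball 0 1" using assms(2) by (rule holomorphic_transform)
  have "(deriv ^^ k) f z = (deriv ^^ k) g z" if "z \<in> ball 0 1" for z k
    by (rule higher_deriv_transform_within_open[OF f g]) (use that assms in auto)
  thus ?thesis using assms g unfolding holder_bounded_def by metis
qed

text \<open>A bounded family is normal, so pointwise convergence becomes locally uniform along a
  subsequence. Convergence of derivatives is claimed along that subsequence only, which suffices to
  pass upper bounds to the limit.\<close>

lemma bounded_pointwise_limit:
  assumes hF: "\<And>k. F k holomorphic_on ball 0 1" and bF: "\<And>k z. z \<in> ball 0 1 \<Longrightarrow> norm (F k z) \<le> C"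
    and lim: "\<And>z. z \<in> ball 0 1 \<Longrightarrow> (\<lambda>k::nat. F k z) \<longlonglongrightarrow> f z"
  shows "f holomorphic_on ball 0 1"
    and "z \<in> ball 0 1 \<Longrightarrow> \<exists>r. (\<lambda>k. (deriv ^^ m) (F (r k)) z) \<longlonglongrightarrow> (deriv ^^ m) f z"
proof -
  obtain g r where g: "g holomorphic_on ball 0 1" "strict_mono (r :: nat \<Rightarrow> nat)"
      "\<And>x. x \<in> ball 0 1 \<Longrightarrow> (\<lambda>n. F (r n) x) \<longlonglongrightarrow> g x"
      "\<And>K. \<lbrakk>compact K; K \<subseteq> ball 0 1\<rbrakk> \<Longrightarrow> uniform_limit K (F \<circ> r) g sequentially"
  proof (rule Montel[of "ball 0 1" "range F" F])
    show "\<exists>B. \<forall>h\<in>range F. \<forall>z\<in>K. norm (h z) \<le> B" if "compact K" "K \<subseteq> ball 0 1" for K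
      using bF that by (intro exI[of _ C]) auto
  qed (use hF in auto)
  have fg: "g z = f z" if "z \<in> ball 0 1" for z
    using LIMSEQ_unique[OF g(3)[OF that]] LIMSEQ_subseq_LIMSEQ[OF lim[OF that] g(2)] by (simp add: o_def)
  show hf: "f holomorphic_on ball 0 1" using g(1) fg by (rule holomorphic_transform)
  show "\<exists>r. (\<lambda>k. (deriv ^^ m) (F (r k)) z) \<longlonglongrightarrow> (deriv ^^ m) f z" if z: "z \<in> ball 0 1"
  proof -
    obtain e where e: "e > 0" "cball z e \<subseteq> ball 0 1" using z open_contains_cball by (metis open_ball)
    have "uniform_limit (ball z e) (F \<circ> r) g sequentially"
      by (rule uniform_limit_on_subset[OF g(4)[of "cball z e"]]) (use e in auto)
    hence "(\<lambda>k. (deriv ^^ m) ((F \<circ> r) k) z) \<longlonglongrightarrow> (deriv ^^ m) g z"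
      by (rule higher_deriv_complex_uniform_limit)
         (use e ball_subset_cball[of z e] in \<open>auto intro!: always_eventually holomorphic_on_subset[OF hF]\<close>)
    moreover have "(deriv ^^ m) g z = (deriv ^^ m) f z"
      by (rule higher_deriv_transform_within_open[OF g(1) hf _ z fg]) auto
    ultimately show ?thesis by auto
  qed
qed

section \<open>Whitney estimates, products and limits in \<open>A_space \<alpha>\<close>\<close>

locale holder_exponent =
  fixes n :: nat and \<alpha> :: real
  assumes n_pos: "1 \<le> n" and n_less: "real n < \<alpha>" and less_Suc_n: "\<alpha> < real n + 1"
begin

abbreviation hb :: "real \<Rightarrow> (complex \<Rightarrow> complex) \<Rightarrow> bool" where "hb \<equiv> holder_bounded n \<alpha>"

lemma hb_top_holder:
  assumes "hb C f" "z \<in> ball 0 1" "w \<in> ball 0 1"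
  shows "norm ((deriv ^^ n) f z - (deriv ^^ n) f w) \<le> (2 / (\<alpha> - n) + 1) * C * norm (z - w) powr (\<alpha> - n)"
proof (rule holder_of_deriv_bound)
  show "norm (deriv ((deriv ^^ n) f) z) \<le> C * (1 - norm z) powr (\<alpha> - real n - 1)" if "z \<in> ball 0 1" for z
    using assms(1) that by (simp add: holder_bounded_def algebra_simps)
qed (use assms n_less less_Suc_n in \<open>auto simp: holder_bounded_def higher_deriv_holomorphic_ball\<close>)

lemma hb_derivs_bounded:
  "\<exists>K>0. \<forall>C f. hb C f \<longrightarrow> (\<forall>i\<le>n. \<forall>z\<in>ball 0 1. norm ((deriv ^^ i) f z) \<le> K * C)"
proof -
  \<comment> \<open>Downwards from order \<open>n\<close>: the Hoelder bound of the top derivative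
    is the start, and each step integrates once from \<open>0\<close>, adding the Cauchy bound
    \<open>fact j\<close> for the value there.\<close>
  define K where "K i = (2 / (\<alpha> - n) + 1) + (\<Sum>j=i..n. fact j)" for i
  have K: "norm ((deriv ^^ i) f z) \<le> K i * C" if f: "hb C f" and "i \<le> n" "z \<in> ball 0 1" for C f i z
    using that(2,3)
  proof (induction i arbitrary: z rule: inc_induct)
    case base
    have "norm ((deriv ^^ n) f z - (deriv ^^ n) f 0) \<le> (2 / (\<alpha> - n) + 1) * C * norm (z - 0) powr (\<alpha> - n)"
      by (rule hb_top_holder[OF f]) (use base in auto)
    also have "\<dots> \<le> (2 / (\<alpha> - n) + 1) * C * 1"
      using holder_bounded_nonneg[OF f] n_less base by (intro mult_left_mono powr_le1) auto
    finally have "norm ((deriv ^^ n) f z) \<le> norm ((deriv ^^ n) f 0) + (2 / (\<alpha> - n) + 1) * C"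
      using norm_triangle_sub[of "(deriv ^^ n) f z" "(deriv ^^ n) f 0"] by simp
    also have "norm ((deriv ^^ n) f 0) \<le> fact n * C"
      by (rule higher_deriv_0_bound) (use f in \<open>auto simp: holder_bounded_def\<close>)
    finally show ?case by (simp add: K_def algebra_simps)
  next
    case (step m)
    have "norm ((deriv ^^ m) f z - (deriv ^^ m) f 0) \<le> (K (Suc m) * C) * norm (z - 0)"
    proof (rule field_differentiable_bound[of "ball 0 1" _ "(deriv ^^ Suc m) f"])
      show "((deriv ^^ m) f has_field_derivative (deriv ^^ Suc m) f x) (at x within ball 0 1)" if "x \<in> ball 0 1" for x
        using holomorphic_derivI[OF higher_deriv_holomorphic_ball[OF holder_bounded_holomorphic[OF f]] _ that, of m] by simp
    qed (use step in auto)
    also have "\<dots> \<le> (K (Suc m) * C) * 1"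
      using step.prems step.IH[of 0] norm_ge_zero[of "(deriv ^^ Suc m) f 0"] by (intro mult_left_mono) (auto simp del: norm_ge_zero)
    finally have "norm ((deriv ^^ m) f z) \<le> norm ((deriv ^^ m) f 0) + K (Suc m) * C"
      using norm_triangle_sub[of "(deriv ^^ m) f z" "(deriv ^^ m) f 0"] by simp
    also have "norm ((deriv ^^ m) f 0) \<le> fact m * C"
      by (rule higher_deriv_0_bound) (use f in \<open>auto simp: holder_bounded_def\<close>)
    also have "fact m * C + K (Suc m) * C = K m * C"
      using step.hyps by (simp add: K_def sum.atLeast_Suc_atMost[of m n] algebra_simps)
    finally show ?case by simp
  qed
  have Kmono: "K i \<le> K 0" if "i \<le> n" for i
    unfolding K_def using that by (intro add_left_mono sum_mono2) auto
  have "K 0 > 0" unfolding K_def using n_less by (intro add_pos_nonneg sum_nonneg) auto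
  moreover have "norm ((deriv ^^ i) f z) \<le> K 0 * C" if "hb C f" and "i \<le> n" "z \<in> ball 0 1" for C f i z
    using K[OF that] Kmono[OF that(2)] mult_right_mono[OF _ holder_bounded_nonneg[OF that(1)]] by (meson order_trans)
  ultimately show ?thesis by blast
qed

lemma hb_whitney:
  "\<exists>K>0. \<forall>C f. hb C f \<longrightarrow> (\<forall>s\<le>n. \<forall>z\<in>ball 0 1. \<forall>w\<in>ball 0 1.
     norm ((deriv ^^ s) f w - (\<Sum>m\<le>n - s. (deriv ^^ (s + m)) f z / fact m * (w - z) ^ m))
       \<le> K * C * norm (w - z) powr (\<alpha> - s))"
proof -
  define K where "K = 2 / (\<alpha> - n) + 1"
  have K0: "K > 0" unfolding K_def using n_less by (intro add_nonneg_pos) auto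
  have "norm ((deriv ^^ s) f w - (\<Sum>m\<le>n - s. (deriv ^^ (s + m)) f z / fact m * (w - z) ^ m))
       \<le> K * C * norm (w - z) powr (\<alpha> - s)"
    if f: "hb C f" and s: "s \<le> n" and z: "z \<in> ball 0 1" and w: "w \<in> ball 0 1" for C f s z w
  proof (cases "s = n")
    case True
    thus ?thesis using hb_top_holder[OF f w z] by (simp add: K_def)
  next
    case False
    define N where "N = n - s - 1"
    have nN: "n = s + Suc N" "n - s = Suc N" using s False by (auto simp: N_def)
    have C0: "C \<ge> 0" by (rule holder_bounded_nonneg[OF f])
    \<comment> \<open>The term of order \<open>n\<close> is removed beforehand. Taylor's formula of
      order \<open>N = n - s - 1\<close> then has as its top derivative the difference of
      \<open>(deriv ^^ n) f\<close> at \<open>x\<close> and at \<open>z\<close>, which the Hoelder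
      bound makes small; the derivatives up to order \<open>N\<close> at \<open>z\<close> are
      unchanged.\<close>
    define F where "F i x = (deriv ^^ (s + i)) f x - (deriv ^^ n) f z * ((x - z) ^ (Suc N - i) / fact (Suc N - i))" for i x
    define S where "S = closed_segment z w"
    have Sb: "S \<subseteq> ball 0 1" unfolding S_def using z w by (intro closed_segment_subset) auto
    have "norm (F 0 w - (\<Sum>i\<le>N. F i z * (w - z) ^ i / fact i)) \<le> (K * C * norm (w - z) powr (\<alpha> - n)) * norm (w - z) ^ Suc N / fact N"
    proof (rule field_Taylor[of S N F])
      fix i x assume x: "x \<in> S" and i: "i \<le> N"
      have Si: "Suc N - i = Suc (N - i)" using i by simp
      have "((deriv ^^ (s + i)) f has_field_derivative (deriv ^^ Suc (s + i)) f x) (at x)"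
        using holomorphic_derivI[OF higher_deriv_holomorphic_ball[OF holder_bounded_holomorphic[OF f]], of x "s + i"] x Sb by auto
      moreover have "((\<lambda>x. (x - z) ^ Suc (N - i) / fact (Suc (N - i))) has_field_derivative (x - z) ^ (N - i) / fact (N - i)) (at x)"
      proof -
        have "((\<lambda>x. (x - z) ^ Suc (N - i)) has_field_derivative of_nat (Suc (N - i)) * (x - z) ^ (N - i)) (at x)"
          by (rule DERIV_cong[OF DERIV_power]) (auto intro!: derivative_eq_intros)
        from DERIV_cdivide[OF this, of "fact (Suc (N - i))"] show ?thesis
          by (rule DERIV_cong) (simp add: fact_Suc del: of_nat_Suc)
      qed
      ultimately have "(F i has_field_derivative (deriv ^^ Suc (s + i)) f x - (deriv ^^ n) f z * ((x - z) ^ (N - i) / fact (N - i))) (at x)"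
        unfolding F_def Si by (intro DERIV_diff DERIV_cmult)
      thus "(F i has_field_derivative F (Suc i) x) (at x within S)"
        unfolding F_def by (simp add: has_field_derivative_at_within)
    next
      fix x assume x: "x \<in> S"
      have "norm (F (Suc N) x) = norm ((deriv ^^ n) f x - (deriv ^^ n) f z)" by (simp add: F_def nN)
      also have "\<dots> \<le> K * C * norm (x - z) powr (\<alpha> - n)"
        unfolding K_def by (rule hb_top_holder[OF f]) (use x Sb z in auto)
      also have "\<dots> \<le> K * C * norm (w - z) powr (\<alpha> - n)"
        using C0 K0 n_less x segment_bound(1)[of x z w]
        by (intro mult_left_mono powr_mono2) (auto simp: S_def norm_minus_commute)
      finally show "norm (F (Suc N) x) \<le> K * C * norm (w - z) powr (\<alpha> - n)" .
    qed (auto simp: S_def)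
    also have "\<dots> \<le> (K * C * norm (w - z) powr (\<alpha> - n)) * norm (w - z) ^ Suc N / 1"
      using K0 C0 by (intro divide_left_mono mult_nonneg_nonneg) (auto simp: fact_ge_1)
    also have "\<dots> = K * C * (norm (w - z) powr (\<alpha> - n) * norm (w - z) ^ Suc N)" by simp
    also have "norm (w - z) powr (\<alpha> - n) * norm (w - z) ^ Suc N = norm (w - z) powr (\<alpha> - s)"
    proof (cases "w = z")
      case False
      have "norm (w - z) powr (\<alpha> - n) * norm (w - z) ^ Suc N = norm (w - z) powr (\<alpha> - n) * norm (w - z) powr (real (Suc N))"
        using False by (subst powr_realpow) auto
      also have "\<dots> = norm (w - z) powr (\<alpha> - s)"
        unfolding powr_add[symmetric] using nN by simp
      finally show ?thesis .
    qed simp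
    also have "F 0 w - (\<Sum>i\<le>N. F i z * (w - z) ^ i / fact i) =
        (deriv ^^ s) f w - (\<Sum>m\<le>n - s. (deriv ^^ (s + m)) f z / fact m * (w - z) ^ m)"
    proof -
      have "F i z = (deriv ^^ (s + i)) f z" if "i \<le> N" for i using that by (simp add: F_def)
      hence "(\<Sum>i\<le>N. F i z * (w - z) ^ i / fact i) = (\<Sum>i\<le>N. (deriv ^^ (s + i)) f z / fact i * (w - z) ^ i)"
        by (intro sum.cong) auto
      thus ?thesis by (simp add: F_def nN)
    qed
    finally show ?thesis .
  qed
  thus ?thesis using K0 by blast
qed

text \<open>Division is proved through the derivative of order \<open>n + 2\<close>. Its Cauchy
  kernel has order \<open>n + 3\<close>, and \<open>\<alpha> - (n + 3)\<close> splits into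
  \<open>-2\<close>, the order of the Poisson kernel, and the negative exponent
  \<open>\<alpha> - (n + 1)\<close>, controlled by the distance of the contour. With one derivative
  less that exponent would be positive. Radial integration recovers order
  \<open>n + 1\<close>.\<close>

lemma hb_of_Suc_deriv:
  "\<exists>K>0. \<forall>C f. f holomorphic_on ball 0 1 \<and> (\<forall>z\<in>ball 0 1. norm (f z) \<le> C) \<and>
     (\<forall>z\<in>ball 0 1. norm ((deriv ^^ Suc (Suc n)) f z) \<le> C * (1 - norm z) powr (\<alpha> - real (Suc (Suc n)))) \<longrightarrow> hb (K * C) f"
proof -
  define K where "K = fact (Suc n) + 1 / (Suc n - \<alpha>)"
  have K1: "K \<ge> 1" unfolding K_def using less_Suc_n fact_ge_1[of "Suc n", where 'a = real] by (simp add: add_increasing2)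
  have "hb (K * C) f" if hol: "f holomorphic_on ball 0 1" and C: "\<And>z. z\<in>ball 0 1 \<Longrightarrow> norm (f z) \<le> C"
    and d: "\<And>z. z\<in>ball 0 1 \<Longrightarrow> norm ((deriv ^^ Suc (Suc n)) f z) \<le> C * (1 - norm z) powr (\<alpha> - real (Suc (Suc n)))" for C f
  proof -
    have C0: "C \<ge> 0" using order_trans[OF norm_ge_zero C[of 0]] by simp
    show ?thesis unfolding holder_bounded_def
    proof (intro conjI ballI hol)
      fix z :: complex assume z: "z \<in> ball 0 1"
      show "norm (f z) \<le> K * C" using C[OF z] mult_right_mono[OF K1 C0] by simp
      have "norm ((deriv ^^ Suc n) f z) \<le> (norm ((deriv ^^ Suc n) f 0) + C / (-(\<alpha> - Suc n))) * (1 - norm z) powr (\<alpha> - Suc n)"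
      proof (rule powr_deriv_bound_down[OF higher_deriv_holomorphic_ball[OF hol] _ _ z])
        show "norm (deriv ((deriv ^^ Suc n) f) z) \<le> C * (1 - norm z) powr (\<alpha> - Suc n - 1)" if "z \<in> ball 0 1" for z
          using d[OF that] by (simp add: algebra_simps)
      qed (use less_Suc_n in auto)
      also have "\<dots> \<le> (fact (Suc n) * C + C / (-(\<alpha> - Suc n))) * (1 - norm z) powr (\<alpha> - Suc n)"
        by (intro mult_right_mono add_right_mono higher_deriv_0_bound hol C) auto
      also have "fact (Suc n) * C + C / (-(\<alpha> - Suc n)) = K * C" by (simp add: K_def algebra_simps)
      finally show "norm ((deriv ^^ Suc n) f z) \<le> K * C * (1 - norm z) powr (\<alpha> - real (Suc n))" .
    qed
  qed
  thus ?thesis using K1 by (intro exI[of _ K]) auto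
qed

text \<open>The definition admits any \<open>m > \<alpha>\<close>. Radial integration brings
  \<open>m\<close> down to \<open>n + 1\<close>, all exponents \<open>\<alpha> - k\<close> on the
  way being negative.\<close>

lemma A_space_iff: "f \<in> A_space \<alpha> \<longleftrightarrow> (\<exists>C. hb C f)"
proof
  assume "f \<in> A_space \<alpha>"
  then obtain m C where hol: "f holomorphic_on ball 0 1" and b: "bounded (f ` ball 0 1)" and m: "real m > \<alpha>"
    and C: "\<And>z. z\<in>ball 0 1 \<Longrightarrow> norm ((deriv ^^ m) f z) \<le> C * (1 - norm z) powr (\<alpha> - real m)"
    unfolding A_space_def H_infinity_def by blast
  obtain C0 where C0: "\<And>z. z\<in>ball 0 1 \<Longrightarrow> norm (f z) \<le> C0" using b unfolding bounded_iff by blast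
  have "Suc n \<le> m" using m n_less by linarith
  hence "\<exists>C. \<forall>z\<in>ball 0 1. norm ((deriv ^^ Suc n) f z) \<le> C * (1 - norm z) powr (\<alpha> - real (Suc n))"
  proof (rule inc_induct)
    show "\<exists>C. \<forall>z\<in>ball 0 1. norm ((deriv ^^ m) f z) \<le> C * (1 - norm z) powr (\<alpha> - real m)"
      using C by blast
  next
    fix k assume k: "Suc n \<le> k"
    assume "\<exists>C. \<forall>z\<in>ball 0 1. norm ((deriv ^^ Suc k) f z) \<le> C * (1 - norm z) powr (\<alpha> - real (Suc k))"
    then obtain C' where C': "\<And>z. z\<in>ball 0 1 \<Longrightarrow> norm ((deriv ^^ Suc k) f z) \<le> C' * (1 - norm z) powr (\<alpha> - real (Suc k))" by blast
    have "norm ((deriv ^^ k) f z) \<le> (norm ((deriv ^^ k) f 0) + C' / (-(\<alpha> - k))) * (1 - norm z) powr (\<alpha> - k)"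
      if z: "z \<in> ball 0 1" for z
    proof (rule powr_deriv_bound_down[OF higher_deriv_holomorphic_ball[OF hol] _ _ z])
      show "norm (deriv ((deriv ^^ k) f) z) \<le> C' * (1 - norm z) powr (\<alpha> - k - 1)" if "z \<in> ball 0 1" for z
        using C'[OF that] by (simp add: algebra_simps)
      show "\<alpha> - k < 0" using less_Suc_n k by linarith
    qed
    thus "\<exists>C. \<forall>z\<in>ball 0 1. norm ((deriv ^^ k) f z) \<le> C * (1 - norm z) powr (\<alpha> - real k)" by blast
  qed
  then obtain C1 where C1: "\<And>z. z\<in>ball 0 1 \<Longrightarrow> norm ((deriv ^^ Suc n) f z) \<le> C1 * (1 - norm z) powr (\<alpha> - real (Suc n))" by blast
  have "hb (max C0 C1) f" unfolding holder_bounded_def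
  proof (intro conjI ballI hol)
    fix z :: complex assume z: "z \<in> ball 0 1"
    show "norm (f z) \<le> max C0 C1" using C0[OF z] by simp
    have "C1 * (1 - norm z) powr (\<alpha> - real (Suc n)) \<le> max C0 C1 * (1 - norm z) powr (\<alpha> - real (Suc n))"
      by (intro mult_right_mono) auto
    thus "norm ((deriv ^^ Suc n) f z) \<le> max C0 C1 * (1 - norm z) powr (\<alpha> - real (Suc n))"
      using C1[OF z] by linarith
  qed
  thus "\<exists>C. hb C f" by blast
next
  assume "\<exists>C. hb C f"
  then obtain C where "hb C f" by blast
  moreover have "\<alpha> < real (Suc n)" using less_Suc_n by simp
  ultimately show "f \<in> A_space \<alpha>"
    unfolding A_space_def H_infinity_def holder_bounded_def bounded_iff by blast
qed

lemma hb_add: assumes "hb C f" "hb C' g" shows "hb (C + C') (\<lambda>z. f z + g z)"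
  unfolding holder_bounded_def
proof (intro conjI ballI)
  fix z :: complex assume z: "z \<in> ball 0 1"
  show "norm (f z + g z) \<le> C + C'"
    using assms z unfolding holder_bounded_def by (meson add_mono norm_triangle_ineq order_trans)
  have "(deriv ^^ Suc n) (\<lambda>z. f z + g z) z = (deriv ^^ Suc n) f z + (deriv ^^ Suc n) g z"
    by (rule higher_deriv_add) (use assms z in \<open>auto simp: holder_bounded_def\<close>)
  thus "norm ((deriv ^^ Suc n) (\<lambda>z. f z + g z) z) \<le> (C + C') * (1 - norm z) powr (\<alpha> - real (Suc n))"
    using assms z norm_triangle_ineq[of "(deriv ^^ Suc n) f z" "(deriv ^^ Suc n) g z"]
    unfolding holder_bounded_def by (fastforce simp: distrib_right)
qed (use assms in \<open>auto simp: holder_bounded_def intro!: holomorphic_intros\<close>)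

text \<open>In Leibniz' formula only the two extreme terms contain a derivative of order
  \<open>n + 1\<close>; all other factors are bounded, and a bounded term is harmless because the
  weight \<open>p\<close> is at least \<open>1\<close>.\<close>

lemma hb_mult: assumes "hb C f" "hb C' g" shows "\<exists>C''. hb C'' (\<lambda>z. f z * g z)"
proof -
  have hf: "f holomorphic_on ball 0 1" and hg: "g holomorphic_on ball 0 1"
    using assms by (auto simp: holder_bounded_def)
  obtain K where K: "K > 0" "\<And>C f i z. hb C f \<Longrightarrow> i \<le> n \<Longrightarrow> z \<in> ball 0 1 \<Longrightarrow> norm ((deriv ^^ i) f z) \<le> K * C"
    using hb_derivs_bounded by blast
  define M where "M = (K + 1) * (C + C')"
  have C0: "C \<ge> 0" "C' \<ge> 0" using holder_bounded_nonneg assms by auto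
  have KC: "K * C \<le> M" "K * C' \<le> M" "C \<le> M" "C' \<le> M" unfolding M_def using K C0 by (auto simp: algebra_simps add_increasing)
  have M0: "M \<ge> 0" using KC C0 by linarith
  define p where "p z = (1 - norm z) powr (\<alpha> - real (Suc n))" for z :: complex
  have p1: "p z \<ge> 1" if "z \<in> ball 0 1" for z
    unfolding p_def using that less_Suc_n powr_mono2'[of "\<alpha> - real (Suc n)" "1 - norm z" 1] by auto
  have b: "norm ((deriv ^^ i) f z) \<le> M" "norm ((deriv ^^ i) g z) \<le> M" if "i \<le> n" "z \<in> ball 0 1" for i z
    using K(2)[OF assms(1) that] K(2)[OF assms(2) that] KC by auto
  have t: "norm ((deriv ^^ Suc n) f z) \<le> M * p z" "norm ((deriv ^^ Suc n) g z) \<le> M * p z" if "z \<in> ball 0 1" for z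
    using assms that KC p1[OF that] mult_right_mono[of _ M "p z"] unfolding holder_bounded_def p_def
    by (fastforce intro: order_trans)+
  define M2 where "M2 = 2 ^ Suc n * (M * M)"
  have "hb M2 (\<lambda>z. f z * g z)" unfolding holder_bounded_def
  proof (intro conjI ballI)
    fix z :: complex assume z: "z \<in> ball 0 1"
    have one: "1 * (M * M) \<le> M2" unfolding M2_def using M0 by (intro mult_right_mono one_le_power) auto
    have "norm (f z * g z) \<le> M * M" unfolding norm_mult using b[of 0 z] z M0 by (intro mult_mono) auto
    thus "norm (f z * g z) \<le> M2" using one by simp
    have "(deriv ^^ Suc n) (\<lambda>w. f w * g w) z =
           (\<Sum>i = 0..Suc n. of_nat (Suc n choose i) * (deriv ^^ i) f z * (deriv ^^ (Suc n - i)) g z)"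
      by (rule higher_deriv_mult[OF hf hg]) (use z in auto)
    also have "norm \<dots> \<le> (\<Sum>i = 0..Suc n. real (Suc n choose i) * (M * M * p z))"
    proof (rule sum_norm_le)
      fix i assume i: "i \<in> {0..Suc n}"
      have "norm ((deriv ^^ i) f z) * norm ((deriv ^^ (Suc n - i)) g z) \<le> M * M * p z"
      proof -
        consider "i = 0" | "i = Suc n" | "i \<le> n" "Suc n - i \<le> n" using i by fastforce
        thus ?thesis
        proof cases
          case 1 thus ?thesis using b(1)[of 0 z] t(2)[of z] z M0 mult_mono[OF b(1)[of 0 z] t(2)[of z]] by (simp add: mult_ac)
        next
          case 2 thus ?thesis using b(2)[of 0 z] t(1)[of z] z M0 p1[OF z] mult_mono[OF t(1)[of z] b(2)[of 0 z]] by (simp add: mult_ac)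
        next
          case 3
          have "norm ((deriv ^^ i) f z) * norm ((deriv ^^ (Suc n - i)) g z) \<le> M * M"
            using b 3 z M0 by (intro mult_mono) auto
          also have "M * M * 1 \<le> M * M * p z" using M0 p1[OF z] by (intro mult_left_mono) auto
          finally show ?thesis by simp
        qed
      qed
      hence "real (Suc n choose i) * (norm ((deriv ^^ i) f z) * norm ((deriv ^^ (Suc n - i)) g z)) \<le> real (Suc n choose i) * (M * M * p z)"
        by (rule mult_left_mono) simp
      thus "norm (of_nat (Suc n choose i) * (deriv ^^ i) f z * (deriv ^^ (Suc n - i)) g z) \<le> real (Suc n choose i) * (M * M * p z)"
        by (simp only: norm_mult norm_of_nat mult.assoc)
    qed
    also have "\<dots> = M2 * p z"
    proof -
      have "(\<Sum>i = 0..Suc n. real (Suc n choose i)) = 2 ^ Suc n"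
        using choose_row_sum[of "Suc n"] by (simp add: atMost_atLeast0 flip: of_nat_sum)
      thus ?thesis unfolding M2_def sum_distrib_right[symmetric] by simp
    qed
    finally show "norm ((deriv ^^ Suc n) (\<lambda>z. f z * g z) z) \<le> M2 * (1 - norm z) powr (\<alpha> - real (Suc n))" 
      unfolding p_def .
  qed (use hf hg in \<open>auto intro!: holomorphic_intros\<close>)
  thus ?thesis by blast
qed

lemma hb_const: "hb (norm c) (\<lambda>_. c)"
  unfolding holder_bounded_def by simp

lemma hb_limit:
  assumes F: "\<And>k. hb C (F k)" and lim: "\<And>z. z \<in> ball 0 1 \<Longrightarrow> (\<lambda>k. F k z) \<longlonglongrightarrow> f z"
  shows "hb C f"
  unfolding holder_bounded_def
proof (intro conjI ballI)
  note bl = bounded_pointwise_limit[of F C f, OF _ _ lim]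
  show "f holomorphic_on ball 0 1" by (rule bl(1)) (use F in \<open>auto simp: holder_bounded_def\<close>)
  fix z :: complex assume z: "z \<in> ball 0 1"
  show "norm (f z) \<le> C"
    by (rule LIMSEQ_le_const2[OF tendsto_norm[OF lim[OF z]]]) (use F z in \<open>auto simp: holder_bounded_def\<close>)
  have "\<exists>r. (\<lambda>k. (deriv ^^ Suc n) (F (r k)) z) \<longlonglongrightarrow> (deriv ^^ Suc n) f z"
    by (rule bl(2)) (use F z in \<open>auto simp: holder_bounded_def\<close>)
  then obtain r where r: "(\<lambda>k. (deriv ^^ Suc n) (F (r k)) z) \<longlonglongrightarrow> (deriv ^^ Suc n) f z" by blast
  show "norm ((deriv ^^ Suc n) f z) \<le> C * (1 - norm z) powr (\<alpha> - real (Suc n))"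
    by (rule LIMSEQ_le_const2[OF tendsto_norm[OF r]]) (use F z in \<open>auto simp: holder_bounded_def\<close>)
qed

end

section \<open>Taylor polynomials and division\<close>

definition taylor_poly :: "nat \<Rightarrow> (complex \<Rightarrow> complex) \<Rightarrow> complex \<Rightarrow> complex \<Rightarrow> complex" where
  "taylor_poly n f z v = (\<Sum>m\<le>n. (deriv ^^ m) f z / fact m * (v - z) ^ m)"

lemma taylor_poly_holomorphic [holomorphic_intros]: "taylor_poly n f z holomorphic_on S"
  unfolding taylor_poly_def by (intro holomorphic_intros)

text \<open>The new coefficients are Taylor sums at \<open>w\<close> of the derivatives of
  \<open>f\<close>, the very expressions that the Whitney estimate compares with those
  derivatives.\<close>

lemma taylor_poly_recenter:
  "taylor_poly n f z v = (\<Sum>s\<le>n. (\<Sum>m\<le>n - s. (deriv ^^ (s + m)) f z / fact m * (w - z) ^ m) / fact s * (v - w) ^ s)"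
proof -
  define t where "t s m = (deriv ^^ (s + m)) f z / fact m * (w - z) ^ m / fact s * (v - w) ^ s" for s m
  have "taylor_poly n f z v = (\<Sum>k\<le>n. \<Sum>s\<le>k. t s (k - s))"
    unfolding taylor_poly_def
  proof (intro sum.cong refl)
    fix k
    have "(v - z) ^ k = ((v - w) + (w - z)) ^ k" by simp
    also have "\<dots> = (\<Sum>s\<le>k. of_nat (k choose s) * (v - w) ^ s * (w - z) ^ (k - s))" by (rule binomial_ring)
    finally have "(deriv ^^ k) f z / fact k * (v - z) ^ k =
        (\<Sum>s\<le>k. (deriv ^^ k) f z / fact k * (of_nat (k choose s) * (v - w) ^ s * (w - z) ^ (k - s)))"
      by (simp add: sum_distrib_left)
    also have "\<dots> = (\<Sum>s\<le>k. t s (k - s))"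
    proof (intro sum.cong refl)
      fix s assume "s \<in> {..k}"
      thus "(deriv ^^ k) f z / fact k * (of_nat (k choose s) * (v - w) ^ s * (w - z) ^ (k - s)) = t s (k - s)"
        by (simp add: t_def binomial_fact mult_ac)
    qed
    finally show "(deriv ^^ k) f z / fact k * (v - z) ^ k = (\<Sum>s\<le>k. t s (k - s))" .
  qed
  also have "\<dots> = sum (\<lambda>(i,j). t i j) {(i,j). i + j \<le> n}" by (rule sum.triangle_reindex_eq[symmetric])
  also have "{(i,j). i + j \<le> n} = Sigma {..n} (\<lambda>s. {..n - s})" by auto
  also have "sum (\<lambda>(i,j). t i j) \<dots> = (\<Sum>s\<le>n. \<Sum>m\<le>n - s. t s m)" by (subst sum.Sigma) auto
  also have "\<dots> = (\<Sum>s\<le>n. (\<Sum>m\<le>n - s. (deriv ^^ (s + m)) f z / fact m * (w - z) ^ m) / fact s * (v - w) ^ s)"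
    by (simp add: t_def sum_distrib_right sum_divide_distrib)
  finally show ?thesis .
qed

lemma taylor_poly_decay:
  assumes z: "norm z < 1"
  shows "\<exists>A\<ge>0. \<forall>u. 2 \<le> norm u \<longrightarrow> norm (taylor_poly n f z u / (u - z) ^ (n + j)) \<le> A / norm u ^ j"
proof -
  define A where "A = (\<Sum>m\<le>n. norm ((deriv ^^ m) f z / fact m))"
  have A0: "A \<ge> 0" unfolding A_def by (rule sum_nonneg) auto
  have "norm (taylor_poly n f z u / (u - z) ^ (n + j)) \<le> (A * 2 ^ j) / norm u ^ j" if u: "2 \<le> norm u" for u
  proof -
    have uz: "norm (u - z) \<ge> norm u / 2" "norm (u - z) \<ge> 1" using norm_triangle_ineq2[of u z] u z by linarith+
    have "norm (taylor_poly n f z u) \<le> (\<Sum>m\<le>n. norm ((deriv ^^ m) f z / fact m) * norm (u - z) ^ n)"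
      unfolding taylor_poly_def
    proof (rule sum_norm_le)
      fix m assume "m \<in> {..n}"
      hence "norm (u - z) ^ m \<le> norm (u - z) ^ n" using uz by (intro power_increasing) auto
      thus "norm ((deriv ^^ m) f z / fact m * (u - z) ^ m) \<le> norm ((deriv ^^ m) f z / fact m) * norm (u - z) ^ n"
        unfolding norm_mult norm_power by (rule mult_left_mono) simp
    qed
    also have "\<dots> = A * norm (u - z) ^ n" by (simp add: A_def sum_distrib_right)
    finally have "norm (taylor_poly n f z u / (u - z) ^ (n + j)) \<le> A * norm (u - z) ^ n / norm (u - z) ^ (n + j)"
      unfolding norm_divide norm_power by (rule divide_right_mono) simp
    also have "\<dots> = A / norm (u - z) ^ j" using uz(2) by (cases "u = z") (simp_all add: power_add)
    also have "\<dots> \<le> A / (norm u / 2) ^ j" using A0 uz u by (intro divide_left_mono power_mono mult_pos_pos) (auto intro!: zero_less_power)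
    finally show ?thesis by (simp add: power_divide)
  qed
  thus ?thesis using A0 by (intro exI[of _ "A * 2 ^ j"]) auto
qed

text \<open>The model case is \<open>\<gamma> = 1 / b\<close> for a finite Blaschke product \<open>b\<close>, which outside the disc
  plays the role of the boundary values of the conjugate of \<open>b\<close>.\<close>
definition exterior_multiplier :: "real \<Rightarrow> (complex \<Rightarrow> complex) \<Rightarrow> bool" where
  "exterior_multiplier \<rho> \<gamma> \<longleftrightarrow> 0 \<le> \<rho> \<and> \<rho> < 1 \<and> \<gamma> holomorphic_on {\<zeta>. \<rho> < norm \<zeta>} \<and> (\<forall>\<zeta>. \<rho> < norm \<zeta> \<longrightarrow> norm (\<gamma> \<zeta>) \<le> 2)"

context holder_exponent
begin

abbreviation tp :: "(complex \<Rightarrow> complex) \<Rightarrow> complex \<Rightarrow> complex \<Rightarrow> complex" where "tp \<equiv> taylor_poly n"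

lemma hb_taylor:
  "\<exists>K>0. \<forall>C f z w. hb C f \<longrightarrow> z \<in> ball 0 1 \<longrightarrow> w \<in> ball 0 1 \<longrightarrow> norm (f w - tp f z w) \<le> K * C * norm (w - z) powr \<alpha>"
proof -
  obtain K where K: "K > 0" "\<And>C f s z w. hb C f \<Longrightarrow> s \<le> n \<Longrightarrow> z \<in> ball 0 1 \<Longrightarrow> w \<in> ball 0 1 \<Longrightarrow>
     norm ((deriv ^^ s) f w - (\<Sum>m\<le>n - s. (deriv ^^ (s + m)) f z / fact m * (w - z) ^ m))
       \<le> K * C * norm (w - z) powr (\<alpha> - s)" using hb_whitney by blast
  show ?thesis using K(1) K(2)[where s = 0] by (intro exI[of _ K]) (auto simp: taylor_poly_def)
qed

text \<open>The point \<open>v\<close> may lie outside the disc, where \<open>f\<close> has no value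
  and the polynomials stand for it. They are compared coefficient by coefficient after recentring at
  \<open>w\<close>.\<close>

lemma hb_taylor_compare:
  "\<exists>K>0. \<forall>C f z w v. hb C f \<longrightarrow> z \<in> ball 0 1 \<longrightarrow> w \<in> ball 0 1 \<longrightarrow>
     norm (tp f z v - tp f w v) \<le> K * C * (norm (w - z) + norm (v - w)) powr \<alpha>"
proof -
  obtain K where K: "K > 0" "\<And>C f s z w. hb C f \<Longrightarrow> s \<le> n \<Longrightarrow> z \<in> ball 0 1 \<Longrightarrow> w \<in> ball 0 1 \<Longrightarrow>
     norm ((deriv ^^ s) f w - (\<Sum>m\<le>n - s. (deriv ^^ (s + m)) f z / fact m * (w - z) ^ m))
       \<le> K * C * norm (w - z) powr (\<alpha> - s)" using hb_whitney by blast
  have "norm (tp f z v - tp f w v) \<le> (Suc n * K) * C * (norm (w - z) + norm (v - w)) powr \<alpha>"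
    if f: "hb C f" and z: "z \<in> ball 0 1" and w: "w \<in> ball 0 1" for C f z w v
  proof -
    have C0: "C \<ge> 0" by (rule holder_bounded_nonneg[OF f])
    define X where "X = norm (w - z) + norm (v - w)"
    have X: "X \<ge> norm (w - z)" "X \<ge> norm (v - w)" "X \<ge> 0" unfolding X_def by auto
    define T where "T s = (\<Sum>m\<le>n - s. (deriv ^^ (s + m)) f z / fact m * (w - z) ^ m)" for s
    have "tp f z v - tp f w v = (\<Sum>s\<le>n. (T s - (deriv ^^ s) f w) / fact s * (v - w) ^ s)"
      unfolding taylor_poly_recenter[of n f z v w] T_def
      by (simp add: taylor_poly_def sum_subtractf diff_divide_distrib left_diff_distrib)
    also have "norm \<dots> \<le> (\<Sum>s\<le>n. K * C * X powr \<alpha>)"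
    proof (rule sum_norm_le)
      fix s assume "s \<in> {..n}"
      hence s: "s \<le> n" by simp
      have "norm ((T s - (deriv ^^ s) f w) / fact s * (v - w) ^ s) = norm ((deriv ^^ s) f w - T s) / fact s * norm (v - w) ^ s"
        by (simp add: norm_mult norm_divide norm_power norm_minus_commute)
      also have "\<dots> \<le> norm ((deriv ^^ s) f w - T s) / 1 * norm (v - w) ^ s"
        by (intro mult_right_mono divide_left_mono) (auto simp: fact_ge_1)
      also have "\<dots> \<le> (K * C * norm (w - z) powr (\<alpha> - s)) * norm (v - w) ^ s"
        using K(2)[OF f s z w] unfolding T_def by (intro mult_right_mono) auto
      also have "\<dots> \<le> (K * C * X powr (\<alpha> - s)) * X ^ s"
        using K C0 X s n_less by (intro mult_mono mult_left_mono powr_mono2 power_mono) auto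
      also have "\<dots> = K * C * X powr \<alpha>"
      proof (cases "X = 0")
        case False
        thus ?thesis using X by (simp add: powr_diff powr_realpow)
      qed (use s n_less in auto)
      finally show "norm ((T s - (deriv ^^ s) f w) / fact s * (v - w) ^ s) \<le> K * C * X powr \<alpha>" .
    qed
    finally show ?thesis by (simp add: X_def mult.assoc)
  qed
  thus ?thesis using K(1) by (intro exI[of _ "Suc n * K"]) auto
qed

lemma power_powr_combine: "x \<noteq> 0 \<Longrightarrow> norm x powr \<beta> / norm x ^ k = norm (x::complex) powr (\<beta> - real k)"
  by (simp add: powr_diff powr_realpow)

lemma circle_kernel_bound:
  fixes z :: complex
  assumes z: "z \<in> ball 0 1" and \<rho>: "\<rho> < 1"
  obtains r where "\<rho> < r" "norm z < r" "0 < r" "r < 1" "(1 - norm z) / 2 \<le> r - norm z"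
    "\<And>u. norm u = r \<Longrightarrow> norm (u - z) powr (\<alpha> - (real n + 3)) \<le> ((1 - norm z) / 2) powr (\<alpha> - Suc n) / norm (u - z) ^ 2"
proof
  \<comment> \<open>At least half way to the unit circle from both \<open>norm z\<close> and
    \<open>\<rho>\<close>: the multiplier is holomorphic on and outside this circle, which keeps
    distance \<open>(1 - norm z) / 2\<close> from \<open>z\<close>.\<close>
  define r where "r = max ((1 + norm z) / 2) ((1 + \<rho>) / 2)"
  have r: "(1 + norm z) / 2 \<le> r" "(1 + \<rho>) / 2 \<le> r" "r < 1" using z \<rho> by (auto simp: r_def)
  show "\<rho> < r" "norm z < r" "r < 1" "(1 - norm z) / 2 \<le> r - norm z" using r z \<rho> by (auto simp: field_simps)
  thus "0 < r" using norm_ge_zero[of z] by linarith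
  fix u :: complex assume u: "norm u = r"
  have d: "norm (u - z) \<ge> (1 - norm z) / 2" using norm_triangle_ineq2[of u z] u r by (simp add: field_simps)
  have p: "norm (u - z) > 0" using d z by (auto intro: less_le_trans)
  have "norm (u - z) powr (\<alpha> - (real n + 3)) = norm (u - z) powr (\<alpha> - Suc n) / norm (u - z) ^ 2"
    using p by (subst power_powr_combine) (auto simp: algebra_simps)
  also have "\<dots> \<le> ((1 - norm z) / 2) powr (\<alpha> - Suc n) / norm (u - z) ^ 2"
    using d z less_Suc_n by (intro divide_right_mono powr_mono2') auto
  finally show "norm (u - z) powr (\<alpha> - (real n + 3)) \<le> ((1 - norm z) / 2) powr (\<alpha> - Suc n) / norm (u - z) ^ 2" .
qed

text \<open>Subtracting a Taylor polynomial of \<open>F\<close> costs nothing, since its product with \<open>\<gamma>\<close> and the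
  Cauchy kernel is holomorphic outside the disc and decays at infinity.\<close>
lemma hb_division:
  "\<exists>K>0. \<forall>C F f \<rho> \<gamma>. hb C F \<longrightarrow> f holomorphic_on ball 0 1 \<longrightarrow> exterior_multiplier \<rho> \<gamma> \<longrightarrow>
     (\<forall>\<zeta>\<in>ball 0 1. \<rho> < norm \<zeta> \<longrightarrow> f \<zeta> = F \<zeta> * \<gamma> \<zeta>) \<longrightarrow> hb (K * C) f"
proof -
  obtain K where K: "K > 0" "\<And>C f z w. hb C f \<Longrightarrow> z \<in> ball 0 1 \<Longrightarrow> w \<in> ball 0 1 \<Longrightarrow> norm (f w - tp f z w) \<le> K * C * norm (w - z) powr \<alpha>"
    using hb_taylor by blast
  obtain K' where K': "K' > 0" "\<And>C f. f holomorphic_on ball 0 1 \<Longrightarrow> (\<And>z. z\<in>ball 0 1 \<Longrightarrow> norm (f z) \<le> C) \<Longrightarrow>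
     (\<And>z. z\<in>ball 0 1 \<Longrightarrow> norm ((deriv ^^ Suc (Suc n)) f z) \<le> C * (1 - norm z) powr (\<alpha> - real (Suc (Suc n)))) \<Longrightarrow> hb (K' * C) f"
    using hb_of_Suc_deriv by blast
  define c where "c = 2 * K * 2 powr (real (Suc (Suc n)) - \<alpha>)"
  define K'' where "K'' = max 2 (fact (Suc (Suc n)) * c)"
  have c0: "c > 0" unfolding c_def using K by simp
  have "hb (K' * (K'' * C)) f" if F: "hb C F" and f: "f holomorphic_on ball 0 1" and \<gamma>: "exterior_multiplier \<rho> \<gamma>"
    and eq: "\<And>\<zeta>. \<zeta>\<in>ball 0 1 \<Longrightarrow> \<rho> < norm \<zeta> \<Longrightarrow> f \<zeta> = F \<zeta> * \<gamma> \<zeta>" for C F f \<rho> \<gamma>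
  proof (rule K'(2)[OF f])
    have \<rho>: "0 \<le> \<rho>" "\<rho> < 1" and h\<gamma>: "\<gamma> holomorphic_on {\<zeta>. \<rho> < norm \<zeta>}" and b\<gamma>: "\<And>\<zeta>. \<rho> < norm \<zeta> \<Longrightarrow> norm (\<gamma> \<zeta>) \<le> 2"
      using \<gamma> by (auto simp: exterior_multiplier_def)
    have C0: "C \<ge> 0" by (rule holder_bounded_nonneg[OF F])
    fix z :: complex assume z: "z \<in> ball 0 1"
    obtain r where r: "\<rho> < r" "norm z < r" "0 < r" "r < 1" "(1 - norm z) / 2 \<le> r - norm z"
      and ker: "\<And>u. norm u = r \<Longrightarrow> norm (u - z) powr (\<alpha> - (real n + 3)) \<le> ((1 - norm z) / 2) powr (\<alpha> - Suc n) / norm (u - z) ^ 2"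
      using circle_kernel_bound[OF z \<rho>(2)] by blast
    have rb: "u \<in> ball 0 1" if "norm u = r" for u :: complex using that r by simp
    have cf: "continuous_on (cball 0 r) f" 
      by (intro holomorphic_on_imp_continuous_on holomorphic_on_subset[OF f]) (use r in auto)
    have hf: "f holomorphic_on ball 0 r" by (rule holomorphic_on_subset[OF f]) (use r in auto)
    \<comment> \<open>The identity \<open>f = F * \<gamma>\<close> is known only near the unit
      circle, and the maximum principle carries the bound inwards; the factor \<open>2\<close> is
      the bound on \<open>\<gamma>\<close>.\<close>
    have "norm (f z) \<le> 2 * C"
    proof (rule maximum_modulus_frontier[of f "ball 0 r"])
      fix u assume "u \<in> frontier (ball (0::complex) r)"
      hence u: "norm u = r" using r by auto
      have "norm (f u) = norm (F u) * norm (\<gamma> u)" using eq[OF rb[OF u]] u r by (simp add: norm_mult)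
      also have "\<dots> \<le> C * 2" using F rb[OF u] b\<gamma>[of u] u r C0 by (intro mult_mono) (auto simp: holder_bounded_def)
      finally show "norm (f u) \<le> 2 * C" by simp
    qed (use r hf cf in auto)
    also have "\<dots> \<le> K'' * C" unfolding K''_def using C0 by (intro mult_right_mono) auto
    finally show "norm (f z) \<le> K'' * C" .
    define I where "I = contour_integral (circlepath 0 r) (\<lambda>u. f u / (u - z) ^ Suc (Suc (Suc n)))"
    have CF: "((\<lambda>u. f u / (u - z) ^ Suc (Suc (Suc n))) has_contour_integral (2 * of_real pi * \<i> / fact (Suc (Suc n)) * (deriv ^^ (Suc (Suc n))) f z)) (circlepath 0 r)"
      using Cauchy_has_contour_integral_higher_derivative_circlepath[OF cf hf, of z "Suc (Suc n)"] r by simp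
    define q where "q u = tp F z u * \<gamma> u / (u - z) ^ (n + 3)" for u
    define \<rho>' where "\<rho>' = max \<rho> (norm z)"
    have hq: "q holomorphic_on {\<zeta>. \<rho>' < norm \<zeta>}" unfolding q_def
      by (intro holomorphic_intros holomorphic_on_subset[OF h\<gamma>]) (auto simp: \<rho>'_def)
    obtain A where A: "A \<ge> 0" "\<And>u. 2 \<le> norm u \<Longrightarrow> norm (tp F z u / (u - z) ^ (n + 3)) \<le> A / norm u ^ 3"
      using taylor_poly_decay[of z n F 3] z by auto
    have q0: "contour_integral (circlepath 0 r) q = 0"
    proof (rule exterior_circle_integral_zero[OF hq])
      fix \<zeta> :: complex assume \<zeta>: "2 \<le> norm \<zeta>"
      have "norm (q \<zeta>) = norm (tp F z \<zeta> / (\<zeta> - z) ^ (n + 3)) * norm (\<gamma> \<zeta>)"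
        by (simp add: q_def norm_mult norm_divide)
      also have "\<dots> \<le> A / norm \<zeta> ^ 3 * 2"
        using A \<zeta> b\<gamma>[of \<zeta>] \<rho> by (intro mult_mono) auto
      also have "\<dots> \<le> A / norm \<zeta> ^ 2 * 2"
        using A \<zeta> by (intro mult_right_mono divide_left_mono mult_pos_pos power_increasing zero_less_power) auto
      finally show "norm (q \<zeta>) \<le> (2 * A) / norm \<zeta> ^ 2" by (simp add: mult.commute)
    qed (use r \<rho> in \<open>auto simp: \<rho>'_def\<close>)
    have cq: "continuous_on (path_image (circlepath 0 r)) q"
      by (intro holomorphic_on_imp_continuous_on holomorphic_on_subset[OF hq]) (use r in \<open>auto simp: \<rho>'_def\<close>)
    have Hq: "(q has_contour_integral 0) (circlepath 0 r)"
      using has_contour_integral_integral[OF contour_integrable_continuous_circlepath[OF cq]] q0 by simp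
    \<comment> \<open>On the contour this is
      \<open>(F u - tp F z u) * \<gamma> u / (u - z) ^ (n + 3)\<close>, so a Taylor remainder of
      \<open>F\<close> is all that has to be estimated; derivatives of \<open>\<gamma>\<close> never
      enter.\<close>
    define g where "g u = f u / (u - z) ^ Suc (Suc (Suc n)) - q u" for u
    have Hg: "(g has_contour_integral (2 * of_real pi * \<i> / fact (Suc (Suc n)) * (deriv ^^ (Suc (Suc n))) f z)) (circlepath 0 r)"
      using has_contour_integral_diff[OF CF Hq] unfolding g_def by simp
    define M where "M = 2 * K * C * ((1 - norm z) / 2) powr (\<alpha> - Suc n)"
    have M0: "M \<ge> 0" unfolding M_def using K C0 by simp
    have "norm (contour_integral (circlepath 0 r) g) \<le> 2 * pi * M / (r - norm z)"
    proof (rule norm_circle_integral_le)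
      have "\<forall>u\<in>sphere 0 r. u \<noteq> z" using r by auto
      thus "continuous_on (sphere 0 r) g" unfolding g_def
        using cq cf r by (intro continuous_intros continuous_on_subset[OF cf]) (auto simp: path_image_circlepath_nonneg)
      fix u :: complex assume u: "norm u = r"
      have uz: "u \<noteq> z" using u r by auto
      have "g u = (F u - tp F z u) * \<gamma> u / (u - z) ^ (n + 3)"
        using eq[OF rb[OF u]] u r by (simp add: g_def q_def numeral_3_eq_3 algebra_simps diff_divide_distrib)
      hence "norm (g u) = norm (F u - tp F z u) * norm (\<gamma> u) / norm (u - z) ^ (n + 3)"
        by (simp add: norm_mult norm_divide norm_power)
      also have "\<dots> \<le> (K * C * norm (u - z) powr \<alpha>) * 2 / norm (u - z) ^ (n + 3)"
        using K(2)[OF F z rb[OF u]] b\<gamma>[of u] u r K(1) C0 by (intro divide_right_mono mult_mono) auto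
      also have "\<dots> = 2 * K * C * (norm (u - z) powr \<alpha> / norm (u - z) ^ (n + 3))" by simp
      also have "\<dots> = 2 * K * C * (norm (u - z) powr (\<alpha> - (real n + 3)))"
        using power_powr_combine[of "u - z" \<alpha> "n + 3"] uz by simp
      also have "\<dots> \<le> 2 * K * C * (((1 - norm z) / 2) powr (\<alpha> - Suc n) / norm (u - z) ^ 2)"
        using K C0 by (intro mult_left_mono ker u) auto
      finally show "norm (g u) \<le> M / norm (u - z) ^ 2" by (simp add: M_def)
    qed (use r in auto)
    hence "norm (2 * of_real pi * \<i> / fact (Suc (Suc n)) * (deriv ^^ (Suc (Suc n))) f z) \<le> 2 * pi * M / (r - norm z)"
      using contour_integral_unique[OF Hg] by simp
    also have "norm (2 * of_real pi * \<i> / fact (Suc (Suc n)) * (deriv ^^ (Suc (Suc n))) f z) = 2 * pi * (norm ((deriv ^^ (Suc (Suc n))) f z) / fact (Suc (Suc n)))"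
      by (simp add: norm_mult norm_divide del: fact_Suc)
    also have "2 * pi * M / (r - norm z) = 2 * pi * (M / (r - norm z))" by simp
    finally have "norm ((deriv ^^ (Suc (Suc n))) f z) / fact (Suc (Suc n)) \<le> M / (r - norm z)"
      by (rule mult_left_le_imp_le) simp
    also have "\<dots> \<le> M / ((1 - norm z) / 2)" using M0 r z by (intro divide_left_mono) auto
    also have "\<dots> = 2 * K * C * (((1 - norm z) / 2) powr (\<alpha> - real (Suc (Suc n))))"
      using z powr_diff[of "(1 - norm z) / 2" "\<alpha> - Suc n" 1] by (simp add: M_def algebra_simps)
    also have "\<dots> = c * C * (1 - norm z) powr (\<alpha> - real (Suc (Suc n)))"
      using z by (simp add: c_def powr_divide powr_diff field_simps)
    finally have "norm ((deriv ^^ (Suc (Suc n))) f z) \<le> (fact (Suc (Suc n)) * c) * C * (1 - norm z) powr (\<alpha> - real (Suc (Suc n)))"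
      by (simp add: divide_le_eq mult_ac del: fact_Suc)
    also have "\<dots> \<le> K'' * C * (1 - norm z) powr (\<alpha> - real (Suc (Suc n)))"
      unfolding K''_def using C0 by (intro mult_right_mono) auto
    finally show "norm ((deriv ^^ (Suc (Suc n))) f z) \<le> K'' * C * (1 - norm z) powr (\<alpha> - real (Suc (Suc n)))" .
  qed
  moreover have "K' * K'' > 0" using K' by (simp add: K''_def)
  ultimately show ?thesis by (intro exI[of _ "K' * K''"]) (auto simp: mult.assoc)
qed

text \<open>The quotient of the difference by \<open>(u - z) ^ (n + 2)\<close> is holomorphic
  outside the disc and decays, so its value at \<open>v\<close> is a Cauchy integral over a circle
  just inside. There \<open>f = F * \<gamma>\<close> turns the difference into two Taylor
  remainders. The first condition on \<open>v\<close> lets \<open>1 / (u - v)\<close> count as one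
  more power of \<open>1 / (u - z)\<close>, which gives the exponent \<open>n + 3\<close> of the
  kernel bound; the second trades \<open>1 - norm z\<close> for \<open>norm v - 1\<close>.\<close>

lemma hb_exterior_taylor:
  assumes L: "1 \<le> L"
  shows "\<exists>K>0. \<forall>C F f \<rho> \<gamma> z v. hb C F \<longrightarrow> hb C f \<longrightarrow> exterior_multiplier \<rho> \<gamma> \<longrightarrow>
     (\<forall>\<zeta>\<in>ball 0 1. \<rho> < norm \<zeta> \<longrightarrow> f \<zeta> = F \<zeta> * \<gamma> \<zeta>) \<longrightarrow> z \<in> ball 0 1 \<longrightarrow> 1 < norm v \<longrightarrow>
     norm (v - z) \<le> L * (norm v - 1) \<longrightarrow> norm v - 1 \<le> L * (1 - norm z) \<longrightarrow>
     norm (tp f z v - tp F z v * \<gamma> v) \<le> K * C * (norm v - 1) powr \<alpha>"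
proof -
  obtain K where K: "K > 0" "\<And>C f z w. hb C f \<Longrightarrow> z \<in> ball 0 1 \<Longrightarrow> w \<in> ball 0 1 \<Longrightarrow> norm (f w - tp f z w) \<le> K * C * norm (w - z) powr \<alpha>"
    using hb_taylor by blast
  define K' where "K' = 3 * K * (1 + L) * (2 * L) powr (real n + 2 - \<alpha>) * L ^ (n + 2)"
  have K'0: "K' > 0" unfolding K'_def using K L by simp
  have "norm (tp f z v - tp F z v * \<gamma> v) \<le> K' * C * (norm v - 1) powr \<alpha>"
    if F: "hb C F" and f: "hb C f" and \<gamma>: "exterior_multiplier \<rho> \<gamma>"
    and eq: "\<And>\<zeta>. \<zeta>\<in>ball 0 1 \<Longrightarrow> \<rho> < norm \<zeta> \<Longrightarrow> f \<zeta> = F \<zeta> * \<gamma> \<zeta>" and z: "z \<in> ball 0 1"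
    and v: "1 < norm v" "norm (v - z) \<le> L * (norm v - 1)" "norm v - 1 \<le> L * (1 - norm z)" for C F f \<rho> \<gamma> z v
  proof -
    have \<rho>: "0 \<le> \<rho>" "\<rho> < 1" and h\<gamma>: "\<gamma> holomorphic_on {\<zeta>. \<rho> < norm \<zeta>}" and b\<gamma>: "\<And>\<zeta>. \<rho> < norm \<zeta> \<Longrightarrow> norm (\<gamma> \<zeta>) \<le> 2"
      using \<gamma> by (auto simp: exterior_multiplier_def)
    have C0: "C \<ge> 0" by (rule holder_bounded_nonneg[OF F])
    obtain r where r: "\<rho> < r" "norm z < r" "0 < r" "r < 1" "(1 - norm z) / 2 \<le> r - norm z"
      and ker: "\<And>u. norm u = r \<Longrightarrow> norm (u - z) powr (\<alpha> - (real n + 3)) \<le> ((1 - norm z) / 2) powr (\<alpha> - Suc n) / norm (u - z) ^ 2"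
      using circle_kernel_bound[OF z \<rho>(2)] by blast
    have rb: "u \<in> ball 0 1" if "norm u = r" for u :: complex using that r by simp
    define g where "g u = (tp f z u - tp F z u * \<gamma> u) / (u - z) ^ (n + 2)" for u
    define \<rho>' where "\<rho>' = max \<rho> (norm z)"
    have hg: "g holomorphic_on {\<zeta>. \<rho>' < norm \<zeta>}" unfolding g_def
      by (intro holomorphic_intros holomorphic_on_subset[OF h\<gamma>]) (auto simp: \<rho>'_def)
    obtain A where A: "A \<ge> 0" "\<And>u. 2 \<le> norm u \<Longrightarrow> norm (tp F z u / (u - z) ^ (n + 2)) \<le> A / norm u ^ 2"
      using taylor_poly_decay[of z n F 2] z by auto
    obtain A' where A': "A' \<ge> 0" "\<And>u. 2 \<le> norm u \<Longrightarrow> norm (tp f z u / (u - z) ^ (n + 2)) \<le> A' / norm u ^ 2"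
      using taylor_poly_decay[of z n f 2] z by auto
    have I: "contour_integral (circlepath 0 r) (\<lambda>\<zeta>. g \<zeta> / (\<zeta> - v)) = - 2 * pi * \<i> * g v"
    proof (rule exterior_Cauchy_formula[OF hg])
      fix \<zeta> :: complex assume \<zeta>: "2 \<le> norm \<zeta>"
      have "g \<zeta> = tp f z \<zeta> / (\<zeta> - z) ^ (n + 2) - tp F z \<zeta> / (\<zeta> - z) ^ (n + 2) * \<gamma> \<zeta>"
        by (simp add: g_def diff_divide_distrib)
      hence "norm (g \<zeta>) \<le> norm (tp f z \<zeta> / (\<zeta> - z) ^ (n + 2)) + norm (tp F z \<zeta> / (\<zeta> - z) ^ (n + 2) * \<gamma> \<zeta>)"
        using norm_triangle_ineq4 by metis
      also have "\<dots> \<le> A' / norm \<zeta> ^ 2 + A / norm \<zeta> ^ 2 * 2"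
        unfolding norm_mult[of _ "\<gamma> \<zeta>"] using A A' \<zeta> b\<gamma>[of \<zeta>] \<rho> by (intro add_mono mult_mono) auto
      also have "\<dots> = (A' + 2 * A) / norm \<zeta> ^ 2" by (simp add: add_divide_distrib)
      also have "\<dots> \<le> (A' + 2 * A) / norm \<zeta> ^ 1"
        using A A' \<zeta> by (intro divide_left_mono mult_pos_pos power_increasing zero_less_power) auto
      finally show "norm (g \<zeta>) \<le> (A' + 2 * A) / norm \<zeta>" by simp
    qed (use r \<rho> v in \<open>auto simp: \<rho>'_def\<close>)
    define M where "M = 3 * K * C * (1 + L) * ((1 - norm z) / 2) powr (\<alpha> - Suc n)"
    have M0: "M \<ge> 0" unfolding M_def using K C0 L by simp
    have "norm (contour_integral (circlepath 0 r) (\<lambda>\<zeta>. g \<zeta> / (\<zeta> - v))) \<le> 2 * pi * M / (r - norm z)"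
    proof (rule norm_circle_integral_le)
      show "continuous_on (sphere 0 r) (\<lambda>\<zeta>. g \<zeta> / (\<zeta> - v))"
        by (intro continuous_intros holomorphic_on_imp_continuous_on holomorphic_on_subset[OF hg]) (use r v in \<open>auto simp: \<rho>'_def\<close>)
      fix u :: complex assume u: "norm u = r"
      have uz: "u \<noteq> z" "u \<noteq> v" using u r v by auto
      have uv: "norm v - 1 \<le> norm (u - v)" using norm_triangle_ineq2[of v u] u r by (simp add: norm_minus_commute)
      have "norm (u - z) \<le> norm (u - v) + norm (v - z)" by norm
      also have "\<dots> \<le> norm (u - v) + L * (norm v - 1)" using v by simp
      also have "\<dots> \<le> (1 + L) * norm (u - v)" using mult_left_mono[OF uv, of L] L by (simp add: algebra_simps)
      finally have ker2: "1 / norm (u - v) \<le> (1 + L) / norm (u - z)" using uz L by (simp add: field_simps)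
      have "tp f z u - tp F z u * \<gamma> u = (tp f z u - f u) + (F u - tp F z u) * \<gamma> u"
        using eq[OF rb[OF u]] u r by (simp add: algebra_simps)
      hence "norm (tp f z u - tp F z u * \<gamma> u) \<le> norm (f u - tp f z u) + norm (F u - tp F z u) * norm (\<gamma> u)"
        by (metis norm_triangle_ineq norm_minus_commute norm_mult)
      also have "\<dots> \<le> (K * C * norm (u - z) powr \<alpha>) + (K * C * norm (u - z) powr \<alpha>) * 2"
        using K(2)[OF F z rb[OF u]] K(2)[OF f z rb[OF u]] b\<gamma>[of u] u r K(1) C0 by (intro add_mono mult_mono) auto
      finally have num: "norm (tp f z u - tp F z u * \<gamma> u) \<le> 3 * K * C * norm (u - z) powr \<alpha>" by (simp add: mult_ac)
      have "norm (g u / (u - v)) = norm (tp f z u - tp F z u * \<gamma> u) / norm (u - z) ^ (n + 2) * (1 / norm (u - v))"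
        by (simp add: g_def norm_divide norm_power norm_mult)
      also have "\<dots> \<le> (3 * K * C * norm (u - z) powr \<alpha>) / norm (u - z) ^ (n + 2) * ((1 + L) / norm (u - z))"
        using num ker2 K C0 by (intro mult_mono divide_right_mono) auto
      also have "\<dots> = 3 * K * C * (1 + L) * (norm (u - z) powr \<alpha> / norm (u - z) ^ (n + 3))"
        by (simp add: numeral_3_eq_3 mult_ac)
      also have "\<dots> = 3 * K * C * (1 + L) * (norm (u - z) powr (\<alpha> - (real n + 3)))"
        using power_powr_combine[of "u - z" \<alpha> "n + 3"] uz by simp
      also have "\<dots> \<le> 3 * K * C * (1 + L) * (((1 - norm z) / 2) powr (\<alpha> - Suc n) / norm (u - z) ^ 2)"
        using K C0 L by (intro mult_left_mono ker u) auto
      finally show "norm (g u / (u - v)) \<le> M / norm (u - z) ^ 2" by (simp add: M_def)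
    qed (use r in auto)
    hence "2 * pi * norm (g v) \<le> 2 * pi * (M / (r - norm z))" unfolding I by (simp add: norm_mult)
    hence "norm (g v) \<le> M / (r - norm z)" by (rule mult_left_le_imp_le) simp
    also have "\<dots> \<le> M / ((1 - norm z) / 2)" using M0 r z by (intro divide_left_mono) auto
    also have "\<dots> = 3 * K * C * (1 + L) * (((1 - norm z) / 2) powr (\<alpha> - (real n + 2)))"
      using z powr_diff[of "(1 - norm z) / 2" "\<alpha> - Suc n" 1] by (simp add: M_def algebra_simps)
    also have "\<dots> \<le> 3 * K * C * (1 + L) * (((norm v - 1) / (2 * L)) powr (\<alpha> - (real n + 2)))"
    proof -
      have "(norm v - 1) / (2 * L) \<le> (1 - norm z) / 2" using v L by (simp add: field_simps)
      thus ?thesis using K C0 L v less_Suc_n by (intro mult_left_mono powr_mono2') auto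
    qed
    finally have gv: "norm (g v) \<le> 3 * K * C * (1 + L) * (((norm v - 1) / (2 * L)) powr (\<alpha> - (real n + 2)))" .
    have vz: "v \<noteq> z" using v z by auto
    have "norm (tp f z v - tp F z v * \<gamma> v) = norm (g v) * norm (v - z) ^ (n + 2)"
      using vz by (simp add: g_def norm_divide norm_power norm_mult)
    also have "\<dots> \<le> 3 * K * C * (1 + L) * (((norm v - 1) / (2 * L)) powr (\<alpha> - (real n + 2))) * (L * (norm v - 1)) ^ (n + 2)"
      using gv v K C0 L by (intro mult_mono power_mono) auto
    also have "((norm v - 1) / (2 * L)) powr (\<alpha> - (real n + 2)) = (norm v - 1) powr (\<alpha> - (real n + 2)) * (2 * L) powr (real n + 2 - \<alpha>)"
    proof -
      have "(x / (2 * L)) powr e = x powr e * (2 * L) powr (- e)" if "x > 0" for x e :: real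
        using that L by (simp add: powr_divide powr_minus_divide)
      from this[of "norm v - 1" "\<alpha> - (real n + 2)"] show ?thesis using v by (simp only: minus_diff_eq)
    qed
    also have "3 * K * C * (1 + L) * ((norm v - 1) powr (\<alpha> - (real n + 2)) * (2 * L) powr (real n + 2 - \<alpha>)) * (L * (norm v - 1)) ^ (n + 2)
       = K' * C * ((norm v - 1) powr (\<alpha> - (real n + 2)) * (norm v - 1) ^ (n + 2))"
      unfolding K'_def power_mult_distrib by (simp only: mult_ac)
    also have "(norm v - 1) powr (\<alpha> - (real n + 2)) * (norm v - 1) ^ (n + 2) = (norm v - 1) powr \<alpha>"
    proof -
      have "(norm v - 1) ^ (n + 2) = (norm v - 1) powr (real n + 2)" using v by (subst powr_realpow[symmetric]) (auto simp: add.commute)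
      thus ?thesis by (simp flip: powr_add)
    qed
    finally show ?thesis .
  qed
  thus ?thesis using K'0 by (intro exI[of _ K']) auto
qed

end

section \<open>Blaschke products\<close>

lemma norm_blaschke_factor: "norm (blaschke_factor a w) = norm (w - a) / norm (1 - cnj a * w)"
  by (cases "a = 0") (auto simp: blaschke_factor_def norm_mult norm_divide norm_minus_commute)

text \<open>The sign of \<open>1 - norm w ^ 2\<close> decides whether a factor has modulus below or
  above \<open>1\<close>. The identity serves on both sides of the circle, and quantitatively in
  \<open>blaschke_factor_exterior_decay\<close>.\<close>

lemma blaschke_norm_identity:
  "norm (1 - cnj a * w) ^ 2 - norm (w - a) ^ 2 = (1 - norm a ^ 2) * (1 - norm w ^ 2)"
  by (simp only: cmod_power2) (simp add: power2_eq_square algebra_simps)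

lemma one_minus_cnj_mult_nz: "norm a < 1 \<Longrightarrow> norm w \<le> 1 \<Longrightarrow> 1 - cnj a * w \<noteq> 0"
proof
  assume "norm a < 1" "norm w \<le> 1" "1 - cnj a * w = 0"
  hence "cnj a * w = 1" by simp
  hence "norm a * norm w = 1" by (metis complex_mod_cnj norm_mult norm_one)
  moreover have "norm a * norm w \<le> norm a * 1" using \<open>norm w \<le> 1\<close> by (intro mult_left_mono) auto
  ultimately show False using \<open>norm a < 1\<close> by simp
qed

lemma norm_blaschke_factor_le_1: "norm a < 1 \<Longrightarrow> norm w \<le> 1 \<Longrightarrow> norm (blaschke_factor a w) \<le> 1"
proof -
  assume a: "norm a < 1" "norm w \<le> 1"
  have "norm a ^ 2 \<le> 1" "norm w ^ 2 \<le> 1" using a by (auto simp: power_le_one)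
  hence "0 \<le> (1 - norm a ^ 2) * (1 - norm w ^ 2)" by simp
  hence "norm (w - a) ^ 2 \<le> norm (1 - cnj a * w) ^ 2" using blaschke_norm_identity[of a w] by linarith
  hence "norm (w - a) \<le> norm (1 - cnj a * w)" by (rule power2_le_imp_le) simp
  thus ?thesis unfolding norm_blaschke_factor using one_minus_cnj_mult_nz[OF a] by (simp add: divide_le_eq_1)
qed

lemma blaschke_factor_eq_0_iff: "norm a < 1 \<Longrightarrow> norm w \<le> 1 \<Longrightarrow> blaschke_factor a w = 0 \<longleftrightarrow> w = a"
  using norm_blaschke_factor[of a w] one_minus_cnj_mult_nz[of a w] by (metis diff_0_right divide_eq_0_iff norm_eq_zero right_minus_eq)

lemma blaschke_factor_eq: "\<exists>c. c \<noteq> 0 \<and> (\<forall>w. blaschke_factor a w = c * ((w - a) / (1 - cnj a * w)))"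
proof (cases "a = 0")
  case False
  have "(a - w) / (1 - cnj a * w) = - ((w - a) / (1 - cnj a * w))" for w
    by (metis minus_diff_eq minus_divide_left)
  thus ?thesis using False by (intro exI[of _ "- (cnj a / of_real (norm a))"]) (simp add: blaschke_factor_def)
qed (auto simp: blaschke_factor_def intro!: exI[of _ 1])

lemma blaschke_factor_holomorphic: 
  assumes "norm a < 1" shows "blaschke_factor a holomorphic_on ball 0 1"
proof -
  obtain c where c: "\<And>w. blaschke_factor a w = c * ((w - a) / (1 - cnj a * w))" using blaschke_factor_eq by blast
  show ?thesis unfolding c[abs_def] by (intro holomorphic_intros) (use one_minus_cnj_mult_nz[OF assms] in auto)
qed

lemma norm_one_minus_blaschke_factor:
  assumes a: "norm a < 1" and w: "norm w < 1"
  shows "norm (blaschke_factor a w - 1) \<le> (1 + norm w) / (1 - norm w) * (1 - norm a)"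
proof (cases "a = 0")
  case True
  have "norm (w - 1) \<le> (1 + norm w) / 1" using norm_triangle_ineq4[of w 1] by simp
  also have "\<dots> \<le> (1 + norm w) / (1 - norm w)" using w by (intro divide_left_mono) auto
  finally show ?thesis using True by (simp add: blaschke_factor_def)
next
  case False
  define m where "m = complex_of_real (norm a)"
  have m0: "m \<noteq> 0" using False by (simp add: m_def)
  have mm: "cnj a * a = m * m" 
  proof -
    have "complex_of_real (norm a * norm a) = a * cnj a"
      using complex_norm_square[of a] by (simp only: power2_eq_square)
    thus ?thesis unfolding m_def of_real_mult by (metis mult.commute)
  qed
  have nz: "1 - cnj a * w \<noteq> 0" using one_minus_cnj_mult_nz a w by simp
  have "blaschke_factor a w - 1 = (cnj a * (a - w) - m * (1 - cnj a * w)) / (m * (1 - cnj a * w))"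
    using False nz m0 by (simp add: blaschke_factor_def m_def[symmetric] divide_simps)
  also have "cnj a * (a - w) - m * (1 - cnj a * w) = - ((1 - m) * (m + cnj a * w))"
    using mm by (simp add: algebra_simps)
  finally have "norm (blaschke_factor a w - 1) = norm (1 - m) * norm (m + cnj a * w) / (norm m * norm (1 - cnj a * w))"
    by (simp add: norm_divide norm_mult)
  also have "norm (1 - m) = 1 - norm a" 
  proof -
    have "1 - m = complex_of_real (1 - norm a)" by (simp add: m_def)
    thus ?thesis using a by (simp only: norm_of_real)
  qed
  also have "norm m = norm a" by (simp add: m_def)
  also have "(1 - norm a) * norm (m + cnj a * w) / (norm a * norm (1 - cnj a * w)) \<le> (1 - norm a) * (norm a * (1 + norm w)) / (norm a * (1 - norm w))"
  proof (intro frac_le mult_left_mono)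
    have "norm (m + cnj a * w) \<le> norm m + norm (cnj a * w)" by (rule norm_triangle_ineq)
    thus "norm (m + cnj a * w) \<le> norm a * (1 + norm w)" by (simp add: m_def norm_mult algebra_simps)
    have "1 - norm (cnj a * w) \<le> norm (1 - cnj a * w)" using norm_triangle_ineq2[of 1 "cnj a * w"] by simp
    moreover have "norm (cnj a * w) \<le> 1 * norm w" unfolding norm_mult using a by (intro mult_right_mono) auto
    ultimately show "1 - norm w \<le> norm (1 - cnj a * w)" by simp
  qed (use a w False in auto)
  also have "\<dots> = (1 + norm w) / (1 - norm w) * (1 - norm a)" using False by simp
  finally show ?thesis .
qed

text \<open>The lower index isolates a middle block of zeros, which is cancelled while the first
  zeros and the tail remain.\<close>

definition finite_blaschke :: "(nat \<Rightarrow> complex) \<Rightarrow> nat \<Rightarrow> nat \<Rightarrow> complex \<Rightarrow> complex" where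
  "finite_blaschke z M N w = (\<Prod>j=M..<N. blaschke_factor (z j) w)"

lemma finite_blaschke_holomorphic:
  "(\<And>j. norm (z j) < 1) \<Longrightarrow> finite_blaschke z M N holomorphic_on ball 0 1"
  unfolding finite_blaschke_def[abs_def] by (intro holomorphic_on_prod blaschke_factor_holomorphic)

lemma norm_finite_blaschke_le_1:
  "(\<And>j. norm (z j) < 1) \<Longrightarrow> norm w \<le> 1 \<Longrightarrow> norm (finite_blaschke z M N w) \<le> 1"
  unfolding finite_blaschke_def by (auto simp flip: prod_norm intro!: prod_le_1 norm_blaschke_factor_le_1)

lemma finite_blaschke_0 [simp]: "finite_blaschke z M M w = 1"
  by (simp add: finite_blaschke_def)

lemma finite_blaschke_Suc: "M \<le> N \<Longrightarrow> finite_blaschke z M (Suc N) w = finite_blaschke z M N w * blaschke_factor (z N) w"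
  by (simp add: finite_blaschke_def)

lemma finite_blaschke_split: "L \<le> M \<Longrightarrow> M \<le> N \<Longrightarrow> finite_blaschke z L N w = finite_blaschke z L M w * finite_blaschke z M N w"
  by (simp add: finite_blaschke_def prod.atLeastLessThan_concat)

text \<open>Every \<open>c > 1\<close> is demanded so that the notion is closed under products: both
  factors are taken with \<open>sqrt c\<close>. The bound \<open>2\<close> of
  \<open>exterior_multiplier\<close> is one instance. At a pole of \<open>b\<close> outside the
  disc, division by zero gives \<open>b \<zeta> = 0\<close> and hence
  \<open>inverse (b \<zeta>) = 0\<close>, the right value of the holomorphic function
  \<open>1 / b\<close>.\<close>

definition almost_inner :: "(complex \<Rightarrow> complex) \<Rightarrow> bool" where
  "almost_inner b \<longleftrightarrow> (\<forall>c>1. \<exists>\<rho>\<ge>0. \<rho> < 1 \<and> (\<lambda>\<zeta>. inverse (b \<zeta>)) holomorphic_on {\<zeta>. \<rho> < norm \<zeta>} \<and>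
     (\<forall>\<zeta>. \<rho> < norm \<zeta> \<longrightarrow> norm (inverse (b \<zeta>)) \<le> c \<and> (norm \<zeta> < 1 \<longrightarrow> b \<zeta> \<noteq> 0)))"

lemma almost_inner_blaschke_factor:
  assumes a: "norm a < 1" shows "almost_inner (blaschke_factor a)"
  unfolding almost_inner_def
proof (intro allI impI)
  fix c :: real assume c: "c > 1"
  obtain u where u: "u \<noteq> 0" "\<And>w. blaschke_factor a w = u * ((w - a) / (1 - cnj a * w))" using blaschke_factor_eq by blast
  \<comment> \<open>\<open>k\<close> bounds \<open>norm (\<zeta> - a) ^ 2\<close> from below for
    \<open>\<rho> < norm \<zeta>\<close>, and \<open>\<rho>\<close> is so close to \<open>1\<close>
    that \<open>1 - norm \<zeta> ^ 2 \<le> (c - 1) * k\<close>. By the norm identity the reciprocal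
    factor then has squared modulus at most \<open>c\<close>.\<close>
  define k where "k = (1 - norm a) ^ 2 / 4"
  have k0: "k > 0" using a by (simp add: k_def)
  define \<rho> where "\<rho> = max ((1 + norm a) / 2) (1 - (c - 1) * k / 2)"
  have \<rho>: "\<rho> < 1" "(1 + norm a) / 2 \<le> \<rho>" "1 - (c - 1) * k / 2 \<le> \<rho>" using a c k0 by (auto simp: \<rho>_def)
  have \<rho>0: "\<rho> \<ge> 0" by (rule order_trans[OF _ \<rho>(2)]) simp
  have "(\<lambda>\<zeta>. inverse u * ((1 - cnj a * \<zeta>) / (\<zeta> - a))) holomorphic_on {\<zeta>. \<rho> < norm \<zeta>}"
    by (intro holomorphic_intros) (use \<rho> a in auto)
  moreover have "inverse u * ((1 - cnj a * \<zeta>) / (\<zeta> - a)) = inverse (blaschke_factor a \<zeta>)" for \<zeta>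
    by (simp add: u divide_inverse)
  ultimately have hol: "(\<lambda>\<zeta>. inverse (blaschke_factor a \<zeta>)) holomorphic_on {\<zeta>. \<rho> < norm \<zeta>}" by simp
  have "norm (inverse (blaschke_factor a \<zeta>)) \<le> c" if \<zeta>: "\<rho> < norm \<zeta>" for \<zeta>
  proof -
    have za: "norm (\<zeta> - a) \<ge> (1 - norm a) / 2" using \<rho> \<zeta> norm_triangle_ineq2[of \<zeta> a] by (simp add: field_simps)
    hence za0: "norm (\<zeta> - a) > 0" using a by (auto intro: less_le_trans)
    have zk: "norm (\<zeta> - a) ^ 2 \<ge> k" using power_mono[OF za, of 2] a by (simp add: k_def power_divide)
    have "1 - norm \<zeta> ^ 2 \<le> (c - 1) * k"
    proof (cases "norm \<zeta> < 1")
      case True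
      have "1 - norm \<zeta> ^ 2 = (1 - norm \<zeta>) * (1 + norm \<zeta>)" by (simp add: power2_eq_square algebra_simps)
      also have "\<dots> \<le> ((c - 1) * k / 2) * 2" using True \<zeta> \<rho> c k0 by (intro mult_mono) auto
      finally show ?thesis by simp
    next
      case False
      hence "norm \<zeta> ^ 2 \<ge> 1" by (simp add: one_le_power)
      moreover have "(c - 1) * k \<ge> 0" using c k0 by simp
      ultimately show ?thesis by linarith
    qed
    hence "(1 - norm a ^ 2) * (1 - norm \<zeta> ^ 2) \<le> 1 * ((c - 1) * k)"
    proof (cases "1 - norm \<zeta> ^ 2 \<ge> 0")
      case True
      thus ?thesis using \<open>1 - norm \<zeta> ^ 2 \<le> (c - 1) * k\<close> by (intro mult_mono) auto
    next
      case False
      have "norm a ^ 2 \<le> 1" using a by (simp add: power_le_one)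
      hence "(1 - norm a ^ 2) * (1 - norm \<zeta> ^ 2) \<le> 0" using False by (intro mult_nonneg_nonpos) auto
      moreover have "(c - 1) * k \<ge> 0" using c k0 by simp
      ultimately show ?thesis by linarith
    qed
    hence "norm (1 - cnj a * \<zeta>) ^ 2 \<le> norm (\<zeta> - a) ^ 2 + (c - 1) * norm (\<zeta> - a) ^ 2"
      using blaschke_norm_identity[of a \<zeta>] mult_left_mono[OF zk, of "c - 1"] c by linarith
    also have "\<dots> = c * norm (\<zeta> - a) ^ 2" by (simp add: algebra_simps)
    also have "\<dots> \<le> c ^ 2 * norm (\<zeta> - a) ^ 2" using c by (intro mult_right_mono) (auto simp: power2_eq_square)
    finally have "norm (1 - cnj a * \<zeta>) ^ 2 \<le> (c * norm (\<zeta> - a)) ^ 2" by (simp add: power_mult_distrib)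
    hence "norm (1 - cnj a * \<zeta>) \<le> c * norm (\<zeta> - a)" by (rule power2_le_imp_le) (use c in auto)
    thus ?thesis using za0 by (simp add: norm_inverse norm_blaschke_factor divide_le_eq)
  qed
  moreover have "blaschke_factor a \<zeta> \<noteq> 0" if "\<rho> < norm \<zeta>" "norm \<zeta> < 1" for \<zeta>
    using that \<rho> a by (subst blaschke_factor_eq_0_iff) auto
  ultimately show "\<exists>\<rho>\<ge>0. \<rho> < 1 \<and> (\<lambda>\<zeta>. inverse (blaschke_factor a \<zeta>)) holomorphic_on {\<zeta>. \<rho> < norm \<zeta>} \<and>
     (\<forall>\<zeta>. \<rho> < norm \<zeta> \<longrightarrow> norm (inverse (blaschke_factor a \<zeta>)) \<le> c \<and> (norm \<zeta> < 1 \<longrightarrow> blaschke_factor a \<zeta> \<noteq> 0))"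
    using hol \<rho>0 \<rho>(1) by blast
qed

lemma almost_inner_one: "almost_inner (\<lambda>_. 1)"
  unfolding almost_inner_def by (auto intro!: exI[of _ 0])

lemma almost_inner_mult:
  assumes f: "almost_inner f" and g: "almost_inner g" shows "almost_inner (\<lambda>w. f w * g w)"
  unfolding almost_inner_def
proof (intro allI impI)
  fix c :: real assume c: "c > 1"
  hence s: "sqrt c > 1" by simp
  obtain \<rho>1 where 1: "\<rho>1 \<ge> 0" "\<rho>1 < 1" "(\<lambda>\<zeta>. inverse (f \<zeta>)) holomorphic_on {\<zeta>. \<rho>1 < norm \<zeta>}"
     "\<And>\<zeta>. \<rho>1 < norm \<zeta> \<Longrightarrow> norm (inverse (f \<zeta>)) \<le> sqrt c" "\<And>\<zeta>. \<rho>1 < norm \<zeta> \<Longrightarrow> norm \<zeta> < 1 \<Longrightarrow> f \<zeta> \<noteq> 0"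
    using f s unfolding almost_inner_def by metis
  obtain \<rho>2 where 2: "\<rho>2 \<ge> 0" "\<rho>2 < 1" "(\<lambda>\<zeta>. inverse (g \<zeta>)) holomorphic_on {\<zeta>. \<rho>2 < norm \<zeta>}"
     "\<And>\<zeta>. \<rho>2 < norm \<zeta> \<Longrightarrow> norm (inverse (g \<zeta>)) \<le> sqrt c" "\<And>\<zeta>. \<rho>2 < norm \<zeta> \<Longrightarrow> norm \<zeta> < 1 \<Longrightarrow> g \<zeta> \<noteq> 0"
    using g s unfolding almost_inner_def by metis
  define \<rho> where "\<rho> = max \<rho>1 \<rho>2"
  have "(\<lambda>\<zeta>. inverse (f \<zeta>) * inverse (g \<zeta>)) holomorphic_on {\<zeta>. \<rho> < norm \<zeta>}"
    by (intro holomorphic_on_mult holomorphic_on_subset[OF 1(3)] holomorphic_on_subset[OF 2(3)]) (auto simp: \<rho>_def)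
  moreover have "norm (inverse (f \<zeta> * g \<zeta>)) \<le> c" if "\<rho> < norm \<zeta>" for \<zeta>
  proof -
    have "norm (inverse (f \<zeta>)) * norm (inverse (g \<zeta>)) \<le> sqrt c * sqrt c"
      using 1(4)[of \<zeta>] 2(4)[of \<zeta>] that c by (intro mult_mono) (auto simp: \<rho>_def)
    thus ?thesis using c by (simp add: norm_mult norm_inverse)
  qed
  moreover have "\<rho> \<ge> 0" "\<rho> < 1" using 1 2 by (auto simp: \<rho>_def)
  moreover have "f \<zeta> * g \<zeta> \<noteq> 0" if "\<rho> < norm \<zeta>" "norm \<zeta> < 1" for \<zeta>
    using 1(5)[of \<zeta>] 2(5)[of \<zeta>] that by (auto simp: \<rho>_def)
  ultimately show "\<exists>\<rho>\<ge>0. \<rho> < 1 \<and> (\<lambda>\<zeta>. inverse (f \<zeta> * g \<zeta>)) holomorphic_on {\<zeta>. \<rho> < norm \<zeta>} \<and>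
     (\<forall>\<zeta>. \<rho> < norm \<zeta> \<longrightarrow> norm (inverse (f \<zeta> * g \<zeta>)) \<le> c \<and> (norm \<zeta> < 1 \<longrightarrow> f \<zeta> * g \<zeta> \<noteq> 0))"
    by (intro exI[of _ \<rho>]) auto
qed

lemma almost_inner_finite_blaschke:
  assumes "\<And>j. norm (z j) < 1" shows "almost_inner (finite_blaschke z M N)"
proof (induction N)
  case 0
  show ?case using almost_inner_one by (simp add: finite_blaschke_def[abs_def])
next
  case (Suc N)
  show ?case
  proof (cases "M \<le> N")
    case True
    have "finite_blaschke z M (Suc N) = (\<lambda>w. finite_blaschke z M N w * blaschke_factor (z N) w)"
      using finite_blaschke_Suc[OF True] by blast
    thus ?thesis using almost_inner_mult[OF Suc almost_inner_blaschke_factor[OF assms]] by metis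
  next
    case False
    thus ?thesis using almost_inner_one by (simp add: finite_blaschke_def[abs_def])
  qed
qed

lemma almost_inner_power: "almost_inner f \<Longrightarrow> almost_inner (\<lambda>w. f w ^ k)"
  by (induction k) (auto intro: almost_inner_one almost_inner_mult)

lemma almost_inner_exterior_multiplier:
  assumes "almost_inner b"
  obtains \<rho> where "exterior_multiplier \<rho> (\<lambda>\<zeta>. inverse (b \<zeta>))" "\<And>\<zeta>. \<rho> < norm \<zeta> \<Longrightarrow> norm \<zeta> < 1 \<Longrightarrow> b \<zeta> \<noteq> 0"
proof -
  obtain \<rho> where "\<rho> \<ge> 0" "\<rho> < 1" "(\<lambda>\<zeta>. inverse (b \<zeta>)) holomorphic_on {\<zeta>. \<rho> < norm \<zeta>}"
     "\<forall>\<zeta>. \<rho> < norm \<zeta> \<longrightarrow> norm (inverse (b \<zeta>)) \<le> 2 \<and> (norm \<zeta> < 1 \<longrightarrow> b \<zeta> \<noteq> 0)"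
    using assms unfolding almost_inner_def by (metis one_less_numeral_iff semiring_norm(76))
  thus ?thesis by (intro that[of \<rho>]) (auto simp: exterior_multiplier_def)
qed

section \<open>Dividing out the zeros of a finite product\<close>

lemma holomorphic_factor_of_vanishing_derivs:
  assumes "h holomorphic_on S" "open S" "a \<in> S" "\<And>s. s < k \<Longrightarrow> (deriv ^^ s) h a = 0"
  shows "\<exists>g. g holomorphic_on S \<and> (\<forall>w\<in>S. h w = (w - a) ^ k * g w)"
  using assms
proof (induction k arbitrary: h)
  case 0
  thus ?case by auto
next
  case (Suc k)
  define H where "H = (\<lambda>w. if w = a then deriv h a else (h w - h a) / (w - a))"
  have holH: "H holomorphic_on S" unfolding H_def
    by (rule pole_lemma) (use Suc.prems in \<open>simp_all add: interior_open\<close>)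
  have "h a = 0" using Suc.prems(4)[of 0] by simp
  hence hH: "h w = (w - a) * H w" for w by (auto simp: H_def)
  have d: "(deriv ^^ i) (\<lambda>w. w - a) a = (if i = 1 then 1 else 0)" for i
  proof (cases i)
    case (Suc j)
    have "deriv (\<lambda>w. w - a) = (\<lambda>_. 1)" by (intro ext DERIV_imp_deriv) (auto intro!: derivative_eq_intros)
    thus ?thesis using Suc by (simp add: funpow_Suc_right higher_deriv_const del: funpow.simps)
  qed simp
  have "(deriv ^^ s) H a = 0" if s: "s < k" for s
  proof -
    have "h = (\<lambda>w. (w - a) * H w)" using hH by blast
    hence "0 = (deriv ^^ Suc s) (\<lambda>w. (w - a) * H w) a" using Suc.prems(4)[of "Suc s"] s by simp
    also have "\<dots> = (\<Sum>i = 0..Suc s. of_nat (Suc s choose i) * (deriv ^^ i) (\<lambda>w. w - a) a * (deriv ^^ (Suc s - i)) H a)"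
      by (rule higher_deriv_mult[of _ S]) (use Suc.prems holH in \<open>auto intro!: holomorphic_intros\<close>)
    also have "\<dots> = (\<Sum>i = 0..Suc s. if i = 1 then of_nat (Suc s) * (deriv ^^ s) H a else 0)"
      by (intro sum.cong refl) (simp add: d)
    also have "\<dots> = of_nat (Suc s) * (deriv ^^ s) H a" by (subst sum.delta) auto
    finally show ?thesis by (simp del: of_nat_Suc)
  qed
  then obtain g where "g holomorphic_on S" "\<forall>w\<in>S. H w = (w - a) ^ k * g w"
    using Suc.IH[OF holH Suc.prems(2,3)] by blast
  thus ?case using hH by (intro exI[of _ g]) auto
qed

lemma finite_blaschke_divides:
  assumes z: "\<And>j. norm (z j) < 1" and inj: "inj z" and f: "f holomorphic_on ball 0 1"
    and van: "\<And>j s. s < k \<Longrightarrow> (deriv ^^ s) f (z j) = 0"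
  shows "\<exists>h. h holomorphic_on ball 0 1 \<and> (\<forall>w\<in>ball 0 1. f w = h w * finite_blaschke z 0 N w ^ k)"
proof (induction N)
  case 0
  thus ?case using f by auto
next
  case (Suc N)
  then obtain h where h: "h holomorphic_on ball 0 1" "\<And>w. w\<in>ball 0 1 \<Longrightarrow> f w = h w * finite_blaschke z 0 N w ^ k" by blast
  define a where "a = z N"
  have a: "norm a < 1" using z by (simp add: a_def)
  define b where "b = finite_blaschke z 0 N"
  have hb: "b holomorphic_on ball 0 1" unfolding b_def by (rule finite_blaschke_holomorphic[OF z])
  \<comment> \<open>The zeros are distinct, so the product of the earlier factors does not vanish at
    \<open>a\<close>. Near \<open>a\<close> the quotient \<open>h\<close> is \<open>f\<close> times
    a holomorphic function and inherits the zero of order \<open>k\<close>.\<close>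
  define U where "U = ball 0 1 \<inter> b -` (- {0})"
  have opU: "open U" unfolding U_def
    by (intro continuous_open_preimage holomorphic_on_imp_continuous_on[OF hb]) auto
  have "b a \<noteq> 0" unfolding b_def finite_blaschke_def a_def using z inj
    by (auto simp: blaschke_factor_eq_0_iff less_imp_le dest!: injD)
  hence aU: "a \<in> U" using a by (simp add: U_def)
  have fU: "f holomorphic_on U" by (rule holomorphic_on_subset[OF f]) (simp add: U_def)
  have "b holomorphic_on U" by (rule holomorphic_on_subset[OF hb]) (simp add: U_def)
  hence iU: "(\<lambda>w. inverse (b w ^ k)) holomorphic_on U" by (intro holomorphic_intros) (auto simp: U_def)
  have "(deriv ^^ s) h a = 0" if s: "s < k" for s
  proof -
    have "(deriv ^^ s) h a = (deriv ^^ s) (\<lambda>w. f w * inverse (b w ^ k)) a"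
    proof (rule higher_deriv_transform_within_open[OF _ _ opU aU])
      show "h holomorphic_on U" by (rule holomorphic_on_subset[OF h(1)]) (simp add: U_def)
      show "(\<lambda>w. f w * inverse (b w ^ k)) holomorphic_on U" by (rule holomorphic_on_mult[OF fU iU])
      show "h w = f w * inverse (b w ^ k)" if "w \<in> U" for w
        using that h(2)[of w] by (auto simp: U_def b_def)
    qed
    also have "\<dots> = (\<Sum>i = 0..s. of_nat (s choose i) * (deriv ^^ i) f a * (deriv ^^ (s - i)) (\<lambda>w. inverse (b w ^ k)) a)"
      by (rule higher_deriv_mult[OF fU iU opU aU])
    also have "\<dots> = 0" using van s by (intro sum.neutral) (auto simp: a_def)
    finally show ?thesis .
  qed
  then obtain g where g: "g holomorphic_on ball 0 1" "\<And>w. w\<in>ball 0 1 \<Longrightarrow> h w = (w - a) ^ k * g w"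
    using holomorphic_factor_of_vanishing_derivs[OF h(1) open_ball, of a k] a by auto
  obtain c where c: "c \<noteq> 0" "\<And>w. blaschke_factor a w = c * ((w - a) / (1 - cnj a * w))" using blaschke_factor_eq by blast
  have "f w = (g w * ((1 - cnj a * w) / c) ^ k) * finite_blaschke z 0 (Suc N) w ^ k" if w: "w \<in> ball 0 1" for w
  proof -
    have nz: "1 - cnj a * w \<noteq> 0" using one_minus_cnj_mult_nz[OF a] w by simp
    have "((1 - cnj a * w) / c) * blaschke_factor a w = w - a" using nz c by simp
    hence "(w - a) ^ k = ((1 - cnj a * w) / c) ^ k * blaschke_factor a w ^ k" by (metis power_mult_distrib)
    thus ?thesis using h(2)[OF w] g(2)[OF w] by (simp add: finite_blaschke_Suc power_mult_distrib a_def mult_ac)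
  qed
  moreover have "(\<lambda>w. g w * ((1 - cnj a * w) / c) ^ k) holomorphic_on ball 0 1"
    using g c by (intro holomorphic_intros) auto
  ultimately show ?case by blast
qed

section \<open>Infinite Blaschke products and their tails\<close>

lemma suminf_tail_tendsto_0:
  fixes f :: "nat \<Rightarrow> real"
  assumes "summable f" shows "(\<lambda>M. \<Sum>j. f (j + M)) \<longlonglongrightarrow> 0"
proof -
  have "(\<lambda>M. suminf f - (\<Sum>j<M. f j)) \<longlonglongrightarrow> suminf f - suminf f"
    by (intro tendsto_intros summable_LIMSEQ assms)
  moreover have "suminf f - (\<Sum>j<M. f j) = (\<Sum>j. f (j + M))" for M
    using suminf_split_initial_segment[OF assms, of M] by simp
  ultimately show ?thesis by simp
qed

context
  fixes z :: "nat \<Rightarrow> complex"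
  assumes bs: "blaschke_sequence z"
begin

lemma blaschke_seq_norm: "norm (z j) < 1"
  using bs unfolding blaschke_sequence_def by (meson mem_ball_0 rangeI subsetD)

lemma blaschke_sequence_shift: "blaschke_sequence (\<lambda>j. z (j + M))"
  using bs summable_iff_shift[of "\<lambda>j. 1 - norm (z j)" M] by (auto simp: blaschke_sequence_def)

lemma blaschke_summable:
  assumes w: "norm w < 1" shows "summable (\<lambda>j. norm (blaschke_factor (z j) w - 1))"
proof (rule summable_comparison_test)
  show "\<exists>N. \<forall>j\<ge>N. norm (norm (blaschke_factor (z j) w - 1)) \<le> (1 + norm w) / (1 - norm w) * (1 - norm (z j))"
    using norm_one_minus_blaschke_factor[OF blaschke_seq_norm w] by simp
  show "summable (\<lambda>j. (1 + norm w) / (1 - norm w) * (1 - norm (z j)))"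
    using bs by (intro summable_mult) (simp add: blaschke_sequence_def)
qed

lemma finite_blaschke_tendsto:
  assumes w: "norm w < 1" shows "(\<lambda>N. finite_blaschke z 0 N w) \<longlonglongrightarrow> blaschke_product z w"
proof -
  have "convergent_prod (\<lambda>j. blaschke_factor (z j) w)"
    by (intro abs_convergent_prod_imp_convergent_prod summable_imp_abs_convergent_prod blaschke_summable w)
  from has_prod_imp_tendsto'[OF convergent_prod_has_prod[OF this]] show ?thesis
    by (simp add: finite_blaschke_def blaschke_product_def atLeast0LessThan)
qed

lemma blaschke_product_holomorphic: "blaschke_product z holomorphic_on ball 0 1"
  by (rule bounded_pointwise_limit(1)[where F = "finite_blaschke z 0" and C = 1])
     (auto intro!: finite_blaschke_holomorphic norm_finite_blaschke_le_1 finite_blaschke_tendsto blaschke_seq_norm)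

lemma norm_blaschke_product_le_1: "norm w < 1 \<Longrightarrow> norm (blaschke_product z w) \<le> 1"
  by (rule LIMSEQ_le_const2[OF tendsto_norm[OF finite_blaschke_tendsto]])
     (auto intro!: norm_finite_blaschke_le_1 blaschke_seq_norm)

end

lemma blaschke_product_split:
  assumes bs: "blaschke_sequence z" and w: "norm w < 1"
  shows "blaschke_product z w = finite_blaschke z 0 M w * blaschke_product (\<lambda>j. z (j + M)) w"
proof -
  have e: "finite_blaschke (\<lambda>j. z (j + M)) 0 N w = finite_blaschke z M (N + M) w" for N
    unfolding finite_blaschke_def using prod.shift_bounds_nat_ivl[of "\<lambda>j. blaschke_factor (z j) w" 0 M N]
    by (simp only: add_0_left)
  have "(\<lambda>N. finite_blaschke z 0 (N + M) w) \<longlonglongrightarrow> blaschke_product z w"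
    by (rule LIMSEQ_ignore_initial_segment[OF finite_blaschke_tendsto[OF bs w]])
  moreover have "(\<lambda>N. finite_blaschke z 0 M w * finite_blaschke (\<lambda>j. z (j + M)) 0 N w) \<longlonglongrightarrow> finite_blaschke z 0 M w * blaschke_product (\<lambda>j. z (j + M)) w"
    by (intro tendsto_intros finite_blaschke_tendsto blaschke_sequence_shift bs w)
  moreover have "finite_blaschke z 0 M w * finite_blaschke (\<lambda>j. z (j + M)) 0 N w = finite_blaschke z 0 (N + M) w" for N
    unfolding e by (rule finite_blaschke_split[symmetric]) auto
  ultimately show ?thesis using LIMSEQ_unique by auto
qed

text \<open>The factors beyond a cancelled finite block survive in every estimate; this limit
  removes them. The distance of a product from \<open>1\<close> is majorized by an exponential of
  the tail of a convergent series, minus \<open>1\<close>.\<close>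

lemma blaschke_product_tail_tendsto:
  assumes bs: "blaschke_sequence z" and w: "norm w < 1"
  shows "(\<lambda>M. blaschke_product (\<lambda>j. z (j + M)) w) \<longlonglongrightarrow> 1"
proof -
  define u where "u j = norm (blaschke_factor (z j) w - 1)" for j
  have su: "summable u" unfolding u_def by (rule blaschke_summable[OF bs w])
  have sM: "summable (\<lambda>j. u (j + M))" for M using su summable_iff_shift[of u M] by blast
  have fin: "norm (finite_blaschke (\<lambda>j. z (j + M)) 0 N w - 1) \<le> exp (\<Sum>j. u (j + M)) - 1" for M N
  proof -
    define g where "g j = blaschke_factor (z (j + M)) w - 1" for j
    have g1: "1 + g j = blaschke_factor (z (j + M)) w" and gu: "norm (g j) = u (j + M)" for j
      by (simp_all add: g_def u_def)
    have "norm (finite_blaschke (\<lambda>j. z (j + M)) 0 N w - 1) \<le> (\<Prod>j=0..<N. 1 + u (j + M)) - 1"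
      using norm_prod_minus1_le_prod_minus1[of g "{0..<N}"] unfolding g1 gu finite_blaschke_def .
    moreover have "(\<Prod>j=0..<N. 1 + u (j + M)) \<le> exp (\<Sum>j=0..<N. u (j + M))"
      by (rule prod_le_exp_sum) (simp add: u_def)
    moreover have "(\<Sum>j=0..<N. u (j + M)) \<le> (\<Sum>j. u (j + M))"
      by (rule sum_le_suminf[OF sM]) (simp_all add: u_def)
    ultimately show ?thesis by (smt (verit) exp_le_cancel_iff)
  qed
  define v where "v M = blaschke_product (\<lambda>j. z (j + M)) w" for M
  have "norm (v M - 1) \<le> exp (\<Sum>j. u (j + M)) - 1" for M
  proof (rule LIMSEQ_le_const2)
    have "(\<lambda>N. finite_blaschke (\<lambda>j. z (j + M)) 0 N w) \<longlonglongrightarrow> v M"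
      unfolding v_def by (rule finite_blaschke_tendsto[OF blaschke_sequence_shift[OF bs] w])
    thus "(\<lambda>N. norm (finite_blaschke (\<lambda>j. z (j + M)) 0 N w - 1)) \<longlonglongrightarrow> norm (v M - 1)"
      by (rule tendsto_norm[OF tendsto_diff[OF _ tendsto_const]])
  qed (use fin in auto)
  moreover have "(\<lambda>M. exp (\<Sum>j. u (j + M)) - 1) \<longlonglongrightarrow> exp 0 - 1"
    by (rule tendsto_diff[OF tendsto_exp[OF suminf_tail_tendsto_0[OF su]] tendsto_const])
  hence "(\<lambda>M. exp (\<Sum>j. u (j + M)) - 1) \<longlonglongrightarrow> 0" by simp
  ultimately have "(\<lambda>M. v M - 1) \<longlonglongrightarrow> 0"
    by (rule Lim_null_comparison[OF always_eventually[OF allI]])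
  hence "v \<longlonglongrightarrow> 1" by (rule LIM_zero_cancel)
  thus ?thesis by (simp add: v_def[abs_def])
qed

text \<open>The interpolation condition lives on the closure, so the zeros must be separated from
  their limit points as well.\<close>

lemma sep_dist_le: 
  assumes "w \<in> closure (range z)" "w \<noteq> z j" shows "sep_dist z j \<le> norm (z j - w)"
proof -
  have "range z \<subseteq> insert (z j) {u. sep_dist z j \<le> norm (z j - u)}"
  proof
    fix u assume "u \<in> range z"
    then obtain l where l: "u = z l" by auto
    show "u \<in> insert (z j) {u. sep_dist z j \<le> norm (z j - u)}"
    proof (cases "l = j")
      case False
      hence "sep_dist z j \<le> norm (z j - z l)" unfolding sep_dist_def
        by (intro cINF_lower bdd_belowI2[of _ 0]) auto
      thus ?thesis using l by simp
    qed (use l in simp)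
  qed
  moreover have "closed (insert (z j) {u. sep_dist z j \<le> norm (z j - u)})"
    by (intro closed_insert closed_Collect_le continuous_intros)
  ultimately have "closure (range z) \<subseteq> insert (z j) {u. sep_dist z j \<le> norm (z j - u)}"
    by (rule closure_minimal)
  thus ?thesis using assms by auto
qed

lemma sep_dist_nonneg: "sep_dist z j \<ge> 0"
proof -
  have "UNIV - {j} \<noteq> {}" by (metis Diff_eq_empty_iff UNIV_I finite.emptyI finite_insert infinite_UNIV_nat finite_subset)
  thus ?thesis unfolding sep_dist_def by (intro cINF_greatest) auto
qed

section \<open>The ideals of a fixed Blaschke sequence\<close>

locale holder_blaschke = holder_exponent +
  fixes z :: "nat \<Rightarrow> complex"
  assumes bs: "blaschke_sequence z"
begin

abbreviation B :: "complex \<Rightarrow> complex" where "B \<equiv> blaschke_product z"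
abbreviation b :: "nat \<Rightarrow> complex \<Rightarrow> complex" where "b N \<equiv> finite_blaschke z 0 N"

lemma zj: "norm (z j) < 1" by (rule blaschke_seq_norm[OF bs])

lemma b_multiplier:
  obtains \<rho> where "exterior_multiplier \<rho> (\<lambda>\<zeta>. inverse (finite_blaschke z M N \<zeta> ^ m))"
    "\<And>\<zeta>. \<rho> < norm \<zeta> \<Longrightarrow> norm \<zeta> < 1 \<Longrightarrow> finite_blaschke z M N \<zeta> ^ m \<noteq> 0"
proof -
  have "almost_inner (\<lambda>\<zeta>. finite_blaschke z M N \<zeta> ^ m)"
    by (intro almost_inner_power almost_inner_finite_blaschke zj)
  from almost_inner_exterior_multiplier[OF this] that show thesis by metis
qed

text \<open>The zeros with index from \<open>N\<close> to \<open>N + M\<close> are cancelled with a bound uniform in \<open>M\<close>; then \<open>M\<close> tends to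
  infinity.\<close>
lemma hb_partial:
  "\<exists>K>0. \<forall>C f m N. f holomorphic_on ball 0 1 \<longrightarrow> hb C (\<lambda>w. f w * B w ^ m) \<longrightarrow> hb (K * C) (\<lambda>w. f w * b N w ^ m)"
proof -
  obtain K where K: "K > 0" "\<And>C F f \<rho> \<gamma>. hb C F \<Longrightarrow> f holomorphic_on ball 0 1 \<Longrightarrow> exterior_multiplier \<rho> \<gamma> \<Longrightarrow>
     (\<And>\<zeta>. \<zeta>\<in>ball 0 1 \<Longrightarrow> \<rho> < norm \<zeta> \<Longrightarrow> f \<zeta> = F \<zeta> * \<gamma> \<zeta>) \<Longrightarrow> hb (K * C) f" using hb_division by blast
  have "hb (K * C) (\<lambda>w. f w * b N w ^ m)" if f: "f holomorphic_on ball 0 1" and F: "hb C (\<lambda>w. f w * B w ^ m)" for C f m N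
  proof (rule hb_limit)
    fix M :: nat
    define T where "T = blaschke_product (\<lambda>j. z (j + (N + M)))"
    define c where "c = finite_blaschke z N (N + M)"
    have sp: "B w = b N w * c w * T w" if "norm w < 1" for w
      using blaschke_product_split[OF bs that, of "N + M"] finite_blaschke_split[of 0 N "N + M" z w] by (simp add: T_def c_def)
    obtain \<rho> where \<rho>: "exterior_multiplier \<rho> (\<lambda>\<zeta>. inverse (c \<zeta> ^ m))" "\<And>\<zeta>. \<rho> < norm \<zeta> \<Longrightarrow> norm \<zeta> < 1 \<Longrightarrow> c \<zeta> ^ m \<noteq> 0"
      unfolding c_def using b_multiplier by blast
    show "hb (K * C) (\<lambda>w. f w * b N w ^ m * T w ^ m)"
    proof (rule K(2)[OF F _ \<rho>(1)])
      show "(\<lambda>w. f w * b N w ^ m * T w ^ m) holomorphic_on ball 0 1"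
        using blaschke_product_holomorphic[OF blaschke_sequence_shift[OF bs]] unfolding T_def
        by (intro holomorphic_intros f finite_blaschke_holomorphic zj)
      fix \<zeta> :: complex assume "\<zeta> \<in> ball 0 1" "\<rho> < norm \<zeta>"
      thus "f \<zeta> * b N \<zeta> ^ m * T \<zeta> ^ m = f \<zeta> * B \<zeta> ^ m * inverse (c \<zeta> ^ m)"
        using sp[of \<zeta>] \<rho>(2)[of \<zeta>] by (simp add: power_mult_distrib)
    qed
  next
    fix w :: complex assume "w \<in> ball 0 1"
    hence w: "norm w < 1" by simp
    define v where "v M = blaschke_product (\<lambda>j. z (j + M)) w" for M
    have "v \<longlonglongrightarrow> 1" unfolding v_def by (rule blaschke_product_tail_tendsto[OF bs w])
    hence "(\<lambda>M. v (M + N)) \<longlonglongrightarrow> 1" by (rule LIMSEQ_ignore_initial_segment)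
    hence "(\<lambda>M. v (N + M)) \<longlonglongrightarrow> 1" by (simp only: add.commute[of N])
    hence "(\<lambda>M. f w * b N w ^ m * v (N + M) ^ m) \<longlonglongrightarrow> f w * b N w ^ m * 1 ^ m"
      by (intro tendsto_mult tendsto_const tendsto_power)
    thus "(\<lambda>M. f w * b N w ^ m * blaschke_product (\<lambda>j. z (j + (N + M))) w ^ m) \<longlonglongrightarrow> f w * b N w ^ m"
      by (simp only: v_def power_one mult_1_right)
  qed
  thus ?thesis using K(1) by blast
qed

text \<open>The quotients by \<open>b N ^ k\<close> share one constant, because the division bound
  does not see the number of zeros. A limit along a Montel subsequence is therefore a quotient by
  \<open>B ^ k\<close>.\<close>

lemma hb_quotient:
  assumes inj: "inj z" and f: "hb C f" and van: "\<And>j s. s < k \<Longrightarrow> (deriv ^^ s) f (z j) = 0"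
  shows "\<exists>h C'. hb C' h \<and> (\<forall>w\<in>ball 0 1. f w = h w * B w ^ k)"
proof -
  obtain K where K: "K > 0" "\<And>C F f \<rho> \<gamma>. hb C F \<Longrightarrow> f holomorphic_on ball 0 1 \<Longrightarrow> exterior_multiplier \<rho> \<gamma> \<Longrightarrow>
     (\<And>\<zeta>. \<zeta>\<in>ball 0 1 \<Longrightarrow> \<rho> < norm \<zeta> \<Longrightarrow> f \<zeta> = F \<zeta> * \<gamma> \<zeta>) \<Longrightarrow> hb (K * C) f" using hb_division by blast
  have "\<forall>N. \<exists>h. h holomorphic_on ball 0 1 \<and> (\<forall>w\<in>ball 0 1. f w = h w * b N w ^ k)"
    using finite_blaschke_divides[OF zj inj holder_bounded_holomorphic[OF f] van] by blast
  then obtain h where h: "\<And>N. h N holomorphic_on ball 0 1" "\<And>N w. w\<in>ball 0 1 \<Longrightarrow> f w = h N w * b N w ^ k" by metis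
  have hN: "hb (K * C) (h N)" for N
  proof -
    obtain \<rho> where \<rho>: "exterior_multiplier \<rho> (\<lambda>\<zeta>. inverse (b N \<zeta> ^ k))" "\<And>\<zeta>. \<rho> < norm \<zeta> \<Longrightarrow> norm \<zeta> < 1 \<Longrightarrow> b N \<zeta> ^ k \<noteq> 0"
      using b_multiplier by blast
    show ?thesis
    proof (rule K(2)[OF f h(1) \<rho>(1)])
      fix \<zeta> :: complex assume "\<zeta> \<in> ball 0 1" "\<rho> < norm \<zeta>"
      thus "h N \<zeta> = f \<zeta> * inverse (b N \<zeta> ^ k)" using h(2)[of \<zeta> N] \<rho>(2)[of \<zeta>] by simp
    qed
  qed
  obtain g r where g: "g holomorphic_on ball 0 1" "strict_mono (r :: nat \<Rightarrow> nat)"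
      "\<And>x. x \<in> ball 0 1 \<Longrightarrow> (\<lambda>N. h (r N) x) \<longlonglongrightarrow> g x"
  proof (rule Montel[of "ball 0 1" "range h" h])
    show "\<exists>B. \<forall>h\<in>range h. \<forall>z\<in>K. norm (h z) \<le> B" if "compact K" "K \<subseteq> ball 0 1" for K
      using hN that unfolding holder_bounded_def by blast
  qed (use h in auto)
  have "hb (K * C) g" by (rule hb_limit[OF _ g(3)]) (rule hN)
  moreover have "f w = g w * B w ^ k" if w: "w \<in> ball 0 1" for w
  proof -
    have "(\<lambda>N. h (r N) w * b (r N) w ^ k) \<longlonglongrightarrow> g w * B w ^ k"
      using LIMSEQ_subseq_LIMSEQ[OF finite_blaschke_tendsto[OF bs, of w] g(2)] w
      by (intro tendsto_intros g(3)) (auto simp: o_def)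
    moreover have "h (r N) w * b (r N) w ^ k = f w" for N using h(2)[OF w] by simp
    ultimately show ?thesis by (simp add: LIMSEQ_const_iff)
  qed
  ultimately show ?thesis by blast
qed

lemma J_iff: "f \<in> J_ideal \<alpha> B k \<longleftrightarrow> (\<exists>C. hb C f) \<and> (\<exists>C. hb C (\<lambda>w. f w * B w ^ k))"
  by (simp add: J_ideal_def A_space_iff)

text \<open>The case \<open>N = 0\<close> of partial cancellation, in which all zeros are removed.
  It orders the ideals by inclusion.\<close>

lemma hb_lower_power:
  assumes "f holomorphic_on ball 0 1" "hb C (\<lambda>w. f w * B w ^ m)" shows "\<exists>C'. hb C' f"
proof -
  obtain K where "\<And>C f m N. f holomorphic_on ball 0 1 \<Longrightarrow> hb C (\<lambda>w. f w * B w ^ m) \<Longrightarrow> hb (K * C) (\<lambda>w. f w * b N w ^ m)"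
    using hb_partial by blast
  from this[OF assms, of 0] show ?thesis by auto
qed

lemma J_Suc_subset: "J_ideal \<alpha> B (k + 1) \<subseteq> J_ideal \<alpha> B k"
proof
  fix f assume f: "f \<in> J_ideal \<alpha> B (k + 1)"
  then obtain C where C: "hb C (\<lambda>w. f w * B w ^ (k + 1))" unfolding J_iff by blast
  have hf: "f holomorphic_on ball 0 1" using f J_iff holder_bounded_holomorphic by blast
  have "\<exists>C'. hb C' (\<lambda>w. f w * B w ^ k)"
  proof (rule hb_lower_power)
    show "(\<lambda>w. f w * B w ^ k) holomorphic_on ball 0 1"
      by (intro holomorphic_intros hf blaschke_product_holomorphic bs)
    show "hb C (\<lambda>w. f w * B w ^ k * B w ^ 1)" using C by (simp add: mult_ac)
  qed
  thus "f \<in> J_ideal \<alpha> B k" using f unfolding J_iff by blast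
qed

lemma J_is_ideal: "ideal_of_A \<alpha> (J_ideal \<alpha> B k)"
  unfolding ideal_of_A_def linear_subspace_of_A_def
proof (intro conjI ballI allI)
  show "J_ideal \<alpha> B k \<subseteq> A_space \<alpha>" by (auto simp: J_ideal_def)
  have "hb 0 (\<lambda>_. 0)" using hb_const[of 0] by simp
  thus "(\<lambda>z. 0) \<in> J_ideal \<alpha> B k" unfolding J_iff by auto
next
  fix f g assume "f \<in> J_ideal \<alpha> B k" "g \<in> J_ideal \<alpha> B k"
  then obtain C1 C2 D1 D2 where "hb C1 f" "hb C2 (\<lambda>w. f w * B w ^ k)" "hb D1 g" "hb D2 (\<lambda>w. g w * B w ^ k)"
    unfolding J_iff by blast
  from hb_add[OF this(1,3)] hb_add[OF this(2,4)] show "(\<lambda>z. f z + g z) \<in> J_ideal \<alpha> B k"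
    unfolding J_iff distrib_right by blast
next
  have mult: "(\<lambda>w. f w * g w) \<in> J_ideal \<alpha> B k" if f: "f \<in> J_ideal \<alpha> B k" and g: "hb C g" for f g C
  proof -
    obtain C1 C2 where "hb C1 f" "hb C2 (\<lambda>w. f w * B w ^ k)" using f unfolding J_iff by blast
    from hb_mult[OF this(1) g] hb_mult[OF this(2) g] show ?thesis
      unfolding J_iff by (simp add: mult_ac)
  qed
  show "(\<lambda>z. c * f z) \<in> J_ideal \<alpha> B k" if "f \<in> J_ideal \<alpha> B k" for c f
    using mult[OF that hb_const[of c]] by (simp add: mult.commute)
  show "(\<lambda>z. f z * g z) \<in> J_ideal \<alpha> B k" if "f \<in> J_ideal \<alpha> B k" "g \<in> A_space \<alpha>" for f g
    using mult that unfolding A_space_iff by blast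
qed

lemma J_nonideal:
  assumes k: "k \<ge> 1" and ne: "J_ideal \<alpha> B (k + 1) \<noteq> J_ideal \<alpha> B k"
  shows "nonideal_ideal_of_A \<alpha> (J_ideal \<alpha> B k)"
proof -
  obtain f where f: "f \<in> J_ideal \<alpha> B k" "f \<notin> J_ideal \<alpha> B (k + 1)" using ne J_Suc_subset[of k] by blast
  have hf: "f holomorphic_on ball 0 1" using f J_iff holder_bounded_holomorphic by blast
  obtain C where C: "hb C (\<lambda>w. f w * B w ^ k)" using f(1) J_iff by blast
  have "\<exists>C'. hb C' (\<lambda>w. f w * B w)"
  proof (rule hb_lower_power)
    show "(\<lambda>w. f w * B w) holomorphic_on ball 0 1"
      by (intro holomorphic_intros hf blaschke_product_holomorphic bs)
    \<comment> \<open>One factor is moved to \<open>f\<close>, and \<open>hb_lower_power\<close>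
      removes the other \<open>k - 1\<close>. This is where \<open>k \<ge> 1\<close> enters.\<close>
    have "B w ^ k = B w * B w ^ (k - 1)" for w using k by (cases k) auto
    thus "hb C (\<lambda>w. f w * B w * B w ^ (k - 1))" using C by (simp add: mult.assoc)
  qed
  hence a1: "(\<lambda>w. f w * B w) \<in> A_space \<alpha>" by (simp add: A_space_iff)
  have a2: "(\<lambda>w. f w * B w) \<notin> J_ideal \<alpha> B k"
  proof
    assume "(\<lambda>w. f w * B w) \<in> J_ideal \<alpha> B k"
    then obtain D where "hb D (\<lambda>w. f w * B w * B w ^ k)" unfolding J_iff by blast
    moreover have "f w * B w * B w ^ k = f w * B w ^ (k + 1)" for w by simp
    ultimately have "hb D (\<lambda>w. f w * B w ^ (k + 1))" by (simp only:)
    thus False using f unfolding J_iff by blast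
  qed
  have a3: "\<forall>w\<in>ball 0 1. norm (f w * B w) \<le> norm (f w)"
  proof
    fix w :: complex assume "w \<in> ball 0 1"
    hence "norm (f w) * norm (B w) \<le> norm (f w)"
      using norm_blaschke_product_le_1[OF bs, of w] by (intro mult_left_le) auto
    thus "norm (f w * B w) \<le> norm (f w)" by (simp only: norm_mult)
  qed
  have "\<not> ideal_subspace_of_A \<alpha> (J_ideal \<alpha> B k)"
  proof
    assume "ideal_subspace_of_A \<alpha> (J_ideal \<alpha> B k)"
    hence "\<forall>f\<in>J_ideal \<alpha> B k. \<forall>g\<in>A_space \<alpha>. (\<forall>w\<in>ball 0 1. norm (g w) \<le> norm (f w)) \<longrightarrow> g \<in> J_ideal \<alpha> B k"
      unfolding ideal_subspace_of_A_def by (elim conjE)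
    from mp[OF bspec[OF bspec[OF this f(1)] a1] a3] a2 show False by contradiction
  qed
  with J_is_ideal[of k] show ?thesis unfolding nonideal_ideal_of_A_def by (rule conjI)
qed

text \<open>Jets vanishing except in order \<open>k\<close>, where the size \<open>d\<^sub>j\<^bsup>\<alpha>-k\<^esup>\<close> is the largest allowed by
  the Whitney condition.\<close>
lemma interpolate_order_k:
  assumes inj: "inj z" and E: "A_interpolating_set n \<alpha> (closure (range z))" and k: "k \<le> n"
  shows "\<exists>f C. hb C f \<and> (\<forall>s j. s \<le> n \<longrightarrow> (deriv ^^ s) f (z j) = (if s = k then of_real (sep_dist z j powr (\<alpha> - k)) else 0))"
proof -
  define E where "E = closure (range z)"
  \<comment> \<open>Limit points of the zeros receive the zero jet. With the separation estimate,
    the value at any point of \<open>E\<close> is then at most the distance to any other point of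
    \<open>E\<close>, raised to the power \<open>\<alpha> - k\<close>.\<close>
  define D where "D w = (if w \<in> range z then sep_dist z (inv z w) powr (\<alpha> - k) else 0)" for w
  define \<phi> where "\<phi> s w = (if s = k then complex_of_real (D w) else 0)" for s w
  have ak: "\<alpha> - real k > 0" using k n_less by (simp add: le_less_trans)
  have D0: "D w \<ge> 0" for w by (simp add: D_def)
  have Dle: "D w \<le> norm (u - w) powr (\<alpha> - k)" if "u \<in> E" "u \<noteq> w" for u w
  proof (cases "w \<in> range z")
    case True
    then obtain j where j: "w = z j" by auto
    have "D w = sep_dist z j powr (\<alpha> - k)" using inj by (simp add: D_def j)
    also have "\<dots> \<le> norm (z j - u) powr (\<alpha> - k)"
      using that j sep_dist_nonneg ak unfolding E_def by (intro powr_mono2 sep_dist_le) auto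
    finally show ?thesis by (simp add: j norm_minus_commute)
  qed (simp add: D_def)
  have wh: "norm (\<phi> s u - (\<Sum>m=0..n - s. \<phi> (s + m) w / fact m * (u - w) ^ m)) \<le> 2 * norm (u - w) powr (\<alpha> - real s)"
    if u: "u \<in> E" and w: "w \<in> E" and s: "s \<le> n" for u w s
  \<comment> \<open>For \<open>u = w\<close> the right-hand side is \<open>0\<close>, a power of
    \<open>0\<close>, so the sum has to reproduce \<open>\<phi> s w\<close> exactly; its term
    \<open>m = 0\<close> does, the others carrying a factor \<open>0\<close>.\<close>
  proof (cases "u = w")
    case True
    have "(\<Sum>m=0..n - s. \<phi> (s + m) w / fact m * (u - w) ^ m) = (\<Sum>m=0..n - s. if m = 0 then \<phi> s w else 0)"
      using True by (intro sum.cong refl) auto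
    also have "\<dots> = \<phi> s w" by (subst sum.delta) auto
    finally have "(\<Sum>m=0..n - s. \<phi> (s + m) w / fact m * (u - w) ^ m) = \<phi> s w" .
    thus ?thesis using True by simp
  next
    case False
    define d where "d = norm (u - w)"
    have d0: "d > 0" using False by (simp add: d_def)
    have 1: "norm (\<phi> s u) \<le> d powr (\<alpha> - s)"
      using Dle[of w u] w False D0[of u] by (auto simp: \<phi>_def d_def norm_minus_commute)
    have 2: "norm (\<Sum>m=0..n - s. \<phi> (s + m) w / fact m * (u - w) ^ m) \<le> d powr (\<alpha> - s)"
    proof (cases "s \<le> k")
      case True
      have "(\<Sum>m=0..n - s. \<phi> (s + m) w / fact m * (u - w) ^ m) = (\<Sum>m=0..n - s. if m = k - s then complex_of_real (D w) / fact m * (u - w) ^ m else 0)"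
        using True by (intro sum.cong refl) (auto simp: \<phi>_def)
      also have "\<dots> = complex_of_real (D w) / fact (k - s) * (u - w) ^ (k - s)"
        using True k by (subst sum.delta) auto
      also have "norm \<dots> = D w / fact (k - s) * d ^ (k - s)" using D0[of w] by (simp add: norm_mult norm_divide norm_power d_def)
      also have "\<dots> \<le> D w / 1 * d ^ (k - s)" using D0[of w] d0 by (intro mult_right_mono divide_left_mono) (auto simp: fact_ge_1)
      also have "\<dots> \<le> d powr (\<alpha> - k) * d ^ (k - s)" using Dle[OF u] False d0 by (intro mult_right_mono) (auto simp: d_def)
      also have "\<dots> = d powr (\<alpha> - k) * d powr real (k - s)" using d0 by (simp add: powr_realpow)
      also have "\<dots> = d powr (\<alpha> - s)" using True by (simp flip: powr_add add: of_nat_diff)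
      finally show ?thesis .
    qed (auto simp: \<phi>_def)
    have "norm (\<phi> s u - (\<Sum>m=0..n - s. \<phi> (s + m) w / fact m * (u - w) ^ m)) \<le> d powr (\<alpha> - s) + d powr (\<alpha> - s)"
      by (rule order_trans[OF norm_triangle_ineq4 add_mono[OF 1 2]])
    thus ?thesis by (simp add: d_def)
  qed
  have "\<exists>C>0. \<forall>z\<in>E. \<forall>w\<in>E. \<forall>s\<le>n. norm (\<phi> s z - (\<Sum>m=0..n - s. \<phi> (s + m) w / fact m * (z - w) ^ m)) \<le> C * norm (z - w) powr (\<alpha> - real s)"
    using wh by (intro exI[of _ 2]) auto
  moreover have "\<forall>\<phi>. (\<exists>C>0. \<forall>z\<in>E. \<forall>w\<in>E. \<forall>s\<le>n. norm (\<phi> s z - (\<Sum>m=0..n - s. \<phi> (s + m) w / fact m * (z - w) ^ m)) \<le> C * norm (z - w) powr (\<alpha> - real s))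
      \<longrightarrow> (\<exists>g\<in>A_space \<alpha>. \<forall>s\<le>n. \<forall>w\<in>E. has_disc_value ((deriv ^^ s) g) w (\<phi> s w))"
    using assms(2) unfolding A_interpolating_set_def E_def by (elim conjE)
  ultimately have "\<exists>g\<in>A_space \<alpha>. \<forall>s\<le>n. \<forall>w\<in>E. has_disc_value ((deriv ^^ s) g) w (\<phi> s w)"
    by (rule rev_mp[OF _ spec[of _ \<phi>]])
  then obtain g where g: "g \<in> A_space \<alpha>" "\<And>s w. s \<le> n \<Longrightarrow> w \<in> E \<Longrightarrow> has_disc_value ((deriv ^^ s) g) w (\<phi> s w)"
    by blast
  obtain C where C: "hb C g" using g(1) unfolding A_space_iff by blast
  have "(deriv ^^ s) g (z j) = (if s = k then of_real (sep_dist z j powr (\<alpha> - k)) else 0)" if s: "s \<le> n" for s j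
  proof -
    have "z j \<in> E" unfolding E_def by (rule subsetD[OF closure_subset rangeI])
    from g(2)[OF s this] have "(deriv ^^ s) g (z j) = \<phi> s (z j)" using zj[of j] by (simp add: has_disc_value_def)
    thus ?thesis using inj by (simp add: \<phi>_def D_def)
  qed
  thus ?thesis using C by blast
qed

lemma J_eq_imp_bounded:
  assumes inj: "inj z" and E: "A_interpolating_set n \<alpha> (closure (range z))" and k: "1 \<le> k" "k \<le> n"
    and eq: "J_ideal \<alpha> B (k + 1) = J_ideal \<alpha> B k"
  shows "\<exists>M. \<forall>j. sep_dist z j / (1 - norm (z j)) \<le> M"
proof -
  obtain f C1 where f: "hb C1 f" and jets: "\<And>s j. s \<le> n \<Longrightarrow> (deriv ^^ s) f (z j) = (if s = k then of_real (sep_dist z j powr (\<alpha> - k)) else 0)"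
    using interpolate_order_k[OF inj E k(2)] by blast
  have "\<exists>h C'. hb C' h \<and> (\<forall>w\<in>ball 0 1. f w = h w * B w ^ k)"
  proof (rule hb_quotient[OF inj f])
    fix j s assume "s < k"
    thus "(deriv ^^ s) f (z j) = 0" using jets[of s j] k by simp
  qed
  then obtain h C' where h: "hb C' h" "\<And>w. w\<in>ball 0 1 \<Longrightarrow> f w = h w * B w ^ k" by blast
  have "hb C1 (\<lambda>w. h w * B w ^ k)" by (rule holder_bounded_cong[OF f h(2)])
  hence "h \<in> J_ideal \<alpha> B k" using h(1) unfolding J_iff by blast
  hence "h \<in> J_ideal \<alpha> B (k + 1)" by (simp only: eq)
  then obtain C2 where "hb C2 (\<lambda>w. h w * B w ^ (k + 1))" unfolding J_iff by blast
  hence C2: "hb C2 (\<lambda>w. f w * B w ^ 1)"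
  proof (rule holder_bounded_cong)
    fix w :: complex assume "w \<in> ball 0 1"
    from h(2)[OF this] show "h w * B w ^ (k + 1) = f w * B w ^ 1" by simp
  qed
  obtain K where K: "K > 0" "\<And>C f m N. f holomorphic_on ball 0 1 \<Longrightarrow> hb C (\<lambda>w. f w * B w ^ m) \<Longrightarrow> hb (K * C) (\<lambda>w. f w * b N w ^ m)"
    using hb_partial by blast
  define C where "C = max C1 (K * C2)"
  have Cf: "hb C f" by (rule holder_bounded_mono[OF f]) (simp add: C_def)
  have CF: "hb C (\<lambda>w. f w * b N w ^ 1)" for N
    by (rule holder_bounded_mono[OF K(2)[OF holder_bounded_holomorphic[OF f] C2]]) (simp add: C_def)
  have C0: "C \<ge> 0" by (rule holder_bounded_nonneg[OF Cf])
  have "(1::real) \<le> 2" by simp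
  from hb_exterior_taylor[OF this]
  obtain K' where K'0: "K' > 0" and K'_all: "\<forall>C F f \<rho> \<gamma> z v. hb C F \<longrightarrow> hb C f \<longrightarrow> exterior_multiplier \<rho> \<gamma> \<longrightarrow>
     (\<forall>\<zeta>\<in>ball 0 1. \<rho> < norm \<zeta> \<longrightarrow> f \<zeta> = F \<zeta> * \<gamma> \<zeta>) \<longrightarrow> z \<in> ball 0 1 \<longrightarrow> 1 < norm v \<longrightarrow>
     norm (v - z) \<le> 2 * (norm v - 1) \<longrightarrow> norm v - 1 \<le> 2 * (1 - norm z) \<longrightarrow>
     norm (tp f z v - tp F z v * \<gamma> v) \<le> K' * C * (norm v - 1) powr \<alpha>"
    by (elim exE conjE) (rule that)
  note K' = K'0 K'_all[rule_format]
  have ak: "\<alpha> - real k > 0" using k n_less by (simp add: le_less_trans)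
  define M where "M = fact k * K' * C * 2 powr \<alpha>"
  have M0: "M \<ge> 0" unfolding M_def using K'0 C0 by (intro mult_nonneg_nonneg) auto
  have "sep_dist z j / (1 - norm (z j)) \<le> max 4 (M powr (1 / (\<alpha> - k)))" for j
  \<comment> \<open>Zeros near the centre have reflections too far away for the comparison. For them
    the ratio is at most \<open>4\<close>, since points of the disc have distance at most
    \<open>2\<close>.\<close>
  proof (cases "norm (z j) < 1 / 2")
    case True
    have "z (Suc j) \<in> closure (range z)" by (rule subsetD[OF closure_subset rangeI])
    moreover have "z (Suc j) \<noteq> z j" using inj by (auto dest: injD)
    ultimately have "sep_dist z j \<le> norm (z j - z (Suc j))" by (rule sep_dist_le)
    also have "\<dots> \<le> 2" using norm_triangle_ineq4[of "z j" "z (Suc j)"] zj[of j] zj[of "Suc j"] by linarith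
    finally have "sep_dist z j / (1 - norm (z j)) \<le> 2 / (1 / 2)" using True by (intro frac_le) auto
    thus ?thesis by simp
  next
    case False
    define a where "a = z j"
    define \<delta> where "\<delta> = 1 - norm a"
    have a: "norm a < 1" "norm a \<ge> 1 / 2" and \<delta>: "\<delta> > 0" using zj[of j] False by (auto simp: a_def \<delta>_def)
    have a0: "a \<noteq> 0" using a by auto
    define v where "v = 1 / cnj a"
    have nv: "norm v = 1 / norm a" by (simp add: v_def norm_divide)
    have v1: "norm v - 1 = \<delta> / norm a" using a0 by (simp add: nv \<delta>_def field_simps)
    have "v - a = (1 - a * cnj a) / cnj a" using a0 by (simp add: v_def field_simps)
    also have "1 - a * cnj a = of_real (1 - norm a ^ 2)" unfolding of_real_diff complex_norm_square[of a] by simp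
    finally have va: "norm (v - a) = \<bar>1 - norm a ^ 2\<bar> / norm a" by (simp only: norm_divide norm_of_real complex_mod_cnj)
    have "norm a ^ 2 \<le> 1" using a by (simp add: power_le_one)
    hence "norm (v - a) = (1 - norm a ^ 2) / norm a" using va by simp
    also have "1 - norm a ^ 2 = \<delta> * (1 + norm a)" by (simp add: \<delta>_def power2_eq_square algebra_simps)
    finally have va: "norm (v - a) = \<delta> * (1 + norm a) / norm a" .
    have "\<delta> / norm a \<le> \<delta> / (1 / 2)" using a \<delta> by (intro divide_left_mono) auto
    hence dn: "\<delta> / norm a \<le> 2 * \<delta>" by simp
    obtain \<rho> where \<rho>: "exterior_multiplier \<rho> (\<lambda>\<zeta>. inverse (b (Suc j) \<zeta> ^ 1))" "\<And>\<zeta>. \<rho> < norm \<zeta> \<Longrightarrow> norm \<zeta> < 1 \<Longrightarrow> b (Suc j) \<zeta> ^ 1 \<noteq> 0"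
      using b_multiplier by blast
    \<comment> \<open>\<open>v\<close> is the pole of this factor, whose value there is
      \<open>0\<close> by division by zero. The inverse is again \<open>0\<close>, in agreement with
      the zero of \<open>1 / b\<close> at the reflected point, and the second polynomial drops
      out.\<close>
    have "blaschke_factor a v = 0" using a0 by (simp add: blaschke_factor_def v_def)
    hence bv: "b (Suc j) v = 0" by (simp add: finite_blaschke_Suc a_def)
    have "norm (tp f a v - tp (\<lambda>w. f w * b (Suc j) w ^ 1) a v * inverse (b (Suc j) v ^ 1)) \<le> K' * C * (norm v - 1) powr \<alpha>"
    proof (rule K'(2)[OF CF Cf \<rho>(1)])
      show "a \<in> ball 0 1" using a by simp
      show "1 < norm v" using nv a a0 by simp
      have "\<delta> * (1 + norm a) / norm a \<le> \<delta> * 2 / norm a" using a \<delta> by (intro divide_right_mono mult_left_mono) auto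
      thus "norm (v - a) \<le> 2 * (norm v - 1)" unfolding va v1 by simp
      show "norm v - 1 \<le> 2 * (1 - norm a)" unfolding v1 using dn by (simp add: \<delta>_def)
    qed (use \<rho>(2) in auto)
    hence "norm (tp f a v) \<le> K' * C * (norm v - 1) powr \<alpha>" using bv by simp
    also have "\<dots> \<le> K' * C * (2 * \<delta>) powr \<alpha>"
      using K'0 C0 v1 dn \<delta> a n_less by (intro mult_left_mono powr_mono2) auto
    finally have up: "norm (tp f a v) \<le> K' * C * (2 * \<delta>) powr \<alpha>" .
    have "tp f a v = (\<Sum>m\<le>n. if m = k then of_real (sep_dist z j powr (\<alpha> - k)) / fact m * (v - a) ^ m else 0)"
      unfolding taylor_poly_def using jets by (intro sum.cong refl) (auto simp: a_def)
    also have "\<dots> = of_real (sep_dist z j powr (\<alpha> - k)) / fact k * (v - a) ^ k"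
      using k by (subst sum.delta) auto
    finally have "norm (tp f a v) = sep_dist z j powr (\<alpha> - k) / fact k * norm (v - a) ^ k"
      by (simp add: norm_mult norm_divide norm_power)
    also have "\<dots> \<ge> sep_dist z j powr (\<alpha> - k) / fact k * \<delta> ^ k"
    proof -
      have "\<delta> \<le> norm (v - a)" unfolding va using \<delta> a a0 by (simp add: le_divide_eq)
      thus ?thesis using \<delta> by (intro mult_left_mono power_mono) auto
    qed
    \<comment> \<open>Dividing by \<open>\<delta> ^ k\<close> leaves the exponent
      \<open>\<alpha> - k\<close> on both sides, and a root of this positive order bounds the ratio
      of the separation to \<open>\<delta>\<close>.\<close>
    finally have "sep_dist z j powr (\<alpha> - k) / fact k * \<delta> ^ k \<le> K' * C * (2 * \<delta>) powr \<alpha>" using up by simp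
    hence "sep_dist z j powr (\<alpha> - k) * \<delta> ^ k \<le> M * \<delta> powr \<alpha>"
      using \<delta> by (simp add: M_def powr_mult field_simps)
    also have "\<delta> powr \<alpha> = \<delta> powr (\<alpha> - k) * \<delta> ^ k" using \<delta> by (simp add: powr_diff powr_realpow)
    finally have "sep_dist z j powr (\<alpha> - k) \<le> M * \<delta> powr (\<alpha> - k)" using \<delta> by simp
    hence "(sep_dist z j / \<delta>) powr (\<alpha> - k) \<le> M"
      using \<delta> sep_dist_nonneg by (simp add: powr_divide divide_le_eq)
    hence "((sep_dist z j / \<delta>) powr (\<alpha> - k)) powr (1 / (\<alpha> - k)) \<le> M powr (1 / (\<alpha> - k))"
      using ak by (intro powr_mono2) auto
    hence "sep_dist z j / \<delta> \<le> M powr (1 / (\<alpha> - k))"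
      using ak \<delta> sep_dist_nonneg[of z j] by (simp add: powr_powr)
    thus ?thesis by (simp add: \<delta>_def a_def)
  qed
  thus ?thesis by blast
qed

end

section \<open>Multiplication by finite Blaschke products\<close>

text \<open>Inversion in the circle carries the outer part of a disc centred inside into its inner
  part, so a bound assumed only within the unit disc can be exploited on the whole disc.\<close>

lemma dist_reflection_le:
  assumes v: "1 < norm v" and z: "norm z < 1"
  shows "norm (1 / cnj v - z) \<le> norm (v - z)"
proof -
  have "1 \<le> norm v ^ 2" "norm z ^ 2 \<le> 1" using v z by (auto simp: power_le_one one_le_power)
  hence "(1 - norm z ^ 2) * (1 - norm v ^ 2) \<le> 0" by (intro mult_nonneg_nonpos) auto
  hence "norm (1 - cnj z * v) ^ 2 \<le> norm (v - z) ^ 2" using blaschke_norm_identity[of z v] by linarith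
  hence le: "norm (1 - cnj z * v) \<le> norm (v - z)" by (rule power2_le_imp_le) simp
  have "v \<noteq> 0" using v by auto
  hence "1 / cnj v - z = cnj (1 - cnj z * v) / cnj v" by (simp add: field_simps)
  hence "norm (1 / cnj v - z) = norm (1 - cnj z * v) / norm v" by (simp only: norm_divide complex_mod_cnj)
  also have "\<dots> \<le> norm (1 - cnj z * v) / 1" using v by (intro divide_left_mono) auto
  finally show ?thesis using le by simp
qed

lemma norm_blaschke_factor_reflection:
  assumes a: "norm a < 1" and v: "1 < norm v" and nz: "1 - cnj a * v \<noteq> 0"
  shows "norm (blaschke_factor a v) * norm (blaschke_factor a (1 / cnj v)) = 1"
proof -
  have v0: "v \<noteq> 0" and va: "v \<noteq> a" using a v by auto
  have "1 / cnj v - a = cnj (1 - cnj a * v) / cnj v" using v0 by (simp add: field_simps)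
  hence 1: "norm (1 / cnj v - a) = norm (1 - cnj a * v) / norm v" by (simp only: norm_divide complex_mod_cnj)
  have "1 - cnj a * (1 / cnj v) = cnj (v - a) / cnj v" using v0 by (simp add: field_simps)
  hence 2: "norm (1 - cnj a * (1 / cnj v)) = norm (v - a) / norm v" by (simp only: norm_divide complex_mod_cnj)
  show ?thesis unfolding norm_blaschke_factor 1 2 using v0 va nz by (simp add: divide_simps)
qed

lemma finite_blaschke_zero:
  assumes "M \<le> j" "j < N" shows "finite_blaschke z M N (z j) = 0"
  unfolding finite_blaschke_def using assms
  by (intro prod_zero bexI[of _ j]) (auto simp: blaschke_factor_def)

text \<open>By reflection, a lower bound for a Blaschke product on the part of a disc inside the unit
  disc is an upper bound on the remaining part.\<close>
lemma finite_blaschke_deriv_bound: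
  assumes z: "\<And>j. norm (z j) < 1" and x: "x \<in> ball 0 1" and r: "0 < r" and \<epsilon>: "0 < \<epsilon>" "\<epsilon> \<le> 1"
    and low: "\<And>w. w \<in> ball 0 1 \<Longrightarrow> w \<in> ball x r \<Longrightarrow> \<epsilon> \<le> norm (finite_blaschke z 0 N w)"
  shows "norm ((deriv ^^ s) (finite_blaschke z 0 N) x) \<le> fact s * (1 / \<epsilon>) / r ^ s"
proof (rule Cauchy_estimate[OF _ r])
  have refl: "1 / cnj v \<in> ball 0 1 \<and> 1 / cnj v \<in> ball x r" if "v \<in> ball x r" "1 < norm v" for v
    using that dist_reflection_le[of v x] x by (auto simp: dist_norm norm_divide norm_minus_commute divide_less_eq)
  \<comment> \<open>A pole in the disc about \<open>x\<close> would reflect to a zero of the product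
    in the inner part, against the lower bound. So the product is holomorphic across the unit circle
    here.\<close>
  have nz: "1 - cnj (z j) * v \<noteq> 0" if v: "v \<in> ball x r" and j: "j < N" for v j
  proof
    assume eq: "1 - cnj (z j) * v = 0"
    hence v1: "1 < norm v" using one_minus_cnj_mult_nz[OF z, of v j] by force
    have "cnj (z j) * v = 1" using eq by simp
    hence "z j * cnj v = 1" by (metis complex_cnj_cnj complex_cnj_mult complex_cnj_one)
    moreover have "cnj v \<noteq> 0" using v1 by auto
    ultimately have "1 / cnj v = z j" by (simp add: field_simps)
    hence "\<epsilon> \<le> norm (finite_blaschke z 0 N (z j))" using refl[OF v v1] low[of "1 / cnj v"] by simp
    thus False using finite_blaschke_zero[of 0 j N z] j \<epsilon> by simp
  qed
  have "blaschke_factor (z j) holomorphic_on ball x r" if "j < N" for j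
  proof -
    obtain c where c: "\<And>w. blaschke_factor (z j) w = c * ((w - z j) / (1 - cnj (z j) * w))" using blaschke_factor_eq by blast
    show ?thesis unfolding c[abs_def] by (intro holomorphic_intros) (use nz that in auto)
  qed
  thus "finite_blaschke z 0 N holomorphic_on ball x r"
    unfolding finite_blaschke_def[abs_def] by (intro holomorphic_on_prod) auto
  fix v assume v: "v \<in> ball x r"
  show "norm (finite_blaschke z 0 N v) \<le> 1 / \<epsilon>"
  proof (cases "norm v \<le> 1")
    case True
    have "norm (finite_blaschke z 0 N v) \<le> 1" by (rule norm_finite_blaschke_le_1[OF z True])
    also have "1 \<le> 1 / \<epsilon>" using \<epsilon> by simp
    finally show ?thesis .
  next
    case False
    have "norm (finite_blaschke z 0 N v) * norm (finite_blaschke z 0 N (1 / cnj v)) =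
        (\<Prod>j=0..<N. norm (blaschke_factor (z j) v) * norm (blaschke_factor (z j) (1 / cnj v)))"
      by (simp add: finite_blaschke_def prod.distrib flip: prod_norm)
    also have "\<dots> = 1"
      using False nz[OF v] by (intro prod.neutral ballI norm_blaschke_factor_reflection[OF z]) auto
    finally have e: "norm (finite_blaschke z 0 N v) * norm (finite_blaschke z 0 N (1 / cnj v)) = 1" .
    have "\<epsilon> \<le> norm (finite_blaschke z 0 N (1 / cnj v))" using refl[OF v] False low by auto
    hence "norm (finite_blaschke z 0 N v) * \<epsilon> \<le> 1" using mult_left_mono[of \<epsilon> _ "norm (finite_blaschke z 0 N v)"] e by (metis norm_ge_zero)
    thus ?thesis using \<epsilon> by (simp add: le_divide_eq)
  qed
qed

context holder_exponent
begin

lemma hb_near_small_point: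
  assumes w: "w \<in> ball 0 1" and g: "g holomorphic_on ball 0 1" and C: "0 \<le> C"
    and small: "\<And>u. u \<in> ball w ((1 - norm w) / 2) \<Longrightarrow> norm (g u) \<le> C * (1 - norm w) powr \<alpha>"
    and t: "t \<le> n"
  shows "norm ((deriv ^^ t) g w) \<le> fact n * 2 ^ n * C * (1 - norm w) powr (\<alpha> - t)"
proof -
  define d where "d = 1 - norm w"
  have d0: "d > 0" using w by (simp add: d_def)
  have "norm ((deriv ^^ t) g w) \<le> fact t * (C * d powr \<alpha>) / (d / 2) ^ t"
  proof (rule Cauchy_estimate)
    have "ball w (d / 2) \<subseteq> ball 0 1" by (rule ball_shrink_subset[OF w]) (use d0 in \<open>simp add: d_def\<close>)
    thus "g holomorphic_on ball w (d / 2)" by (rule holomorphic_on_subset[OF g])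
  qed (use d0 small in \<open>auto simp: d_def\<close>)
  also have "\<dots> = fact t * 2 ^ t * C * (d powr \<alpha> / d ^ t)" by (simp add: power_divide)
  also have "d powr \<alpha> / d ^ t = d powr (\<alpha> - t)" using d0 by (simp add: powr_diff powr_realpow)
  also have "fact t * 2 ^ t * C * d powr (\<alpha> - t) \<le> fact n * 2 ^ n * C * d powr (\<alpha> - t)"
    using C t by (intro mult_right_mono mult_mono fact_mono power_increasing) auto
  finally show ?thesis by (simp add: d_def)
qed

text \<open>If \<open>x\<close> is close to the set where \<open>b\<close> is small, then
  \<open>g\<close> is small around \<open>x\<close> and Cauchy's estimate is enough. Otherwise let
  \<open>r\<close> be the distance to that set. It may far exceed the distance to the circle, and
  \<open>s\<close> derivatives of \<open>b\<close> cost only \<open>r\<close> to the power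
  \<open>-s\<close>. Those of \<open>g\<close> gain a matching power, as its jets are small at a
  nearly closest point of the set. In Leibniz' formula every term but the one with the top
  derivative of \<open>g\<close> becomes \<open>r\<close> to the negative power
  \<open>\<alpha> - (n + 1)\<close>, and \<open>r \<ge> \<delta> / 4\<close>.\<close>

lemma hb_mult_blaschke:
  assumes \<epsilon>: "0 < \<epsilon>" "\<epsilon> < 1" and C: "0 \<le> C"
  shows "\<exists>K. \<forall>z N g. (\<forall>j. norm (z j) < 1) \<longrightarrow> hb C g \<longrightarrow>
     (\<forall>w\<in>ball 0 1. norm (finite_blaschke z 0 N w) < \<epsilon> \<longrightarrow> (\<forall>u\<in>ball w ((1 - norm w) / 2). norm (g u) \<le> C * (1 - norm w) powr \<alpha>)) \<longrightarrow>
     hb K (\<lambda>w. g w * finite_blaschke z 0 N w)"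
proof -
  obtain Kd where Kd0: "Kd > 0" and Kd: "\<forall>C f. hb C f \<longrightarrow> (\<forall>i\<le>n. \<forall>z\<in>ball 0 1. norm ((deriv ^^ i) f z) \<le> Kd * C)"
    using hb_derivs_bounded by blast
  obtain Kw where Kw0: "Kw > 0" and Kw: "\<forall>C f. hb C f \<longrightarrow> (\<forall>s\<le>n. \<forall>z\<in>ball 0 1. \<forall>w\<in>ball 0 1.
     norm ((deriv ^^ s) f w - (\<Sum>m\<le>n - s. (deriv ^^ (s + m)) f z / fact m * (w - z) ^ m)) \<le> Kw * C * norm (w - z) powr (\<alpha> - s))"
    using hb_whitney by blast
  define K1 where "K1 = fact (Suc n) * C * 2 powr \<alpha> * 8 ^ Suc n"
  define K2 where "K2 = Kd * C * 8 powr \<alpha> + (Kw * C + Suc n * (fact n * 2 ^ n * C)) * 6 powr \<alpha>"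
  define K3 where "K3 = K2 * fact (Suc n) / \<epsilon> * 4 powr (Suc n - \<alpha>)"
  define K where "K = max C (max K1 (2 ^ Suc n * (C + K3)))"
  have pos: "K1 \<ge> 0" "K2 \<ge> 0" "K3 \<ge> 0"
    unfolding K1_def K2_def K3_def using Kd0 Kw0 C \<epsilon> by (auto intro!: add_nonneg_nonneg mult_nonneg_nonneg divide_nonneg_nonneg simp del: fact_Suc)
  have "hb K (\<lambda>w. g w * b w)"
    if z: "\<And>j. norm (z j) < 1" and g: "hb C g" and b: "b = finite_blaschke z 0 N"
    and small: "\<And>w u. w\<in>ball 0 1 \<Longrightarrow> norm (b w) < \<epsilon> \<Longrightarrow> u\<in>ball w ((1 - norm w) / 2) \<Longrightarrow> norm (g u) \<le> C * (1 - norm w) powr \<alpha>"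
    for z N g b
    unfolding holder_bounded_def
  proof (intro conjI ballI)
    have holg: "g holomorphic_on ball 0 1" by (rule holder_bounded_holomorphic[OF g])
    have holb: "b holomorphic_on ball 0 1" unfolding b by (rule finite_blaschke_holomorphic[OF z])
    show holgb: "(\<lambda>w. g w * b w) holomorphic_on ball 0 1" by (intro holomorphic_intros holg holb)
    have b1: "norm (b w) \<le> 1" if "w \<in> ball 0 1" for w
      unfolding b by (rule norm_finite_blaschke_le_1[OF z]) (use that in auto)
    have gC: "norm (g w) \<le> C" if "w \<in> ball 0 1" for w using g that by (simp add: holder_bounded_def)
    fix x :: complex assume x: "x \<in> ball 0 1"
    have "norm (g x) * norm (b x) \<le> C * 1" using gC[OF x] b1[OF x] C by (intro mult_mono) auto
    thus "norm (g x * b x) \<le> K" by (simp add: norm_mult K_def)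
    define \<delta> where "\<delta> = 1 - norm x"
    have \<delta>: "0 < \<delta>" "\<delta> \<le> 1" using x by (auto simp: \<delta>_def)
    define S where "S = {w \<in> ball 0 1. norm (b w) < \<epsilon>}"
    have "norm ((deriv ^^ Suc n) (\<lambda>w. g w * b w) x) \<le> max K1 (2 ^ Suc n * (C + K3)) * \<delta> powr (\<alpha> - Suc n)"
    proof (cases "\<exists>w\<in>S. norm (w - x) < \<delta> / 4")
      case True
      then obtain w where w: "w \<in> ball 0 1" "norm (b w) < \<epsilon>" "norm (w - x) < \<delta> / 4" by (auto simp: S_def)
      have nw: "norm w \<le> norm x + \<delta> / 4" "norm x \<le> norm w + \<delta> / 4"
        using w(3) norm_triangle_sub[of w x] norm_triangle_sub[of x w] by (auto simp: norm_minus_commute)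
      have wd: "1 - norm w \<le> 2 * \<delta>" using nw \<delta> unfolding \<delta>_def by argo
      \<comment> \<open>As \<open>norm (w - x) < \<delta> / 4\<close>, the disc about
        \<open>w\<close> on which \<open>g\<close> is small has radius at least
        \<open>3 * \<delta> / 8\<close> and contains the disc of radius \<open>\<delta> / 8\<close>
        about \<open>x\<close>.\<close>
      have sub: "ball x (\<delta> / 8) \<subseteq> ball 0 1" by (rule ball_shrink_subset[OF x]) (use \<delta> in \<open>auto simp: \<delta>_def\<close>)
      have "norm ((deriv ^^ Suc n) (\<lambda>w. g w * b w) x) \<le> fact (Suc n) * (C * (2 * \<delta>) powr \<alpha>) / (\<delta> / 8) ^ Suc n"
      proof (rule Cauchy_estimate)
        show "(\<lambda>w. g w * b w) holomorphic_on ball x (\<delta> / 8)" by (rule holomorphic_on_subset[OF holgb sub])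
        fix u assume u: "u \<in> ball x (\<delta> / 8)"
        have "norm (u - w) \<le> norm (u - x) + norm (w - x)" using norm_triangle_ineq4[of "u - x" "w - x"] by simp
        moreover have "norm (u - x) < \<delta> / 8" using u by (simp add: dist_norm norm_minus_commute)
        ultimately have "norm (u - w) < (1 - norm w) / 2" using w(3) nw unfolding \<delta>_def by argo
        hence "u \<in> ball w ((1 - norm w) / 2)" by (simp add: dist_norm norm_minus_commute)
        hence "norm (g u) \<le> C * (1 - norm w) powr \<alpha>" by (rule small[OF w(1,2)])
        also have "\<dots> \<le> C * (2 * \<delta>) powr \<alpha>"
          using C w wd n_less by (intro mult_left_mono powr_mono2) auto
        finally have "norm (g u) * norm (b u) \<le> C * (2 * \<delta>) powr \<alpha> * 1"
          using b1[of u] u sub C by (intro mult_mono) auto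
        thus "norm (g u * b u) \<le> C * (2 * \<delta>) powr \<alpha>" by (simp add: norm_mult)
      qed (use \<delta> in auto)
      also have "\<dots> = K1 * (\<delta> powr \<alpha> / \<delta> ^ Suc n)"
        using \<delta> unfolding K1_def by (simp add: powr_mult power_divide del: fact_Suc power_Suc)
      also have "\<delta> powr \<alpha> / \<delta> ^ Suc n = \<delta> powr (\<alpha> - Suc n)" using \<delta> by (simp add: powr_diff powr_realpow del: of_nat_Suc power_Suc)
      also have "K1 * \<delta> powr (\<alpha> - Suc n) \<le> max K1 (2 ^ Suc n * (C + K3)) * \<delta> powr (\<alpha> - Suc n)" by (intro mult_right_mono) auto
      finally show ?thesis .
    next
      case False
      \<comment> \<open>The value \<open>1 / 4\<close> keeps the infimum meaningful when
        \<open>b\<close> is nowhere small, and caps \<open>r\<close>.\<close>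
      define X where "X = insert (1 / 4) ((\<lambda>w. norm (w - x)) ` S)"
      define r where "r = Inf X"
      have bdd: "bdd_below X" unfolding X_def by (intro bdd_belowI[of _ 0]) auto
      have "\<delta> / 4 \<le> y" if "y \<in> X" for y using that False \<delta> by (auto simp: X_def not_less)
      hence r\<delta>: "\<delta> / 4 \<le> r" unfolding r_def by (intro cInf_greatest) (auto simp: X_def)
      have r4: "r \<le> 1 / 4" unfolding r_def by (intro cInf_lower bdd) (simp add: X_def)
      have r0: "0 < r" using r\<delta> \<delta> by simp
      have low: "\<epsilon> \<le> norm (b w)" if "w \<in> ball 0 1" "w \<in> ball x r" for w
      proof (rule ccontr)
        assume "\<not> \<epsilon> \<le> norm (b w)"
        hence "norm (w - x) \<in> X" using that by (auto simp: X_def S_def)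
        hence "r \<le> norm (w - x)" unfolding r_def by (intro cInf_lower bdd)
        thus False using that by (simp add: dist_norm norm_minus_commute)
      qed
      have bs: "norm ((deriv ^^ s) b x) \<le> fact s * (1 / \<epsilon>) / r ^ s" for s
        unfolding b by (rule finite_blaschke_deriv_bound[OF z x r0]) (use \<epsilon> low b in auto)
      have gs: "norm ((deriv ^^ s) g x) \<le> K2 * r powr (\<alpha> - s)" if s: "s \<le> n" for s
      proof -
        have as: "0 \<le> \<alpha> - real s" using s n_less by simp
        \<comment> \<open>The infimum need not be attained, so a distance below \<open>2 * r\<close>
          is taken. If it is the cap \<open>1 / 4\<close>, then \<open>r\<close> is bounded below
          and the global bounds of the derivatives suffice.\<close>
        have "Inf X < 2 * r" using r0 by (simp add: r_def)
        moreover have "X \<noteq> {}" by (simp add: X_def)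
        ultimately obtain y where y: "y \<in> X" "y < 2 * r" using cInf_lessD by meson
        consider "r \<ge> 1 / 8" | w where "w \<in> S" "norm (w - x) < 2 * r" using y by (auto simp: X_def)
        thus ?thesis
        proof cases
          case 1
          have "1 = 8 powr \<alpha> * (1 / 8) powr \<alpha>" by (simp add: powr_divide)
          also have "\<dots> \<le> 8 powr \<alpha> * (1 / 8) powr (\<alpha> - s)" by (intro mult_left_mono powr_mono') auto
          also have "\<dots> \<le> 8 powr \<alpha> * r powr (\<alpha> - s)" using 1 as by (intro mult_left_mono powr_mono2) auto
          finally have "Kd * C * 1 \<le> Kd * C * (8 powr \<alpha> * r powr (\<alpha> - s))"
            using Kd0 C by (intro mult_left_mono) auto
          moreover have "norm ((deriv ^^ s) g x) \<le> Kd * C" using Kd g s x by blast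
          moreover have "0 \<le> (Kw * C + Suc n * (fact n * 2 ^ n * C)) * 6 powr \<alpha> * r powr (\<alpha> - s)"
            using Kw0 C by (intro mult_nonneg_nonneg add_nonneg_nonneg) auto
          ultimately show ?thesis unfolding K2_def distrib_right[of _ _ "r powr (\<alpha> - real s)"] by linarith
        next
          case 2
          define c where "c = fact n * 2 ^ n * C"
          have c0: "c \<ge> 0" using C by (simp add: c_def)
          \<comment> \<open>\<open>D\<close> dominates both \<open>norm (x - w) < 2 * r\<close> and
            \<open>1 - norm w \<le> \<delta> + 2 * r\<close>, because
            \<open>\<delta> \<le> 4 * r\<close>.\<close>
          define D where "D = 6 * r"
          have D0: "D > 0" using r0 by (simp add: D_def)
          have w: "w \<in> ball 0 1" "norm (b w) < \<epsilon>" using 2 by (auto simp: S_def)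
          have xw: "norm (x - w) \<le> D" using 2 r0 by (simp add: D_def norm_minus_commute)
          have wD: "1 - norm w \<le> D"
            using norm_triangle_ineq2[of x w] 2 r\<delta> unfolding D_def \<delta>_def by (simp add: norm_minus_commute)
          define T where "T = (\<Sum>m\<le>n - s. (deriv ^^ (s + m)) g w / fact m * (x - w) ^ m)"
          have "norm ((deriv ^^ s) g x - T) \<le> Kw * C * norm (x - w) powr (\<alpha> - s)"
            unfolding T_def using Kw g s x w(1) by blast
          also have "\<dots> \<le> Kw * C * D powr (\<alpha> - s)" using Kw0 C xw as by (intro mult_left_mono powr_mono2) auto
          finally have 1: "norm ((deriv ^^ s) g x - T) \<le> Kw * C * D powr (\<alpha> - s)" .
          have "norm T \<le> (\<Sum>m\<le>n - s. c * D powr (\<alpha> - s))" unfolding T_def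
          proof (rule sum_norm_le)
            fix m assume "m \<in> {..n - s}"
            hence m: "s + m \<le> n" using s by auto
            have am: "0 \<le> \<alpha> - real (s + m)" using m n_less by linarith
            have "norm ((deriv ^^ (s + m)) g w) \<le> c * (1 - norm w) powr (\<alpha> - real (s + m))"
              unfolding c_def by (rule hb_near_small_point[OF w(1) holg C small[OF w] m])
            also have "\<dots> \<le> c * D powr (\<alpha> - real (s + m))"
              using c0 wD w(1) am by (intro mult_left_mono powr_mono2) auto
            finally have d: "norm ((deriv ^^ (s + m)) g w) \<le> c * D powr (\<alpha> - real (s + m))" .
            have "norm ((deriv ^^ (s + m)) g w / fact m * (x - w) ^ m) = norm ((deriv ^^ (s + m)) g w) / fact m * norm (x - w) ^ m"
              by (simp add: norm_mult norm_divide norm_power)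
            also have "\<dots> \<le> (c * D powr (\<alpha> - real (s + m))) / 1 * D ^ m"
              using d xw c0 by (intro mult_mono frac_le power_mono) (auto simp: fact_ge_1)
            also have "\<dots> = c * (D powr (\<alpha> - real (s + m)) * D powr real m)" using D0 by (simp add: powr_realpow)
            also have "D powr (\<alpha> - real (s + m)) * D powr real m = D powr (\<alpha> - s)" by (simp flip: powr_add)
            finally show "norm ((deriv ^^ (s + m)) g w / fact m * (x - w) ^ m) \<le> c * D powr (\<alpha> - s)" .
          qed
          also have "\<dots> = real (Suc (n - s)) * (c * D powr (\<alpha> - s))" by simp
          also have "\<dots> \<le> real (Suc n) * (c * D powr (\<alpha> - s))" using c0 by (intro mult_right_mono) auto
          finally have 2: "norm T \<le> real (Suc n) * (c * D powr (\<alpha> - s))" .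
          have "norm ((deriv ^^ s) g x) \<le> norm ((deriv ^^ s) g x - T) + norm T"
            using norm_triangle_ineq[of "(deriv ^^ s) g x - T" T] by simp
          also have "\<dots> \<le> (Kw * C + Suc n * c) * D powr (\<alpha> - s)"
            using 1 2 by (simp add: distrib_right mult.assoc)
          also have "D powr (\<alpha> - s) = 6 powr (\<alpha> - s) * r powr (\<alpha> - s)" using r0 by (simp add: D_def powr_mult)
          also have "(Kw * C + Suc n * c) * (6 powr (\<alpha> - s) * r powr (\<alpha> - s)) \<le> (Kw * C + Suc n * c) * (6 powr \<alpha> * r powr (\<alpha> - s))"
            using Kw0 C c0 by (intro mult_left_mono mult_right_mono powr_mono add_nonneg_nonneg) auto
          also have "\<dots> = (Kw * C + Suc n * c) * 6 powr \<alpha> * r powr (\<alpha> - s)" by simp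
          finally have a: "norm ((deriv ^^ s) g x) \<le> (Kw * C + Suc n * c) * 6 powr \<alpha> * r powr (\<alpha> - s)" .
          have "0 \<le> Kd * C * 8 powr \<alpha> * r powr (\<alpha> - s)" using Kd0 C by simp
          thus ?thesis using a unfolding K2_def c_def[symmetric] distrib_right[of _ _ "r powr (\<alpha> - real s)"] by linarith
        qed
      qed
      define p where "p = \<delta> powr (\<alpha> - Suc n)"
      have p0: "p \<ge> 0" by (simp add: p_def)
      have summand: "norm ((deriv ^^ i) g x) * norm ((deriv ^^ (Suc n - i)) b x) \<le> (C + K3) * p" if i: "i \<le> Suc n" for i
      proof (cases "i = Suc n")
        case True
        have "norm ((deriv ^^ Suc n) g x) * norm (b x) \<le> (C * p) * 1"
          using g x b1[OF x] C p0 unfolding holder_bounded_def p_def \<delta>_def by (intro mult_mono) auto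
        also have "\<dots> \<le> (C + K3) * p" using pos p0 by (simp add: distrib_right)
        finally show ?thesis using True by simp
      next
        case False
        hence i: "i \<le> n" using i by simp
        have "norm ((deriv ^^ i) g x) * norm ((deriv ^^ (Suc n - i)) b x)
            \<le> (K2 * r powr (\<alpha> - i)) * (fact (Suc n) * (1 / \<epsilon>) / r ^ (Suc n - i))"
        proof (rule mult_mono[OF gs[OF i]])
          have "norm ((deriv ^^ (Suc n - i)) b x) \<le> fact (Suc n - i) * (1 / \<epsilon>) / r ^ (Suc n - i)" by (rule bs)
          also have "\<dots> \<le> fact (Suc n) * (1 / \<epsilon>) / r ^ (Suc n - i)"
            using \<epsilon> r0 by (intro divide_right_mono mult_right_mono fact_mono) auto
          finally show "norm ((deriv ^^ (Suc n - i)) b x) \<le> fact (Suc n) * (1 / \<epsilon>) / r ^ (Suc n - i)" .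
        qed (use pos in auto)
        also have "\<dots> = K2 * fact (Suc n) / \<epsilon> * (r powr (\<alpha> - i) / r ^ (Suc n - i))" by simp
        also have "r powr (\<alpha> - i) / r ^ (Suc n - i) = r powr (\<alpha> - Suc n)"
        proof -
          have "r ^ (Suc n - i) = r powr real (Suc n - i)" using r0 by (simp only: powr_realpow)
          hence "r powr (\<alpha> - i) / r ^ (Suc n - i) = r powr (\<alpha> - i - real (Suc n - i))" by (simp only: powr_diff)
          also have "\<alpha> - i - real (Suc n - i) = \<alpha> - Suc n" using i by (simp add: of_nat_diff)
          finally show ?thesis .
        qed
        also have "K2 * fact (Suc n) / \<epsilon> * r powr (\<alpha> - Suc n) \<le> K2 * fact (Suc n) / \<epsilon> * (\<delta> / 4) powr (\<alpha> - Suc n)"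
          using r\<delta> \<delta> less_Suc_n pos \<epsilon> by (intro mult_left_mono powr_mono2' divide_nonneg_nonneg mult_nonneg_nonneg) auto
        also have "(\<delta> / 4) powr (\<alpha> - Suc n) = 4 powr (Suc n - \<alpha>) * p"
        proof -
          have "(\<delta> / 4) powr e = 4 powr (- e) * \<delta> powr e" for e :: real
            using \<delta> by (simp add: powr_divide powr_minus_divide)
          from this[of "\<alpha> - Suc n"] show ?thesis by (simp only: minus_diff_eq p_def)
        qed
        also have "K2 * fact (Suc n) / \<epsilon> * (4 powr (Suc n - \<alpha>) * p) = K3 * p" by (simp only: K3_def mult.assoc)
        also have "\<dots> \<le> (C + K3) * p" using C p0 by (intro mult_right_mono) auto
        finally show ?thesis .
      qed
      have "(deriv ^^ Suc n) (\<lambda>w. g w * b w) x =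
           (\<Sum>i = 0..Suc n. of_nat (Suc n choose i) * (deriv ^^ i) g x * (deriv ^^ (Suc n - i)) b x)"
        by (rule higher_deriv_mult[OF holg holb open_ball x])
      also have "norm \<dots> \<le> (\<Sum>i = 0..Suc n. real (Suc n choose i) * ((C + K3) * p))"
      proof (rule sum_norm_le)
        fix i assume "i \<in> {0..Suc n}"
        hence "real (Suc n choose i) * (norm ((deriv ^^ i) g x) * norm ((deriv ^^ (Suc n - i)) b x)) \<le> real (Suc n choose i) * ((C + K3) * p)"
          by (intro mult_left_mono summand) auto
        thus "norm (of_nat (Suc n choose i) * (deriv ^^ i) g x * (deriv ^^ (Suc n - i)) b x) \<le> real (Suc n choose i) * ((C + K3) * p)"
          by (simp only: norm_mult norm_of_nat mult.assoc)
      qed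
      also have "\<dots> = 2 ^ Suc n * (C + K3) * p"
      proof -
        have "(\<Sum>i = 0..Suc n. real (Suc n choose i)) = 2 ^ Suc n"
          using choose_row_sum[of "Suc n"] by (simp add: atMost_atLeast0 flip: of_nat_sum)
        thus ?thesis unfolding sum_distrib_right[symmetric] by simp
      qed
      also have "\<dots> \<le> max K1 (2 ^ Suc n * (C + K3)) * p" using p0 by (intro mult_right_mono) auto
      finally show ?thesis by (simp only: p_def)
    qed
    also have "\<dots> \<le> K * \<delta> powr (\<alpha> - Suc n)" by (intro mult_right_mono) (auto simp: K_def)
    finally show "norm ((deriv ^^ Suc n) (\<lambda>w. g w * b w) x) \<le> K * (1 - norm x) powr (\<alpha> - real (Suc n))"
      by (simp only: \<delta>_def)
  qed
  thus ?thesis by (intro exI[of _ K]) auto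
qed

text \<open>One factor at a time: \<open>b\<close> is bounded by \<open>1\<close> in the disc, so
  the product with its earlier powers is still small where \<open>b\<close> is small, and
  \<open>hb_mult_blaschke\<close> applies again with a larger constant.\<close>

lemma hb_mult_blaschke_power:
  assumes \<epsilon>: "0 < \<epsilon>" "\<epsilon> < 1" and C: "0 \<le> C"
  shows "\<exists>K. \<forall>z N g. (\<forall>j. norm (z j) < 1) \<longrightarrow> hb C g \<longrightarrow>
     (\<forall>w\<in>ball 0 1. norm (finite_blaschke z 0 N w) < \<epsilon> \<longrightarrow> (\<forall>u\<in>ball w ((1 - norm w) / 2). norm (g u) \<le> C * (1 - norm w) powr \<alpha>)) \<longrightarrow>
     hb K (\<lambda>w. g w * finite_blaschke z 0 N w ^ k)"
proof (induction k)
  case 0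
  show ?case by (intro exI[of _ C]) auto
next
  case (Suc k)
  then obtain K where K: "\<forall>z N g. (\<forall>j. norm (z j) < 1) \<longrightarrow> hb C g \<longrightarrow>
     (\<forall>w\<in>ball 0 1. norm (finite_blaschke z 0 N w) < \<epsilon> \<longrightarrow> (\<forall>u\<in>ball w ((1 - norm w) / 2). norm (g u) \<le> C * (1 - norm w) powr \<alpha>)) \<longrightarrow>
     hb K (\<lambda>w. g w * finite_blaschke z 0 N w ^ k)" by (elim exE)
  define M where "M = max C K"
  have M0: "0 \<le> M" using C by (simp add: M_def)
  obtain K' where K': "\<forall>z N g. (\<forall>j. norm (z j) < 1) \<longrightarrow> hb M g \<longrightarrow>
     (\<forall>w\<in>ball 0 1. norm (finite_blaschke z 0 N w) < \<epsilon> \<longrightarrow> (\<forall>u\<in>ball w ((1 - norm w) / 2). norm (g u) \<le> M * (1 - norm w) powr \<alpha>)) \<longrightarrow>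
     hb K' (\<lambda>w. g w * finite_blaschke z 0 N w)" using hb_mult_blaschke[OF \<epsilon> M0] by (elim exE)
  have "hb K' (\<lambda>w. g w * finite_blaschke z 0 N w ^ Suc k)"
    if z: "\<forall>j. norm (z j) < 1" and g: "hb C g"
      and small: "\<forall>w\<in>ball 0 1. norm (finite_blaschke z 0 N w) < \<epsilon> \<longrightarrow> (\<forall>u\<in>ball w ((1 - norm w) / 2). norm (g u) \<le> C * (1 - norm w) powr \<alpha>)" for z N g
  proof -
    have "hb K (\<lambda>w. g w * finite_blaschke z 0 N w ^ k)" by (rule K[rule_format]) (use z g small in auto)
    hence 1: "hb M (\<lambda>w. g w * finite_blaschke z 0 N w ^ k)" by (rule holder_bounded_mono) (simp add: M_def)
    have 2: "norm (g u * finite_blaschke z 0 N u ^ k) \<le> M * (1 - norm w) powr \<alpha>"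
      if w: "w \<in> ball 0 1" and bw: "norm (finite_blaschke z 0 N w) < \<epsilon>" and u: "u \<in> ball w ((1 - norm w) / 2)" for w u
    proof -
      have "ball w ((1 - norm w) / 2) \<subseteq> ball 0 1" by (rule ball_shrink_subset[OF w]) (use w in simp)
      hence "u \<in> ball 0 1" using u by blast
      hence "norm (finite_blaschke z 0 N u) \<le> 1" using z by (intro norm_finite_blaschke_le_1) auto
      hence "norm (finite_blaschke z 0 N u) ^ k \<le> 1" by (intro power_le_one) auto
      hence "norm (g u) * norm (finite_blaschke z 0 N u) ^ k \<le> (C * (1 - norm w) powr \<alpha>) * 1"
        using small w bw u C by (intro mult_mono) auto
      also have "\<dots> \<le> M * (1 - norm w) powr \<alpha>" by (simp add: M_def mult_right_mono)
      finally show ?thesis by (simp only: norm_mult norm_power)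
    qed
    have "hb K' (\<lambda>w. (g w * finite_blaschke z 0 N w ^ k) * finite_blaschke z 0 N w)"
      using K'[rule_format, OF _ 1 2] z by blast
    thus ?thesis by (simp add: mult_ac)
  qed
  thus ?case by (intro exI[of _ K']) blast
qed

end

section \<open>Smallness at the zeros\<close>

lemma poly_coeff_bound:
  fixes a :: "nat \<Rightarrow> complex"
  assumes r: "0 < r" and bd: "\<And>u. norm u < r \<Longrightarrow> norm (\<Sum>k\<le>n. a k * u ^ k) \<le> M" and s: "s \<le> n"
  shows "norm (a s) * r ^ s \<le> M"
proof -
  define p where "p = (\<lambda>u. \<Sum>k\<le>n. a k * u ^ k)"
  have hol: "p holomorphic_on A" for A unfolding p_def by (intro holomorphic_intros)
  have d: "(deriv ^^ s) p 0 = fact s * a s"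
  proof -
    have pw: "(deriv ^^ s) (\<lambda>u. a k * u ^ k) 0 = (if k = s then fact s * a s else 0)" for k
    proof -
      have "(deriv ^^ s) (\<lambda>u. a k * u ^ k) 0 = a k * (deriv ^^ s) (\<lambda>u. u ^ k) 0"
        by (rule higher_deriv_cmult[of _ UNIV]) (auto intro!: holomorphic_intros)
      also have "(deriv ^^ s) (\<lambda>u. u ^ k) (0::complex) = pochhammer (of_nat (Suc k - s)) s * 0 ^ (k - s)"
        using higher_deriv_power[of s "0::complex" k 0] by simp
      also have "\<dots> = (if k = s then fact s else 0)"
      proof (cases "k < s")
        case True
        hence "Suc k - s = 0" "s > 0" by auto
        thus ?thesis using True by (simp add: pochhammer_0_left)
      qed (auto simp: pochhammer_fact Suc_diff_le)
      finally show ?thesis by simp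
    qed
    have "(deriv ^^ s) (\<lambda>u. \<Sum>k\<le>m. a k * u ^ k) 0 = (\<Sum>k\<le>m. if k = s then fact s * a s else 0)" for m
    proof (induction m)
      case (Suc m)
      have "(deriv ^^ s) (\<lambda>u. (\<Sum>k\<le>m. a k * u ^ k) + a (Suc m) * u ^ Suc m) 0 =
         (deriv ^^ s) (\<lambda>u. \<Sum>k\<le>m. a k * u ^ k) 0 + (deriv ^^ s) (\<lambda>u. a (Suc m) * u ^ Suc m) 0"
        by (rule higher_deriv_add[of _ UNIV]) (auto intro!: holomorphic_intros)
      thus ?case using Suc pw[of "Suc m"] by simp
    qed (use pw[of 0] in simp)
    thus ?thesis using s by (simp add: p_def)
  qed
  have "norm ((deriv ^^ s) p 0) \<le> fact s * M / r ^ s"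
    by (rule Cauchy_estimate[OF hol r]) (use bd in \<open>auto simp: p_def\<close>)
  hence "fact s * norm (a s) \<le> fact s * (M / r ^ s)" unfolding d by (simp add: norm_mult)
  hence "norm (a s) \<le> M / r ^ s" by (rule mult_left_le_imp_le) simp
  thus ?thesis using r by (simp add: le_divide_eq)
qed

text \<open>A polynomial that is small near two nearby points, up to factors vanishing to order \<open>n\<close>
  at each of them, is small. If the points are very close, the first one alone carries a zero of
  order \<open>2 n > n\<close>; otherwise the value at the second one controls the leading coefficient.\<close>
lemma two_zeros_bound:
  fixes L K r :: real
  assumes n: "1 \<le> n" and L: "0 \<le> L" and K: "1 \<le> K" and r: "0 < r" "r \<le> 1"
  shows "\<exists>K'\<ge>0. \<forall>(c :: nat \<Rightarrow> complex) e \<eta>. 0 \<le> \<eta> \<longrightarrow> norm e \<le> L \<longrightarrow>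
     (\<forall>u. norm u < r \<longrightarrow> norm (\<Sum>s\<le>n. c s * u ^ s) \<le> K * ((\<Sum>s\<le>n. norm (c s)) * (norm u ^ n * norm (u - e) ^ n) + \<eta>)) \<longrightarrow>
     norm (\<Sum>s\<le>n. c s * e ^ s) \<le> K * \<eta> \<longrightarrow> (\<Sum>s\<le>n. norm (c s)) \<le> K' * \<eta>"
proof -
  have half: "A * t \<le> 1 / 2" if "t \<le> 1 / (2 * A)" "0 < A" for A t :: real
    using mult_left_mono[OF that(1), of A] that(2) by simp
  define G where "G = K * (2 + L) ^ n"
  have G: "G \<ge> 1" unfolding G_def using K L mult_mono[of 1 K 1 "(2 + L) ^ n"] by (simp add: one_le_power)
  \<comment> \<open>In Cauchy's estimate at radius \<open>t\<close> for a coefficient of order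
    \<open>s < n\<close>, the factor \<open>norm u ^ n\<close> leaves at least one power of
    \<open>t\<close>. A small \<open>\<tau>\<close> lets these coefficients be absorbed into the
    total \<open>m\<close>. For \<open>s = n\<close> nothing is left, and the position of
    \<open>e\<close> decides.\<close>
  define \<tau> where "\<tau> = min r (1 / (2 * ((n + 1) * G)))"
  have \<tau>: "0 < \<tau>" "\<tau> \<le> r" "\<tau> \<le> 1 / (2 * ((n + 1) * G))" using r G by (auto simp: \<tau>_def)
  have \<tau>1: "(n + 1) * G * \<tau> \<le> 1 / 2" by (rule half[OF \<tau>(3)]) (use G in auto)
  define H where "H = n + n * (1 + L) ^ n / \<tau> ^ n"
  have H: "H \<ge> 1" unfolding H_def using n L \<tau> by (simp add: add_increasing2)
  \<comment> \<open>A second, smaller scale for the case \<open>\<tau> < norm e\<close>. The leading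
    coefficient is recovered from the value at \<open>e\<close> with the loss \<open>H\<close>,
    which contains \<open>1 / \<tau> ^ n\<close>, and \<open>\<sigma>\<close> compensates for
    it.\<close>
  define \<sigma> where "\<sigma> = min \<tau> (1 / (2 * (H * G)))"
  have \<sigma>: "0 < \<sigma>" "\<sigma> \<le> \<tau>" "\<sigma> \<le> 1 / (2 * (H * G))" using \<tau> G H by (auto simp: \<sigma>_def)
  have \<sigma>1: "H * G * \<sigma> \<le> 1 / 2" by (rule half[OF \<sigma>(3)]) (use G H in auto)
  define K1 where "K1 = 2 * (n + 1) * K / \<tau> ^ n"
  define K2 where "K2 = 2 * (H * K / \<sigma> ^ n + K / \<tau> ^ n)"
  have "(\<Sum>s\<le>n. norm (c s)) \<le> max K1 K2 * \<eta>"
    if \<eta>: "0 \<le> \<eta>" and e: "norm e \<le> L"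
      and small: "\<And>u. norm u < r \<Longrightarrow> norm (\<Sum>s\<le>n. c s * u ^ s) \<le> K * ((\<Sum>s\<le>n. norm (c s)) * (norm u ^ n * norm (u - e) ^ n) + \<eta>)"
      and at_e: "norm (\<Sum>s\<le>n. c s * e ^ s) \<le> K * \<eta>" for c :: "nat \<Rightarrow> complex" and e \<eta>
  proof -
    define m where "m = (\<Sum>s\<le>n. norm (c s))"
    have m0: "0 \<le> m" unfolding m_def by (rule sum_nonneg) auto
    have coeff: "norm (c s) * t ^ s \<le> K * (m * (t ^ n * (t + norm e) ^ n) + \<eta>)" if t: "0 < t" "t \<le> r" and s: "s \<le> n" for t s
    proof (rule poly_coeff_bound[OF t(1) _ s])
      fix u :: complex assume u: "norm u < t"
      have "norm (\<Sum>s\<le>n. c s * u ^ s) \<le> K * (m * (norm u ^ n * norm (u - e) ^ n) + \<eta>)"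
        using small[of u] u t by (simp add: m_def)
      also have "\<dots> \<le> K * (m * (t ^ n * (t + norm e) ^ n) + \<eta>)"
        using u t K m0 norm_triangle_ineq4[of u e] by (intro mult_left_mono add_right_mono mult_mono power_mono) auto
      finally show "norm (\<Sum>k\<le>n. c k * u ^ k) \<le> K * (m * (t ^ n * (t + norm e) ^ n) + \<eta>)" .
    qed
    have low: "norm (c s) \<le> G * t * m + K * \<eta> / t ^ n" if t: "0 < t" "t \<le> r" and s: "s < n" for t s
    proof -
      have t1: "t \<le> 1" using t r by simp
      have "norm (c s) \<le> K * (m * (t ^ n * (t + norm e) ^ n) + \<eta>) / t ^ s"
        using coeff[OF t less_imp_le[OF s]] t by (simp add: le_divide_eq)
      also have "\<dots> = K * (m * (t ^ (n - s) * (t + norm e) ^ n)) + K * \<eta> / t ^ s"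
        using t s by (simp add: power_diff add_divide_distrib algebra_simps)
      also have "\<dots> \<le> K * (m * (t * (2 + L) ^ n)) + K * \<eta> / t ^ n"
      proof (intro add_mono mult_left_mono mult_mono divide_left_mono)
        show "t ^ (n - s) \<le> t" using power_decreasing[of 1 "n - s" t] t t1 s by simp
        show "(t + norm e) ^ n \<le> (2 + L) ^ n" using t1 e t by (intro power_mono) auto
        show "t ^ n \<le> t ^ s" using t t1 s by (intro power_decreasing) auto
      qed (use t K m0 \<eta> in auto)
      finally show ?thesis by (simp add: G_def mult_ac)
    qed
    have msplit: "m = (\<Sum>s<n. norm (c s)) + norm (c n)" unfolding m_def by (simp add: lessThan_Suc_atMost[symmetric])
    have "m \<le> max K1 K2 * \<eta>"
    proof (cases "norm e \<le> \<tau>")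
      case True
      have \<tau>le1: "\<tau> \<le> 1" using \<tau> r by simp
      have "norm (c n) \<le> K * (m * (\<tau> ^ n * (\<tau> + norm e) ^ n) + \<eta>) / \<tau> ^ n"
        using coeff[of \<tau> n] \<tau> by (simp add: le_divide_eq)
      also have "\<dots> = K * (m * (\<tau> + norm e) ^ n) + K * \<eta> / \<tau> ^ n"
        using \<tau> by (simp add: add_divide_distrib algebra_simps)
      also have "\<dots> \<le> K * (m * (2 * \<tau>) ^ n) + K * \<eta> / \<tau> ^ n"
        using True K m0 \<tau> by (intro add_right_mono mult_left_mono power_mono) auto
      also have "\<dots> \<le> K * (m * ((2 + L) ^ n * \<tau>)) + K * \<eta> / \<tau> ^ n"
      proof -
        have "(2 * \<tau>) ^ n \<le> (2 + L) ^ n * \<tau>"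
          unfolding power_mult_distrib using \<tau> \<tau>le1 n L power_decreasing[of 1 n \<tau>] by (intro mult_mono power_mono) auto
        thus ?thesis using K m0 by (intro add_right_mono mult_left_mono) auto
      qed
      finally have cn: "norm (c n) \<le> G * \<tau> * m + K * \<eta> / \<tau> ^ n"
        by (simp add: G_def mult_ac)
      have "m \<le> (\<Sum>s<n. G * \<tau> * m + K * \<eta> / \<tau> ^ n) + (G * \<tau> * m + K * \<eta> / \<tau> ^ n)"
        by (subst msplit) (intro add_mono sum_mono cn low[OF \<tau>(1,2)], simp)
      also have "\<dots> = ((n + 1) * G * \<tau>) * m + (n + 1) * K * \<eta> / \<tau> ^ n" by (simp add: algebra_simps add_divide_distrib)
      also have "\<dots> \<le> (1 / 2) * m + (n + 1) * K * \<eta> / \<tau> ^ n" using \<tau>1 m0 by (intro add_right_mono mult_right_mono) auto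
      finally have "m \<le> 2 * ((n + 1) * K * \<eta> / \<tau> ^ n)" by linarith
      also have "\<dots> = K1 * \<eta>" by (simp add: K1_def)
      also have "\<dots> \<le> max K1 K2 * \<eta>" using \<eta> by (intro mult_right_mono) auto
      finally show ?thesis .
    next
      case False
      define S where "S = G * \<sigma> * m + K * \<eta> / \<sigma> ^ n"
      have S0: "S \<ge> 0" unfolding S_def using G \<sigma> m0 K \<eta> by auto
      have lowS: "norm (c s) \<le> S" if "s < n" for s unfolding S_def using low[of \<sigma> s] \<sigma> \<tau> that by auto
      have "(\<Sum>s\<le>n. c s * e ^ s) = (\<Sum>s<n. c s * e ^ s) + c n * e ^ n" by (simp add: lessThan_Suc_atMost[symmetric])
      hence "norm (c n * e ^ n) \<le> norm (\<Sum>s\<le>n. c s * e ^ s) + norm (\<Sum>s<n. c s * e ^ s)"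
        using norm_triangle_ineq4[of "\<Sum>s\<le>n. c s * e ^ s" "\<Sum>s<n. c s * e ^ s"] by simp
      also have "norm (\<Sum>s<n. c s * e ^ s) \<le> (\<Sum>s<n. S * (1 + L) ^ n)"
      proof (rule sum_norm_le)
        fix s assume "s \<in> {..<n}"
        hence s: "s < n" by simp
        have "norm e ^ s \<le> (1 + L) ^ s" using e by (intro power_mono) auto
        also have "\<dots> \<le> (1 + L) ^ n" using s L by (intro power_increasing) auto
        finally show "norm (c s * e ^ s) \<le> S * (1 + L) ^ n"
          unfolding norm_mult norm_power using lowS[OF s] S0 by (intro mult_mono) auto
      qed
      finally have "norm (c n) * norm e ^ n \<le> K * \<eta> + n * (S * (1 + L) ^ n)"
        using at_e by (simp add: norm_mult norm_power)
      moreover have "norm (c n) * \<tau> ^ n \<le> norm (c n) * norm e ^ n" using False \<tau> by (intro mult_left_mono power_mono) auto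
      ultimately have "norm (c n) \<le> (K * \<eta> + n * (S * (1 + L) ^ n)) / \<tau> ^ n" using \<tau> by (simp add: le_divide_eq)
      moreover have "(\<Sum>s<n. norm (c s)) \<le> n * S" using sum_bounded_above[of "{..<n}" "\<lambda>s. norm (c s)" S] lowS by auto
      ultimately have "m \<le> n * S + (K * \<eta> + n * (S * (1 + L) ^ n)) / \<tau> ^ n" using msplit by linarith
      also have "\<dots> = H * S + K * \<eta> / \<tau> ^ n" by (simp add: H_def algebra_simps add_divide_distrib)
      also have "\<dots> = (H * G * \<sigma>) * m + (H * (K * \<eta> / \<sigma> ^ n) + K * \<eta> / \<tau> ^ n)" by (simp add: S_def algebra_simps)
      also have "\<dots> \<le> (1 / 2) * m + (H * (K * \<eta> / \<sigma> ^ n) + K * \<eta> / \<tau> ^ n)" using \<sigma>1 m0 by (intro add_right_mono mult_right_mono) auto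
      finally have "m \<le> 2 * (H * (K * \<eta> / \<sigma> ^ n) + K * \<eta> / \<tau> ^ n)" by simp
      also have "\<dots> = K2 * \<eta>" by (simp add: K2_def algebra_simps)
      also have "\<dots> \<le> max K1 K2 * \<eta>" using \<eta> by (intro mult_right_mono) auto
      finally show ?thesis .
    qed
    thus ?thesis by (simp add: m_def)
  qed
  moreover have "max K1 K2 \<ge> 0" using K \<tau> by (simp add: K1_def le_max_iff_disj)
  ultimately show ?thesis by (intro exI[of _ "max K1 K2"]) auto
qed

text \<open>The deficits \<open>X\<close> of the squared modulus at \<open>x\<close> and
  \<open>Y\<close> of the squared reciprocal at \<open>v\<close> satisfy
  \<open>X / 50 \<le> Y\<close>: a factor \<open>2\<close> comes from the numerators and
  \<open>25\<close> from \<open>w \<le> 5 * q\<close>. So the squared reciprocal is at most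
  \<open>exp (- X / 50)\<close>. Since \<open>x\<close> is not close to \<open>a\<close>,
  \<open>1 - X \<ge> 1 / 25\<close> and hence \<open>- (25 * X) \<le> ln (1 - X)\<close>, which
  explains \<open>1250 = 25 * 50\<close>. A bound by a power multiplies over all zeros without loss,
  so smallness of the product at \<open>x\<close> becomes smallness of its reciprocal across the
  circle.\<close>

lemma blaschke_factor_exterior_decay:
  assumes a: "norm a < 1" and x: "norm x < 1" and \<delta>: "\<delta> = 1 - norm x" and away: "\<delta> / 2 < norm (x - a)"
    and v: "1 + \<delta> / 2 \<le> norm v" "norm (v - x) \<le> 4 * \<delta>"
  shows "norm (inverse (blaschke_factor a v)) \<le> norm (blaschke_factor a x) powr (1 / 1250)"
proof -
  have \<delta>0: "\<delta> > 0" using x \<delta> by simp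
  define q where "q = norm (1 - cnj a * x)"
  have q1: "\<delta> \<le> q"
  proof -
    have "norm (cnj a * x) \<le> 1 * norm x" unfolding norm_mult using a by (intro mult_right_mono) auto
    thus ?thesis using norm_triangle_ineq2[of 1 "cnj a * x"] by (simp add: q_def \<delta>)
  qed
  have q0: "q > 0" using q1 \<delta>0 by simp
  have a2: "0 < 1 - norm a ^ 2" and x2: "0 < 1 - norm x ^ 2" using a x by (simp_all add: abs_square_less_1)
  have bx1: "norm (blaschke_factor a x) \<le> 1" by (rule norm_blaschke_factor_le_1) (use a x in auto)
  hence q2: "norm (x - a) \<le> q" unfolding norm_blaschke_factor using q0 by (simp add: q_def[symmetric] divide_le_eq)
  have q5: "q \<le> 5 * norm (x - a)"
  proof -
    have "1 - cnj a * x = of_real (1 - norm x ^ 2) + x * cnj (x - a)"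
      unfolding of_real_diff complex_norm_square by (simp add: algebra_simps)
    hence "q \<le> norm (complex_of_real (1 - norm x ^ 2)) + norm (x * cnj (x - a))"
      unfolding q_def by (metis norm_triangle_ineq)
    also have "\<dots> = (1 - norm x ^ 2) + norm x * norm (x - a)"
      using x2 unfolding norm_mult complex_mod_cnj norm_of_real by simp
    also have "norm x * norm (x - a) \<le> 1 * norm (x - a)" using x by (intro mult_right_mono) auto
    also have "1 - norm x ^ 2 = \<delta> * (1 + norm x)" by (simp add: \<delta> power2_eq_square algebra_simps)
    also have "\<dots> \<le> \<delta> * 2" using x \<delta>0 by (intro mult_left_mono) auto
    finally show ?thesis using away by simp
  qed
  define X where "X = (1 - norm a ^ 2) * (1 - norm x ^ 2) / q ^ 2"
  have X0: "X > 0" using a2 x2 q0 by (simp add: X_def)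
  have bX: "norm (blaschke_factor a x) ^ 2 = 1 - X"
    using blaschke_norm_identity[of a x] q0 unfolding norm_blaschke_factor X_def q_def[symmetric]
    by (simp add: power_divide field_simps)
  have X25: "1 / 25 \<le> 1 - X"
  proof -
    have "(1 / 5) ^ 2 \<le> norm (blaschke_factor a x) ^ 2"
      unfolding norm_blaschke_factor q_def[symmetric] using q5 q0 by (intro power_mono) (auto simp: le_divide_eq)
    thus ?thesis using bX by (simp add: power2_eq_square)
  qed
  have v1: "norm v > 1" using v \<delta>0 by simp
  define w where "w = norm (v - a)"
  have "norm v - norm a \<le> w" unfolding w_def by (rule norm_triangle_ineq2)
  hence w0: "w > 0" using v1 a by simp
  have "w \<le> norm (v - x) + norm (x - a)" unfolding w_def by norm
  hence w5: "w \<le> 5 * q" using v q1 q2 by simp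
  define Y where "Y = (1 - norm a ^ 2) * (norm v ^ 2 - 1) / w ^ 2"
  have bY: "norm (inverse (blaschke_factor a v)) ^ 2 = 1 - Y"
    using blaschke_norm_identity[of a v] w0 unfolding norm_inverse norm_blaschke_factor Y_def w_def[symmetric]
    by (simp add: power_divide field_simps)
  have "X / 50 \<le> Y"
  proof -
    have "1 - norm x ^ 2 = \<delta> * (1 + norm x)" by (simp add: \<delta> power2_eq_square algebra_simps)
    also have "\<dots> \<le> \<delta> * 2" using x \<delta>0 by (intro mult_left_mono) auto
    finally have 1: "(1 - norm x ^ 2) / 2 \<le> \<delta>" by simp
    have "norm v ^ 2 - 1 = (norm v - 1) * (norm v + 1)" by (simp add: power2_eq_square algebra_simps)
    also have "\<dots> \<ge> (\<delta> / 2) * 2" using v v1 \<delta>0 by (intro mult_mono) auto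
    finally have 2: "(1 - norm x ^ 2) / 2 \<le> norm v ^ 2 - 1" using 1 by simp
    have "X / 50 = (1 - norm a ^ 2) * ((1 - norm x ^ 2) / 2) / (5 * q) ^ 2" by (simp add: X_def power_mult_distrib)
    also have "\<dots> \<le> (1 - norm a ^ 2) * (norm v ^ 2 - 1) / w ^ 2"
      using 2 a2 x2 w0 w5 q0 by (intro frac_le mult_left_mono power_mono mult_nonneg_nonneg) auto
    finally show ?thesis by (simp add: Y_def)
  qed
  hence "norm (inverse (blaschke_factor a v)) ^ 2 \<le> 1 + (- X / 50)" using bY by simp
  also have "\<dots> \<le> exp (- X / 50)" by (rule exp_ge_add_one_self)
  also have "\<dots> \<le> exp ((1 / 1250) * ln (1 - X))"
  proof -
    have "- X / (1 - X) \<le> ln (1 - X)"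
      using ln_le_minus_one[of "1 / (1 - X)"] X25 by (simp add: ln_div field_simps)
    moreover have "X / (1 - X) \<le> X / (1 / 25)" using X25 X0 by (intro divide_left_mono) auto
    ultimately have "- (25 * X) \<le> ln (1 - X)" by simp
    thus ?thesis by simp
  qed
  also have "\<dots> = (norm (blaschke_factor a x) ^ 2) powr (1 / 1250)" using X25 by (simp add: powr_def bX)
  also have "\<dots> = (norm (blaschke_factor a x) powr (1 / 1250)) ^ 2" by (simp add: power2_eq_square powr_mult)
  finally show ?thesis by (rule power2_le_imp_le) simp
qed

lemma norm_inverse_blaschke_factor_le_1:
  assumes a: "norm a < 1" and v: "1 < norm v"
  shows "norm (inverse (blaschke_factor a v)) \<le> 1"
proof -
  have "1 \<le> norm v ^ 2" "norm a ^ 2 \<le> 1" using v a by (auto simp: power_le_one one_le_power)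
  hence "(1 - norm a ^ 2) * (1 - norm v ^ 2) \<le> 0" by (intro mult_nonneg_nonpos) auto
  hence "norm (1 - cnj a * v) ^ 2 \<le> norm (v - a) ^ 2" using blaschke_norm_identity[of a v] by linarith
  hence "norm (1 - cnj a * v) \<le> norm (v - a)" by (rule power2_le_imp_le) simp
  moreover have "0 < norm (v - a)" using a v by auto
  ultimately show ?thesis by (simp add: norm_inverse norm_blaschke_factor divide_le_eq)
qed

text \<open>With \<open>norm v - 1\<close> of order \<open>\<delta>\<close> this is a simple zero at
  the reflected point, measured in units of \<open>\<delta>\<close>; two such factors lead to the
  hypothesis of \<open>two_zeros_bound\<close>.\<close>

lemma norm_inverse_blaschke_factor_near:
  assumes a: "norm a < 1" "a \<noteq> 0" and v: "1 < norm v"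
  shows "norm (inverse (blaschke_factor a v)) \<le> norm (v - 1 / cnj a) / (norm v - 1)"
proof -
  have "1 - cnj a * v = - (cnj a * (v - 1 / cnj a))" using a by (simp add: algebra_simps)
  hence 1: "norm (1 - cnj a * v) = norm a * norm (v - 1 / cnj a)" by (simp only: norm_minus_cancel norm_mult complex_mod_cnj)
  have 2: "norm v - 1 \<le> norm (v - a)" using norm_triangle_ineq2[of v a] a by simp
  have "norm (inverse (blaschke_factor a v)) = norm a * norm (v - 1 / cnj a) / norm (v - a)"
    by (simp add: norm_inverse norm_blaschke_factor 1)
  also have "\<dots> \<le> 1 * norm (v - 1 / cnj a) / (norm v - 1)"
    using 2 a v by (intro frac_le mult_right_mono) auto
  finally show ?thesis by simp
qed

text \<open>The size of the Taylor polynomial on the disc of radius \<open>\<delta>\<close> about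
  \<open>x\<close>, in coefficients scaled to the unit disc. It is the unknown that the following
  estimates absorb.\<close>

definition jet_norm :: "nat \<Rightarrow> (complex \<Rightarrow> complex) \<Rightarrow> complex \<Rightarrow> real \<Rightarrow> real" where
  "jet_norm n f x \<delta> = (\<Sum>s\<le>n. norm ((deriv ^^ s) f x) / fact s * \<delta> ^ s)"

lemma jet_norm_nonneg: "0 \<le> \<delta> \<Longrightarrow> 0 \<le> jet_norm n f x \<delta>"
  unfolding jet_norm_def by (intro sum_nonneg) auto

lemma norm_taylor_poly_le:
  assumes "norm (v - x) \<le> L * \<delta>" "1 \<le> L" "0 \<le> \<delta>"
  shows "norm (taylor_poly n f x v) \<le> L ^ n * jet_norm n f x \<delta>"
  unfolding taylor_poly_def jet_norm_def sum_distrib_left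
proof (rule sum_norm_le)
  fix m assume m: "m \<in> {..n}"
  have "norm ((deriv ^^ m) f x / fact m * (v - x) ^ m) = norm ((deriv ^^ m) f x) / fact m * norm (v - x) ^ m"
    by (simp add: norm_mult norm_divide norm_power)
  also have "\<dots> \<le> norm ((deriv ^^ m) f x) / fact m * (L * \<delta>) ^ m"
    using assms by (intro mult_left_mono power_mono) auto
  also have "\<dots> = L ^ m * (norm ((deriv ^^ m) f x) / fact m * \<delta> ^ m)" by (simp add: power_mult_distrib)
  also have "\<dots> \<le> L ^ n * (norm ((deriv ^^ m) f x) / fact m * \<delta> ^ m)"
    using assms m by (intro mult_right_mono power_increasing) auto
  finally show "norm ((deriv ^^ m) f x / fact m * (v - x) ^ m) \<le> L ^ n * (norm ((deriv ^^ m) f x) / fact m * \<delta> ^ m)" .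
qed

text \<open>The new centre will be a reflected point and the unit \<open>\<delta>\<close>, which
  puts the relevant zeros of \<open>1 / b\<close> at bounded places. Cauchy's estimate on the unit
  disc about the old centre brings the coefficients back with a constant depending on
  \<open>n\<close> and \<open>L\<close> only.\<close>

lemma taylor_poly_recenter_scaled:
  assumes \<delta>: "0 < \<delta>" and e: "norm (e - x) \<le> L * \<delta>" and L: "0 \<le> L"
  shows "\<exists>c :: nat \<Rightarrow> complex. (\<forall>u. taylor_poly n f x (e + of_real \<delta> * u) = (\<Sum>s\<le>n. c s * u ^ s)) \<and>
    jet_norm n f x \<delta> \<le> (real n + 1) * (1 + L) ^ n * (\<Sum>s\<le>n. norm (c s))"
proof -
  define c where "c s = (\<Sum>m\<le>n - s. (deriv ^^ (s + m)) f x / fact m * (e - x) ^ m) / fact s * of_real \<delta> ^ s" for s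
  have c: "taylor_poly n f x (e + of_real \<delta> * u) = (\<Sum>s\<le>n. c s * u ^ s)" for u
    unfolding taylor_poly_recenter[of n f x _ e] c_def by (simp add: power_mult_distrib mult_ac)
  define a where "a s = (deriv ^^ s) f x / fact s * of_real \<delta> ^ s" for s
  define M where "M = (1 + L) ^ n * (\<Sum>s\<le>n. norm (c s))"
  have a_le: "norm (a s) \<le> M" if s: "s \<le> n" for s
  proof -
    have "norm (a s) * 1 ^ s \<le> M"
    proof (rule poly_coeff_bound[OF _ _ s])
      fix u :: complex assume u: "norm u < 1"
      define w where "w = u - (e - x) / of_real \<delta>"
      have ew: "e + of_real \<delta> * w = x + of_real \<delta> * u" 
      proof -
        have "of_real \<delta> * ((e - x) / of_real \<delta>) = e - x" using \<delta> by simp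
        thus ?thesis unfolding w_def right_diff_distrib by simp
      qed
      have "(\<Sum>k\<le>n. a k * u ^ k) = taylor_poly n f x (x + of_real \<delta> * u)"
        unfolding taylor_poly_def a_def by (simp add: power_mult_distrib mult_ac)
      also have "\<dots> = (\<Sum>s\<le>n. c s * w ^ s)" using c[of w] ew by simp
      also have "norm \<dots> \<le> (\<Sum>s\<le>n. norm (c s) * (1 + L) ^ n)"
      proof (rule sum_norm_le)
        fix s assume s: "s \<in> {..n}"
        have "norm ((e - x) / of_real \<delta>) \<le> L" using e \<delta> by (simp add: norm_divide divide_le_eq)
        hence "norm w \<le> 1 + L" unfolding w_def using u norm_triangle_ineq4[of u "(e - x) / of_real \<delta>"] by linarith
        hence "norm w ^ s \<le> (1 + L) ^ s" by (intro power_mono) auto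
        also have "\<dots> \<le> (1 + L) ^ n" using s L by (intro power_increasing) auto
        finally show "norm (c s * w ^ s) \<le> norm (c s) * (1 + L) ^ n"
          unfolding norm_mult norm_power by (intro mult_left_mono) auto
      qed
      finally show "norm (\<Sum>k\<le>n. a k * u ^ k) \<le> M" by (simp add: M_def sum_distrib_left mult.commute)
    qed simp
    thus ?thesis by simp
  qed
  have jet: "jet_norm n f x \<delta> = (\<Sum>s\<le>n. norm (a s))"
    unfolding jet_norm_def a_def using \<delta> by (simp add: norm_mult norm_divide norm_power)
  have "(\<Sum>s\<le>n. norm (a s)) \<le> of_nat (card {..n}) * M"
    by (rule sum_bounded_above) (use a_le in auto)
  hence "jet_norm n f x \<delta> \<le> (real n + 1) * (1 + L) ^ n * (\<Sum>s\<le>n. norm (c s))"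
    unfolding jet by (simp add: M_def mult.assoc add.commute)
  thus ?thesis by (intro exI[of _ c] conjI allI c)
qed

context holder_blaschke
begin

text \<open>The comparison in the exterior demands that the centre be about as close to
  \<open>v\<close> as the circle is. So it is applied at the reflection of \<open>v\<close>, and the
  polynomials are moved back to \<open>x\<close> at the cost of the admissible error. The polynomial
  of \<open>F\<close> is controlled by the jet of \<open>f\<close>, since \<open>F\<close> is
  dominated by \<open>f\<close> on the disc of radius \<open>1 - norm x\<close>. The result holds
  for \<open>v\<close> arbitrarily close to the circle and gains wherever \<open>1 / b\<close> is
  small.\<close>

lemma exterior_jet_bound:
  assumes L: "1 \<le> L"
  shows "\<exists>K\<ge>1. \<forall>C f x v N m. hb C f \<longrightarrow> hb C (\<lambda>w. f w * b N w ^ m) \<longrightarrow> x \<in> ball 0 1 \<longrightarrow> 1 < norm v \<longrightarrow>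
     norm v \<le> 2 \<longrightarrow> norm (v - x) \<le> L * (1 - norm x) \<longrightarrow>
     norm (tp f x v) \<le> K * (jet_norm n f x (1 - norm x) * norm (inverse (b N v)) ^ m + C * (1 - norm x) powr \<alpha>)"
proof -
  have "(1::real) \<le> 2" by simp
  from hb_exterior_taylor[OF this]
  obtain K1 where K1: "K1 > 0" and K1_all: "\<forall>C F f \<rho> \<gamma> z v. hb C F \<longrightarrow> hb C f \<longrightarrow> exterior_multiplier \<rho> \<gamma> \<longrightarrow>
     (\<forall>\<zeta>\<in>ball 0 1. \<rho> < norm \<zeta> \<longrightarrow> f \<zeta> = F \<zeta> * \<gamma> \<zeta>) \<longrightarrow> z \<in> ball 0 1 \<longrightarrow> 1 < norm v \<longrightarrow>
     norm (v - z) \<le> 2 * (norm v - 1) \<longrightarrow> norm v - 1 \<le> 2 * (1 - norm z) \<longrightarrow>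
     norm (tp f z v - tp F z v * \<gamma> v) \<le> K1 * C * (norm v - 1) powr \<alpha>"
    by (elim exE conjE) (rule that)
  obtain K2 where K2: "K2 > 0" and K2_all: "\<forall>C f z w v. hb C f \<longrightarrow> z \<in> ball 0 1 \<longrightarrow> w \<in> ball 0 1 \<longrightarrow>
     norm (tp f z v - tp f w v) \<le> K2 * C * (norm (w - z) + norm (v - w)) powr \<alpha>"
    using hb_taylor_compare by (elim exE conjE) (rule that)
  obtain K3 where K3: "K3 > 0" and K3_all: "\<forall>C f z w. hb C f \<longrightarrow> z \<in> ball 0 1 \<longrightarrow> w \<in> ball 0 1 \<longrightarrow> norm (f w - tp f z w) \<le> K3 * C * norm (w - z) powr \<alpha>"
    using hb_taylor by (elim exE conjE) (rule that)
  define c where "c = (real n + 1) * L ^ n"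
  have c1: "c \<ge> 1" unfolding c_def using L mult_mono[of 1 "real n + 1" 1 "L ^ n"] by (simp add: one_le_power)
  define E where "E = 2 * (c * K3) + (K1 * L powr \<alpha> + 3 * (K2 * (3 * L) powr \<alpha>))"
  have E0: "E \<ge> 0" unfolding E_def using c1 K1 K2 K3 by (intro add_nonneg_nonneg mult_nonneg_nonneg) auto
  have "norm (tp f x v) \<le> max c E * (jet_norm n f x (1 - norm x) * norm (inverse (b N v)) ^ m + C * (1 - norm x) powr \<alpha>)"
    if f: "hb C f" and F: "hb C (\<lambda>w. f w * b N w ^ m)" and x: "x \<in> ball 0 1" and v: "1 < norm v" "norm v \<le> 2"
      and vx: "norm (v - x) \<le> L * (1 - norm x)" for C f x v N m
  proof -
    define F where "F = (\<lambda>w. f w * b N w ^ m)"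
    have F': "hb C F" using F by (simp only: F_def)
    define \<delta> where "\<delta> = 1 - norm x"
    have \<delta>: "\<delta> > 0" using x by (simp add: \<delta>_def)
    have C0: "C \<ge> 0" by (rule holder_bounded_nonneg[OF f])
    define M where "M = jet_norm n f x \<delta>"
    have M0: "M \<ge> 0" unfolding M_def using \<delta> by (intro jet_norm_nonneg) simp
    have hF: "F holomorphic_on ball 0 1" by (rule holder_bounded_holomorphic[OF F'])
    have sub: "ball x \<delta> \<subseteq> ball 0 1" by (rule ball_shrink_subset[OF x]) (simp add: \<delta>_def)
    have Fu: "norm (F u) \<le> M + K3 * C * \<delta> powr \<alpha>" if u: "u \<in> ball x \<delta>" for u
    proof -
      have ud: "u \<in> ball 0 1" using u sub by blast
      have ux: "norm (u - x) \<le> 1 * \<delta>" using u by (simp add: dist_norm norm_minus_commute)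
      have "norm (b N u) \<le> 1" by (rule norm_finite_blaschke_le_1[OF zj]) (use ud in auto)
      hence "norm (b N u) ^ m \<le> 1" by (intro power_le_one) auto
      hence "norm (F u) \<le> norm (f u)" by (simp add: F_def norm_mult norm_power mult_left_le)
      also have "\<dots> \<le> norm (tp f x u) + norm (f u - tp f x u)" using norm_triangle_sub[of "f u" "tp f x u"] by simp
      also have "norm (tp f x u) \<le> 1 ^ n * M" unfolding M_def by (rule norm_taylor_poly_le[OF ux]) (use \<delta> in auto)
      also have "norm (f u - tp f x u) \<le> K3 * C * norm (u - x) powr \<alpha>" by (rule K3_all[rule_format, OF f x ud])
      also have "\<dots> \<le> K3 * C * \<delta> powr \<alpha>" using K3 C0 ux n_less by (intro mult_left_mono powr_mono2) auto
      finally show ?thesis by simp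
    qed
    have jF: "jet_norm n F x \<delta> \<le> (real n + 1) * (M + K3 * C * \<delta> powr \<alpha>)"
    proof -
      have "norm ((deriv ^^ s) F x) / fact s * \<delta> ^ s \<le> M + K3 * C * \<delta> powr \<alpha>" for s
      proof -
        have "norm ((deriv ^^ s) F x) \<le> fact s * (M + K3 * C * \<delta> powr \<alpha>) / \<delta> ^ s"
          by (rule Cauchy_estimate[OF holomorphic_on_subset[OF hF sub] \<delta> Fu])
        hence "norm ((deriv ^^ s) F x) / fact s * \<delta> ^ s \<le> (fact s * (M + K3 * C * \<delta> powr \<alpha>) / \<delta> ^ s) / fact s * \<delta> ^ s"
          using \<delta> by (intro mult_right_mono divide_right_mono) auto
        also have "\<dots> = M + K3 * C * \<delta> powr \<alpha>" using \<delta> by simp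
        finally show ?thesis .
      qed
      thus ?thesis unfolding jet_norm_def
        using sum_bounded_above[of "{..n}" "\<lambda>s. norm ((deriv ^^ s) F x) / fact s * \<delta> ^ s" "M + K3 * C * \<delta> powr \<alpha>"] by (simp add: add.commute)
    qed
    have tF: "norm (tp F x v) \<le> c * (M + K3 * C * \<delta> powr \<alpha>)"
    proof -
      have "norm (tp F x v) \<le> L ^ n * jet_norm n F x \<delta>"
        by (rule norm_taylor_poly_le) (use vx L \<delta> in \<open>auto simp: \<delta>_def\<close>)
      also have "\<dots> \<le> L ^ n * ((real n + 1) * (M + K3 * C * \<delta> powr \<alpha>))" using jF L by (intro mult_left_mono) auto
      finally show ?thesis by (simp add: c_def mult_ac)
    qed
    have "\<exists>\<rho>. exterior_multiplier \<rho> (\<lambda>\<zeta>. inverse (b N \<zeta> ^ m)) \<and> (\<forall>\<zeta>. \<rho> < norm \<zeta> \<longrightarrow> norm \<zeta> < 1 \<longrightarrow> b N \<zeta> ^ m \<noteq> 0)"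
      by (rule b_multiplier[of 0 N m]) blast
    then obtain \<rho> where \<rho>: "exterior_multiplier \<rho> (\<lambda>\<zeta>. inverse (b N \<zeta> ^ m))" "\<And>\<zeta>. \<rho> < norm \<zeta> \<Longrightarrow> norm \<zeta> < 1 \<Longrightarrow> b N \<zeta> ^ m \<noteq> 0"
      by (elim exE conjE) (rule that, auto)
    define \<gamma> where "\<gamma> = inverse (b N v ^ m)"
    have \<gamma>n: "norm \<gamma> = norm (inverse (b N v)) ^ m" unfolding \<gamma>_def by (simp only: norm_inverse norm_power power_inverse)
    have \<gamma>2: "norm \<gamma> \<le> 2" using \<rho>(1) v unfolding \<gamma>_def exterior_multiplier_def by auto
    define y where "y = 1 / cnj v"
    have ny: "norm y = 1 / norm v" by (simp add: y_def norm_divide)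
    have y: "y \<in> ball 0 1" using v ny by (simp add: divide_less_eq)
    have v0: "v \<noteq> 0" using v by auto
    have vy: "norm (v - y) \<le> 2 * (norm v - 1)"
    proof -
      have "v - y = (v * cnj v - 1) / cnj v" using v0 by (simp add: y_def field_simps)
      also have "v * cnj v - 1 = of_real (norm v ^ 2 - 1)" unfolding of_real_diff complex_norm_square by simp
      finally have "norm (v - y) = \<bar>norm v ^ 2 - 1\<bar> / norm v" by (simp only: norm_divide norm_of_real complex_mod_cnj)
      moreover have "norm v ^ 2 \<ge> 1" using v by (simp add: one_le_power)
      ultimately have "norm (v - y) = (norm v - 1) * ((norm v + 1) / norm v)" by (simp add: power2_eq_square algebra_simps)
      also have "\<dots> \<le> (norm v - 1) * 2" using v by (intro mult_left_mono) (auto simp: divide_le_eq)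
      finally show ?thesis by simp
    qed
    have vL: "norm v - 1 \<le> L * \<delta>" using norm_triangle_ineq2[of v x] vx \<delta> by (simp add: \<delta>_def)
    have 1: "norm (tp f y v - tp F y v * \<gamma>) \<le> K1 * C * (norm v - 1) powr \<alpha>"
      unfolding \<gamma>_def
    proof (rule K1_all[rule_format, OF F' f \<rho>(1) _ y v(1) vy])
      show "f \<zeta> = F \<zeta> * inverse (b N \<zeta> ^ m)" if "\<zeta> \<in> ball 0 1" "\<rho> < norm \<zeta>" for \<zeta>
        using \<rho>(2)[of \<zeta>] that by (simp add: F_def)
      have "1 - norm y = (norm v - 1) / norm v" using v0 by (simp add: ny field_simps)
      also have "\<dots> \<ge> (norm v - 1) / 2" using v by (intro divide_left_mono) auto
      finally show "norm v - 1 \<le> 2 * (1 - norm y)" by simp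
    qed
    have cmp: "norm (tp h x v - tp h y v) \<le> K2 * C * (3 * L * \<delta>) powr \<alpha>" if h: "hb C h" for h
    proof -
      have "norm (y - x) \<le> L * \<delta>" using dist_reflection_le[OF v(1), of x] x vx by (simp add: y_def \<delta>_def)
      hence "norm (y - x) + norm (v - y) \<le> 3 * L * \<delta>" using vy vL by simp
      hence "K2 * C * (norm (y - x) + norm (v - y)) powr \<alpha> \<le> K2 * C * (3 * L * \<delta>) powr \<alpha>"
        using K2 C0 n_less by (intro mult_left_mono powr_mono2) auto
      thus ?thesis using K2_all[rule_format, OF h x y, of v] by linarith
    qed
    have s1: "norm (tp f x v) \<le> norm (tp F x v) * norm \<gamma> + norm (tp f x v - tp f y v) + norm (tp f y v - tp F y v * \<gamma>) + norm (tp F x v - tp F y v) * norm \<gamma>"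
    proof -
      have "norm p \<le> norm p' * norm \<gamma> + norm (p - q) + norm (q - q' * \<gamma>) + norm (p' - q') * norm \<gamma>" for p p' q q' :: complex
      proof -
        have "norm (a1 + a2 + a3 - a4) \<le> norm a1 + norm a2 + norm a3 + norm a4" for a1 a2 a3 a4 :: complex by norm
        note tri = this[of "p' * \<gamma>" "p - q" "q - q' * \<gamma>" "(p' - q') * \<gamma>"]
        have e: "p' * \<gamma> + (p - q) + (q - q' * \<gamma>) - (p' - q') * \<gamma> = p" by (simp add: algebra_simps)
        show ?thesis using tri unfolding e norm_mult .
      qed
      thus ?thesis .
    qed
    have s2: "norm (tp F x v - tp F y v) * norm \<gamma> \<le> K2 * C * (3 * L * \<delta>) powr \<alpha> * 2"
      by (rule mult_mono[OF cmp[OF F'] \<gamma>2]) (use K2 C0 in \<open>auto intro!: mult_nonneg_nonneg\<close>)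
    have "K1 * C * (norm v - 1) powr \<alpha> \<le> K1 * C * (L * \<delta>) powr \<alpha>"
      using K1 C0 vL v n_less by (intro mult_left_mono powr_mono2) auto
    hence s3: "norm (tp f y v - tp F y v * \<gamma>) \<le> K1 * C * (L * \<delta>) powr \<alpha>" using 1 by linarith
    have s4: "norm (tp F x v) * norm \<gamma> \<le> c * M * norm \<gamma> + c * (K3 * C * \<delta> powr \<alpha>) * 2"
    proof -
      have 1: "norm (tp F x v) * norm \<gamma> \<le> c * (M + K3 * C * \<delta> powr \<alpha>) * norm \<gamma>" using tF by (rule mult_right_mono) simp
      have 2: "c * (K3 * C * \<delta> powr \<alpha>) * norm \<gamma> \<le> c * (K3 * C * \<delta> powr \<alpha>) * 2"
        using \<gamma>2 by (rule mult_left_mono) (use c1 K3 C0 in auto)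
      show ?thesis using 1 2 unfolding distrib_left distrib_right by linarith
    qed
    have p1: "(3 * L * \<delta>) powr \<alpha> = (3 * L) powr \<alpha> * \<delta> powr \<alpha>" "(L * \<delta>) powr \<alpha> = L powr \<alpha> * \<delta> powr \<alpha>"
      using \<delta> L by (simp_all add: powr_mult)
    have s5: "norm (tp f x v) \<le> c * M * norm \<gamma> + c * (K3 * C * \<delta> powr \<alpha>) * 2 + K2 * C * (3 * L * \<delta>) powr \<alpha> + K1 * C * (L * \<delta>) powr \<alpha> + K2 * C * (3 * L * \<delta>) powr \<alpha> * 2"
      using s1 s2 s3 s4 cmp[OF f] by linarith
    also have "\<dots> = c * (M * norm \<gamma>) + E * (C * \<delta> powr \<alpha>)"
      unfolding p1 E_def by (simp only: algebra_simps)
    also have "\<dots> \<le> max c E * (M * norm \<gamma>) + max c E * (C * \<delta> powr \<alpha>)"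
      using M0 C0 by (intro add_mono mult_right_mono) auto
    also have "\<dots> = max c E * (M * norm (inverse (b N v)) ^ m + C * \<delta> powr \<alpha>)" by (simp add: \<gamma>n distrib_left)
    finally show ?thesis by (simp only: M_def \<delta>_def)
  qed
  thus ?thesis using c1 by (intro exI[of _ "max c E"]) (auto simp: le_max_iff_disj)
qed

text \<open>Outside the disc every reciprocal factor has modulus at most \<open>1\<close>, so all
  but two may be dropped.\<close>

lemma norm_inverse_b_two_factors:
  assumes v: "1 < norm v" and jl: "j \<noteq> l" "j < N" "l < N"
  shows "norm (inverse (b N v)) \<le> norm (inverse (blaschke_factor (z j) v)) * norm (inverse (blaschke_factor (z l) v))"
proof -
  define p where "p i = norm (inverse (blaschke_factor (z i) v))" for i
  have p: "0 \<le> p i" "p i \<le> 1" for i unfolding p_def using norm_inverse_blaschke_factor_le_1[OF zj v] by auto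
  have "norm (inverse (b N v)) = (\<Prod>i=0..<N. p i)"
    by (simp add: finite_blaschke_def p_def norm_inverse prod_norm[symmetric] prod_inversef[symmetric])
  also have "{0..<N} = insert j (insert l ({0..<N} - {j, l}))" using jl by auto
  also have "(\<Prod>i\<in>\<dots>. p i) = p j * (p l * (\<Prod>i\<in>{0..<N} - {j, l}. p i))" using jl by simp
  also have "\<dots> \<le> p j * (p l * 1)" using p by (intro mult_left_mono prod_le_1) auto
  finally show ?thesis by (simp add: p_def)
qed

lemma norm_inverse_b_no_zeros:
  assumes x: "norm x < 1" and \<delta>: "\<delta> = 1 - norm x" and away: "\<And>j. j < N \<Longrightarrow> \<delta> / 2 < norm (x - z j)"
    and v: "1 + \<delta> / 2 \<le> norm v" "norm (v - x) \<le> 4 * \<delta>"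
  shows "norm (inverse (b N v)) \<le> norm (b N x) powr (1 / 1250)"
proof -
  have "norm (inverse (b N v)) = (\<Prod>i=0..<N. norm (inverse (blaschke_factor (z i) v)))"
    by (simp add: finite_blaschke_def norm_inverse prod_norm[symmetric] prod_inversef[symmetric])
  also have "\<dots> \<le> (\<Prod>i=0..<N. norm (blaschke_factor (z i) x) powr (1 / 1250))"
    by (intro prod_mono conjI blaschke_factor_exterior_decay[OF zj x \<delta> away v]) auto
  also have "\<dots> = (\<Prod>i=0..<N. norm (blaschke_factor (z i) x)) powr (1 / 1250)"
    by (rule prod_powr_distrib[symmetric])
  finally show ?thesis by (simp add: finite_blaschke_def prod_norm)
qed

end

lemma reflection_bounds:
  assumes a: "a \<noteq> 0" "norm a < 1"
  shows "norm (1 / cnj a) = 1 / norm a" "2 - norm a \<le> norm (1 / cnj a)"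
    "norm (1 / cnj a - a) \<le> 2 * (1 - norm a) / norm a" "blaschke_factor a (1 / cnj a) = 0"
proof -
  show n: "norm (1 / cnj a) = 1 / norm a" by (simp add: norm_divide)
  have "norm a * (2 - norm a) \<le> 1" using zero_le_power2[of "1 - norm a"] by (simp add: power2_eq_square algebra_simps)
  thus "2 - norm a \<le> norm (1 / cnj a)" unfolding n using a by (simp add: field_simps)
  have "1 / cnj a - a = (1 - a * cnj a) / cnj a" using a by (simp add: field_simps)
  also have "1 - a * cnj a = of_real (1 - norm a ^ 2)" unfolding of_real_diff complex_norm_square[of a] by simp
  finally have "norm (1 / cnj a - a) = \<bar>1 - norm a ^ 2\<bar> / norm a" by (simp only: norm_divide norm_of_real complex_mod_cnj)
  also have "\<bar>1 - norm a ^ 2\<bar> = (1 - norm a) * (1 + norm a)"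
  proof -
    have "norm a ^ 2 \<le> 1" using a by (simp add: power_le_one)
    thus ?thesis by (simp add: power2_eq_square algebra_simps)
  qed
  also have "\<dots> \<le> (1 - norm a) * 2" using a by (intro mult_left_mono) auto
  finally show "norm (1 / cnj a - a) \<le> 2 * (1 - norm a) / norm a" by (simp add: divide_right_mono mult.commute)
  show "blaschke_factor a (1 / cnj a) = 0" using a by (simp add: blaschke_factor_def)
qed

context holder_blaschke
begin

text \<open>In the coordinate \<open>u\<close> with origin at the reflection of \<open>z j\<close>
  and unit \<open>\<delta>\<close>, the two reflected zeros give
  \<open>norm (inverse (b N v)) \<le> 16 * (norm u * norm (u - e))\<close>. Inserted into
  \<open>exterior_jet_bound\<close> with exponent \<open>n\<close>, this is the situation of
  \<open>two_zeros_bound\<close>. The smallness of \<open>1 - norm x\<close> keeps both zeros at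
  modulus at least \<open>1 / 2\<close>, so that their reflections stay near
  \<open>x\<close>.\<close>

lemma jet_norm_bound_near_zero:
  assumes C0: "1 \<le> C0"
  shows "\<exists>Q\<ge>0. \<forall>C f x j l. (\<forall>N. hb C (\<lambda>w. f w * b N w ^ n)) \<longrightarrow> x \<in> ball 0 1 \<longrightarrow> 8 * (C0 + 1) * (1 - norm x) \<le> 1 \<longrightarrow>
    norm (x - z j) \<le> (1 - norm x) / 2 \<longrightarrow> l \<noteq> j \<longrightarrow> norm (z j - z l) \<le> C0 * (1 - norm (z j)) \<longrightarrow>
    jet_norm n f x (1 - norm x) \<le> Q * (C * (1 - norm x) powr \<alpha>)"
proof -
  \<comment> \<open>The reflected zeros lie within \<open>7 * \<delta>\<close> and
    \<open>14 * (C0 * \<delta>)\<close> of \<open>x\<close>; \<open>L * \<delta>\<close> leaves room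
    for both and gives \<open>norm e \<le> 2 * L\<close>.\<close>
  define L where "L = 20 * (C0 + 1)"
  have L: "1 \<le> L" using C0 by (simp add: L_def)
  obtain K where K: "K \<ge> 1" and K_all: "\<forall>C f x v N m. hb C f \<longrightarrow> hb C (\<lambda>w. f w * b N w ^ m) \<longrightarrow> x \<in> ball 0 1 \<longrightarrow> 1 < norm v \<longrightarrow>
     norm v \<le> 2 \<longrightarrow> norm (v - x) \<le> L * (1 - norm x) \<longrightarrow>
     norm (tp f x v) \<le> K * (jet_norm n f x (1 - norm x) * norm (inverse (b N v)) ^ m + C * (1 - norm x) powr \<alpha>)"
    using exterior_jet_bound[OF L] by (elim exE conjE) (rule that)
  define R where "R = (real n + 1) * (1 + L) ^ n"
  have R: "R \<ge> 1" unfolding R_def using L mult_mono[of 1 "real n + 1" 1 "(1 + L) ^ n"] by (simp add: one_le_power)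
  define KK where "KK = K * (R * 16 ^ n)"
  have R16: "1 \<le> R * 16 ^ n" using R mult_mono[of 1 R 1 "16 ^ n"] by (simp add: one_le_power)
  have KK: "1 \<le> KK" "K \<le> KK" unfolding KK_def using K R16 mult_mono[of 1 K 1 "R * 16 ^ n"] mult_left_mono[OF R16, of K] by auto
  have L2: "0 \<le> 2 * L" using L by simp
  have r4: "0 < (1 / 4 :: real)" "(1 / 4 :: real) \<le> 1" by auto
  obtain K2 where K2: "0 \<le> K2" and K2_all: "\<forall>(c :: nat \<Rightarrow> complex) e \<eta>. 0 \<le> \<eta> \<longrightarrow> norm e \<le> 2 * L \<longrightarrow>
     (\<forall>u. norm u < 1 / 4 \<longrightarrow> norm (\<Sum>s\<le>n. c s * u ^ s) \<le> KK * ((\<Sum>s\<le>n. norm (c s)) * (norm u ^ n * norm (u - e) ^ n) + \<eta>)) \<longrightarrow>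
     norm (\<Sum>s\<le>n. c s * e ^ s) \<le> KK * \<eta> \<longrightarrow> (\<Sum>s\<le>n. norm (c s)) \<le> K2 * \<eta>"
    using two_zeros_bound[OF n_pos L2 KK(1) r4] by (elim exE conjE) (rule that)
  have "jet_norm n f x (1 - norm x) \<le> (R * K2) * (C * (1 - norm x) powr \<alpha>)"
    if fN: "\<And>N. hb C (\<lambda>w. f w * b N w ^ n)" and x: "x \<in> ball 0 1" and small: "8 * (C0 + 1) * (1 - norm x) \<le> 1"
      and xj: "norm (x - z j) \<le> (1 - norm x) / 2" and lj: "l \<noteq> j" and jl: "norm (z j - z l) \<le> C0 * (1 - norm (z j))" for C f x j l
  proof -
    have f: "hb C f" using fN[of 0] by simp
    have C: "C \<ge> 0" by (rule holder_bounded_nonneg[OF f])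
    define \<delta> where "\<delta> = 1 - norm x"
    have \<delta>: "0 < \<delta>" using x by (simp add: \<delta>_def)
    have C0\<delta>: "8 * (C0 * \<delta>) + 8 * \<delta> \<le> 1" using small by (simp add: \<delta>_def algebra_simps)
    have \<delta>C0: "\<delta> \<le> C0 * \<delta>" using C0 \<delta> by simp
    have \<delta>16: "16 * \<delta> \<le> 1" using C0\<delta> \<delta>C0 by linarith
    have nx: "norm x = 1 - \<delta>" by (simp add: \<delta>_def)
    define M where "M = jet_norm n f x \<delta>"
    have M0: "M \<ge> 0" unfolding M_def using \<delta> by (intro jet_norm_nonneg) simp
    define \<eta> where "\<eta> = C * \<delta> powr \<alpha>"
    have \<eta>: "\<eta> \<ge> 0" using C by (simp add: \<eta>_def)
    have xj': "norm (x - z j) \<le> \<delta> / 2" using xj by (simp add: \<delta>_def)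
    have nj: "1 - 3 / 2 * \<delta> \<le> norm (z j)" "norm (z j) \<le> 1 - \<delta> / 2"
      using norm_triangle_ineq2[of x "z j"] norm_triangle_ineq2[of "z j" x] xj' nx by (auto simp: norm_minus_commute)
    have "C0 * (1 - norm (z j)) \<le> C0 * (3 / 2 * \<delta>)" using C0 nj by (intro mult_left_mono) auto
    hence jl': "norm (z j - z l) \<le> 3 / 2 * (C0 * \<delta>)" using jl by simp
    have xl: "norm (x - z l) \<le> 2 * (C0 * \<delta>)"
      using norm_triangle_ineq[of "x - z j" "z j - z l"] xj' jl' \<delta>C0 by simp
    have nl: "1 - 3 * (C0 * \<delta>) \<le> norm (z l)"
      using norm_triangle_ineq2[of x "z l"] xl nx \<delta>C0 by linarith
    have zj2: "1 / 2 \<le> norm (z j)" using nj \<delta>16 by linarith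
    have zl2: "1 / 2 \<le> norm (z l)" using nl C0\<delta> \<delta> by linarith
    have z0: "z j \<noteq> 0" "z l \<noteq> 0" using zj2 zl2 by auto
    define vj where "vj = 1 / cnj (z j)"
    define vl where "vl = 1 / cnj (z l)"
    have refl4: "norm (1 / cnj a - a) \<le> 4 * (1 - norm a)" if "1 / 2 \<le> norm a" "norm a < 1" for a
    proof -
      have "norm (1 / cnj a - a) \<le> 2 * (1 - norm a) / norm a" by (rule reflection_bounds) (use that in auto)
      also have "\<dots> \<le> 2 * (1 - norm a) / (1 / 2)" using that by (intro divide_left_mono) auto
      finally show ?thesis by simp
    qed
    have vj: "norm (vj - z j) \<le> 6 * \<delta>" using refl4[OF zj2 zj] nj unfolding vj_def by argo
    have vl: "norm (vl - z l) \<le> 12 * (C0 * \<delta>)" using refl4[OF zl2 zj] nl unfolding vl_def by argo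
    have vjx: "norm (vj - x) \<le> 7 * \<delta>"
      using norm_triangle_ineq[of "vj - z j" "z j - x"] vj xj' \<delta> by (simp add: norm_minus_commute)
    have vlx: "norm (vl - x) \<le> 14 * (C0 * \<delta>)"
      using norm_triangle_ineq[of "vl - z l" "z l - x"] vl xl by (simp add: norm_minus_commute)
    have L\<delta>: "L * \<delta> = 20 * (C0 * \<delta>) + 20 * \<delta>" by (simp add: L_def algebra_simps)
    have nvj: "1 + \<delta> / 2 \<le> norm vj" using reflection_bounds(2)[OF z0(1) zj] nj unfolding vj_def by argo
    have nvl: "1 < norm vl" "norm vl \<le> 2"
      using reflection_bounds(1)[OF z0(2) zj] zl2 zj[of l] z0(2) unfolding vl_def by (auto simp: divide_le_eq)
    define N where "N = Suc (max j l)"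
    have jN: "j < N" "l < N" by (auto simp: N_def)
    define e where "e = (vl - vj) / of_real \<delta>"
    have e: "norm e \<le> 2 * L"
    proof -
      have "norm (vl - vj) \<le> norm (vl - x) + norm (vj - x)" using norm_triangle_ineq4[of "vl - x" "vj - x"] by simp
      also have "\<dots> \<le> 2 * L * \<delta>" using vjx vlx L\<delta> \<delta>C0 \<delta> by linarith
      finally show ?thesis using \<delta> by (simp add: e_def norm_divide divide_le_eq)
    qed
    have vle: "vl = vj + of_real \<delta> * e" using \<delta> by (simp add: e_def)
    have vjL: "norm (vj - x) \<le> L * \<delta>" using vjx L\<delta> \<delta>C0 \<delta> by linarith
    have L0: "0 \<le> L" using L by simp
    from taylor_poly_recenter_scaled[OF \<delta> vjL L0, of n f]
    obtain c :: "nat \<Rightarrow> complex" where c: "\<forall>u. tp f x (vj + of_real \<delta> * u) = (\<Sum>s\<le>n. c s * u ^ s)"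
      and Mc: "jet_norm n f x \<delta> \<le> (real n + 1) * (1 + L) ^ n * (\<Sum>s\<le>n. norm (c s))"
      by (elim exE conjE) (rule that)
    define m where "m = (\<Sum>s\<le>n. norm (c s))"
    have m0: "m \<ge> 0" unfolding m_def by (rule sum_nonneg) auto
    have Mm: "M \<le> R * m" using Mc by (simp add: M_def R_def m_def)
    have "m \<le> K2 * \<eta>" unfolding m_def
    proof (rule K2_all[rule_format, OF \<eta> e])
      \<comment> \<open>The radius \<open>1 / 4\<close> keeps \<open>v\<close> outside: from
        \<open>norm vj \<ge> 1 + \<delta> / 2\<close> it follows that
        \<open>norm v \<ge> 1 + \<delta> / 4\<close>, so each of the two reciprocal factors is at
        most \<open>4\<close> times a distance in the new coordinate.\<close>
      fix u :: complex assume u: "norm u < 1 / 4"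
      define v where "v = vj + of_real \<delta> * u"
      have du: "norm (of_real \<delta> * u) \<le> \<delta> / 4" using u \<delta> by (simp add: norm_mult)
      have v1: "1 + \<delta> / 4 \<le> norm v"
        using norm_triangle_ineq2[of vj "- (of_real \<delta> * u)"] du nvj by (simp add: v_def)
      have vx: "norm (v - x) \<le> 8 * \<delta>"
        using norm_triangle_ineq[of "vj - x" "of_real \<delta> * u"] du vjx \<delta> by (simp add: v_def algebra_simps)
      have v2: "norm v \<le> 2" using norm_triangle_ineq2[of v x] vx nx \<delta>16 by linarith
      have vgt: "1 < norm v" using v1 \<delta> by linarith
      have vL: "norm (v - x) \<le> L * (1 - norm x)" using vx L\<delta> \<delta>C0 \<delta> unfolding \<delta>_def[symmetric] by linarith
      have pj: "norm (inverse (blaschke_factor (z j) v)) \<le> 4 * norm u"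
      proof -
        have "norm (inverse (blaschke_factor (z j) v)) \<le> norm (v - vj) / (norm v - 1)"
          unfolding vj_def by (rule norm_inverse_blaschke_factor_near[OF zj z0(1) vgt])
        also have "\<dots> \<le> (\<delta> * norm u) / (\<delta> / 4)" using v1 \<delta> by (intro frac_le) (auto simp: v_def norm_mult)
        finally show ?thesis using \<delta> by simp
      qed
      have pl: "norm (inverse (blaschke_factor (z l) v)) \<le> 4 * norm (u - e)"
      proof -
        have "norm (inverse (blaschke_factor (z l) v)) \<le> norm (v - vl) / (norm v - 1)"
          unfolding vl_def by (rule norm_inverse_blaschke_factor_near[OF zj z0(2) vgt])
        also have "v - vl = of_real \<delta> * (u - e)" by (simp add: v_def vle algebra_simps)
        also have "norm (of_real \<delta> * (u - e)) / (norm v - 1) \<le> (\<delta> * norm (u - e)) / (\<delta> / 4)"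
          using v1 \<delta> by (intro frac_le) (auto simp: norm_mult)
        finally show ?thesis using \<delta> by simp
      qed
      have "norm (inverse (b N v)) \<le> norm (inverse (blaschke_factor (z j) v)) * norm (inverse (blaschke_factor (z l) v))"
        by (rule norm_inverse_b_two_factors[OF vgt]) (use lj jN in auto)
      also have "\<dots> \<le> (4 * norm u) * (4 * norm (u - e))" by (intro mult_mono pj pl) auto
      finally have "norm (inverse (b N v)) \<le> 16 * (norm u * norm (u - e))" by simp
      hence "norm (inverse (b N v)) ^ n \<le> (16 * (norm u * norm (u - e))) ^ n" by (intro power_mono) auto
      hence pb: "norm (inverse (b N v)) ^ n \<le> 16 ^ n * (norm u ^ n * norm (u - e) ^ n)" by (simp add: power_mult_distrib)
      have "norm (tp f x v) \<le> K * (M * norm (inverse (b N v)) ^ n + \<eta>)"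
        using K_all[rule_format, OF f fN x vgt v2 vL] unfolding M_def \<eta>_def \<delta>_def .
      also have "\<dots> \<le> K * ((R * m) * (16 ^ n * (norm u ^ n * norm (u - e) ^ n)) + \<eta>)"
        using K Mm pb M0 R m0 by (intro mult_left_mono add_right_mono mult_mono) auto
      also have "\<dots> = KK * (m * (norm u ^ n * norm (u - e) ^ n)) + K * \<eta>" by (simp add: KK_def algebra_simps)
      also have "\<dots> \<le> KK * (m * (norm u ^ n * norm (u - e) ^ n)) + KK * \<eta>"
        using KK \<eta> by (intro add_left_mono mult_right_mono) auto
      finally show "norm (\<Sum>s\<le>n. c s * u ^ s) \<le> KK * ((\<Sum>s\<le>n. norm (c s)) * (norm u ^ n * norm (u - e) ^ n) + \<eta>)"
        using c by (simp add: v_def m_def distrib_left)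
    next
      \<comment> \<open>The point \<open>e\<close> may lie outside the disc of radius
        \<open>1 / 4\<close>, so its value is a separate condition. Again \<open>b N vl = 0\<close>
        by division by zero stands for a zero of \<open>1 / b\<close>, and \<open>n \<ge> 1\<close>
        makes the jet term vanish.\<close>
      have "blaschke_factor (z l) vl = 0" unfolding vl_def by (rule reflection_bounds(4)[OF z0(2) zj])
      hence "b N vl = 0" unfolding finite_blaschke_def using jN by (intro prod_zero bexI[of _ l]) auto
      moreover have "norm (vl - x) \<le> L * (1 - norm x)" using vlx L\<delta> \<delta>C0 \<delta> unfolding \<delta>_def[symmetric] by linarith
      ultimately have "norm (tp f x vl) \<le> K * (M * norm (inverse (0::complex)) ^ n + \<eta>)"
        using K_all[rule_format, OF f fN[of N] x nvl] unfolding M_def \<eta>_def \<delta>_def by simp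
      hence "norm (tp f x vl) \<le> K * \<eta>" using n_pos by (simp add: power_0_left)
      also have "\<dots> \<le> KK * \<eta>" using KK \<eta> by (intro mult_right_mono) auto
      finally show "norm (\<Sum>s\<le>n. c s * e ^ s) \<le> KK * \<eta>" using c vle by simp
    qed
    hence "R * m \<le> R * (K2 * \<eta>)" using R by (intro mult_left_mono) auto
    thus ?thesis using Mm by (simp add: M_def \<eta>_def \<delta>_def mult.assoc)
  qed
  moreover have "0 \<le> R * K2" using R K2 by simp
  ultimately show ?thesis by (intro exI[of _ "R * K2"]) auto
qed

text \<open>Here the smallness of \<open>B\<close> comes from the joint effect of zeros that are not
  close to \<open>x\<close>. It is carried over to \<open>1 / b\<close> on a whole disc in the
  exterior, where \<open>exterior_jet_bound\<close> bounds the jet by half of itself plus the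
  error.\<close>

lemma jet_norm_bound_away_from_zeros:
  "\<exists>Q \<epsilon>. 0 \<le> Q \<and> 0 < \<epsilon> \<and> \<epsilon> < 1 \<and> (\<forall>C f x. (\<forall>N. hb C (\<lambda>w. f w * b N w ^ n)) \<longrightarrow> x \<in> ball 0 1 \<longrightarrow> 16 * (1 - norm x) \<le> 1 \<longrightarrow>
    (\<forall>j. (1 - norm x) / 2 < norm (x - z j)) \<longrightarrow> norm (B x) < \<epsilon> \<longrightarrow>
    jet_norm n f x (1 - norm x) \<le> Q * (C * (1 - norm x) powr \<alpha>))"
proof -
  have "(1::real) \<le> 4" by simp
  from exterior_jet_bound[OF this]
  obtain K where K: "K \<ge> 1" and K_all: "\<forall>C f x v N m. hb C f \<longrightarrow> hb C (\<lambda>w. f w * b N w ^ m) \<longrightarrow> x \<in> ball 0 1 \<longrightarrow> 1 < norm v \<longrightarrow>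
     norm v \<le> 2 \<longrightarrow> norm (v - x) \<le> 4 * (1 - norm x) \<longrightarrow>
     norm (tp f x v) \<le> K * (jet_norm n f x (1 - norm x) * norm (inverse (b N v)) ^ m + C * (1 - norm x) powr \<alpha>)"
    by (elim exE conjE) (rule that)
  define R where "R = (real n + 1) * 5 ^ n * ((real n + 1) * 4 ^ n)"
  have "1 * 1 \<le> (real n + 1) * 5 ^ n" "1 * 1 \<le> (real n + 1) * 4 ^ n" by (intro mult_mono one_le_power; simp)+
  hence R: "R \<ge> 1" unfolding R_def using mult_mono[of 1 "(real n + 1) * 5 ^ n" 1 "(real n + 1) * 4 ^ n"] by simp
  \<comment> \<open>The power \<open>1250\<close> undoes the exponent of the decay estimate, so that
    \<open>1 / b\<close> becomes at most \<open>1 / (2 * (R * K))\<close>. \<open>R\<close> collects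
    the loss from a disc of radius \<open>1 / 4\<close> to coefficients, \<open>4 ^ n\<close>, and
    from the shifted centre back to \<open>x\<close>, \<open>5 ^ n\<close>; the jet then reappears
    with the factor \<open>1 / 2\<close>.\<close>
  define \<epsilon> where "\<epsilon> = (1 / (2 * (R * K))) powr 1250"
  have RK: "R * K \<ge> 1" using R K mult_mono[of 1 R 1 K] by simp
  have \<epsilon>0: "0 < \<epsilon>" unfolding \<epsilon>_def using R K by simp
  have \<epsilon>1: "\<epsilon> < 1" 
  proof -
    have "1 / (2 * (R * K)) < 1" using RK by (simp add: divide_less_eq)
    thus ?thesis unfolding \<epsilon>_def using powr_less_mono2[of 1250 "1 / (2 * (R * K))" 1] RK by simp
  qed
  have "jet_norm n f x (1 - norm x) \<le> (2 * (R * K)) * (C * (1 - norm x) powr \<alpha>)"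
    if fN: "\<And>N. hb C (\<lambda>w. f w * b N w ^ n)" and x: "x \<in> ball 0 1" and small: "16 * (1 - norm x) \<le> 1"
      and away: "\<And>j. (1 - norm x) / 2 < norm (x - z j)" and Bx: "norm (B x) < \<epsilon>" for C f x
  proof -
    have f: "hb C f" using fN[of 0] by simp
    have C: "C \<ge> 0" by (rule holder_bounded_nonneg[OF f])
    define \<delta> where "\<delta> = 1 - norm x"
    have \<delta>: "0 < \<delta>" "16 * \<delta> \<le> 1" using x small by (auto simp: \<delta>_def)
    have nx: "norm x = 1 - \<delta>" by (simp add: \<delta>_def)
    have x1: "norm x < 1" using x by simp
    have x0: "x \<noteq> 0" using nx \<delta> by auto
    define M where "M = jet_norm n f x \<delta>"
    have M0: "M \<ge> 0" unfolding M_def using \<delta> by (intro jet_norm_nonneg) simp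
    define \<eta> where "\<eta> = C * \<delta> powr \<alpha>"
    have "(\<lambda>N. norm (b N x)) \<longlonglongrightarrow> norm (B x)" by (intro tendsto_norm finite_blaschke_tendsto[OF bs x1])
    hence "eventually (\<lambda>N. norm (b N x) < \<epsilon>) sequentially" using Bx by (rule order_tendstoD)
    \<comment> \<open>\<open>N\<close> depends on \<open>x\<close>, which is harmless because the
      constant of \<open>exterior_jet_bound\<close> does not depend on \<open>N\<close>.\<close>
    then obtain N where N: "norm (b N x) < \<epsilon>" by (metis eventually_happens sequentially_bot)
    define v0 where "v0 = 1 / cnj x"
    have nv0: "1 + \<delta> \<le> norm v0" using reflection_bounds(2)[OF x0 x1] nx unfolding v0_def by linarith
    have v0x: "norm (v0 - x) \<le> 3 * \<delta>"
    proof -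
      have "norm (v0 - x) \<le> 2 * \<delta> / norm x" unfolding v0_def \<delta>_def by (rule reflection_bounds(3)[OF x0 x1])
      also have "\<dots> \<le> 2 * \<delta> / (2 / 3)" using \<delta> nx by (intro divide_left_mono) auto
      finally show ?thesis by simp
    qed
    have v0L: "norm (v0 - x) \<le> 4 * \<delta>" using v0x \<delta> by simp
    have "(0::real) \<le> 4" by simp
    from taylor_poly_recenter_scaled[OF \<delta>(1) v0L this, of n f]
    obtain c :: "nat \<Rightarrow> complex" where c: "\<forall>u. tp f x (v0 + of_real \<delta> * u) = (\<Sum>s\<le>n. c s * u ^ s)"
      and Mc: "jet_norm n f x \<delta> \<le> (real n + 1) * (1 + 4) ^ n * (\<Sum>s\<le>n. norm (c s))"
      by (elim exE conjE) (rule that)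
    define m where "m = (\<Sum>s\<le>n. norm (c s))"
    define A where "A = K * (M * (1 / (2 * (R * K))) + \<eta>)"
    have bd: "norm (\<Sum>s\<le>n. c s * u ^ s) \<le> A" if u: "norm u < 1 / 4" for u
    proof -
      define v where "v = v0 + of_real \<delta> * u"
      have du: "norm (of_real \<delta> * u) \<le> \<delta> / 4" using u \<delta> by (simp add: norm_mult)
      have v1: "1 + \<delta> / 2 \<le> norm v"
        using norm_triangle_ineq2[of v0 "- (of_real \<delta> * u)"] du nv0 \<delta> by (simp add: v_def)
      have vx: "norm (v - x) \<le> 4 * \<delta>"
        using norm_triangle_ineq[of "v0 - x" "of_real \<delta> * u"] du v0x \<delta> by (simp add: v_def algebra_simps)
      have v2: "norm v \<le> 2" using norm_triangle_ineq2[of v x] vx nx \<delta> by linarith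
      have vgt: "1 < norm v" using v1 \<delta> by linarith
      have "norm (inverse (b N v)) \<le> norm (b N x) powr (1 / 1250)"
        by (rule norm_inverse_b_no_zeros[OF x1 \<delta>_def _ v1 vx]) (use away in \<open>simp add: \<delta>_def\<close>)
      also have "\<dots> \<le> \<epsilon> powr (1 / 1250)" using N by (intro powr_mono2) auto
      also have "\<dots> = 1 / (2 * (R * K))" unfolding \<epsilon>_def powr_powr using R K by simp
      finally have ib: "norm (inverse (b N v)) \<le> 1 / (2 * (R * K))" .
      have i1: "norm (inverse (b N v)) \<le> 1" by (rule order_trans[OF ib]) (use RK in \<open>simp add: divide_le_eq\<close>)
      have "norm (inverse (b N v)) ^ n \<le> norm (inverse (b N v)) ^ 1"
        using i1 n_pos by (intro power_decreasing) auto
      hence ibn: "norm (inverse (b N v)) ^ n \<le> 1 / (2 * (R * K))" using ib by simp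
      have vx': "norm (v - x) \<le> 4 * (1 - norm x)" using vx by (simp add: \<delta>_def)
      have "norm (tp f x v) \<le> K * (M * norm (inverse (b N v)) ^ n + \<eta>)"
        using K_all[rule_format, OF f fN x vgt v2 vx'] unfolding M_def \<eta>_def \<delta>_def .
      also have "\<dots> \<le> A" unfolding A_def using K M0 ibn by (intro mult_left_mono add_right_mono) auto
      finally show ?thesis using c by (simp add: v_def)
    qed
    have A0: "A \<ge> 0" using bd[of 0] by (rule order_trans[OF norm_ge_zero]) simp
    have "norm (c s) \<le> 4 ^ n * A" if s: "s \<le> n" for s
    proof -
      have "norm (c s) * (1 / 4) ^ s \<le> A" by (rule poly_coeff_bound[OF _ bd s]) auto
      hence "norm (c s) \<le> 4 ^ s * A" by (simp add: power_divide divide_le_eq mult.commute)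
      also have "\<dots> \<le> 4 ^ n * A" using s A0 by (intro mult_right_mono power_increasing) auto
      finally show ?thesis .
    qed
    hence "m \<le> of_nat (card {..n}) * (4 ^ n * A)" unfolding m_def by (intro sum_bounded_above) auto
    hence "m \<le> (real n + 1) * 4 ^ n * A" by (simp add: add.commute)
    hence m5: "(real n + 1) * 5 ^ n * m \<le> (real n + 1) * 5 ^ n * ((real n + 1) * 4 ^ n * A)" by (intro mult_left_mono) auto
    have "M \<le> (real n + 1) * 5 ^ n * m" using Mc by (simp add: M_def m_def)
    also note m5
    also have "(real n + 1) * 5 ^ n * ((real n + 1) * 4 ^ n * A) = R * A" by (simp only: R_def mult.assoc)
    also have "R * A = M / 2 + (R * K) * \<eta>" unfolding A_def using R K by (simp add: field_simps)
    finally have "M \<le> 2 * (R * K) * \<eta>" by simp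
    thus ?thesis by (simp add: M_def \<eta>_def \<delta>_def)
  qed
  moreover have "0 \<le> 2 * (R * K)" using RK by simp
  ultimately show ?thesis using \<epsilon>0 \<epsilon>1 by (intro exI[of _ "2 * (R * K)"] exI[of _ \<epsilon>]) auto
qed

end

section \<open>The ideal of index \<open>n\<close> when every zero has another one nearby\<close>

context holder_blaschke
begin

lemma J_n_small_where_B_small:
  assumes f: "f \<in> J_ideal \<alpha> B n" and C0: "1 \<le> C0"
    and near: "\<And>j. \<exists>l. l \<noteq> j \<and> norm (z j - z l) \<le> C0 * (1 - norm (z j))"
  shows "\<exists>\<epsilon> C'. 0 < \<epsilon> \<and> \<epsilon> < 1 \<and> 0 \<le> C' \<and> (\<forall>x\<in>ball 0 1. norm (B x) < \<epsilon> \<longrightarrow>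
    (\<forall>u\<in>ball x ((1 - norm x) / 2). norm (f u) \<le> C' * (1 - norm x) powr \<alpha>))"
proof -
  obtain C1 where C1: "hb C1 (\<lambda>w. f w * B w ^ n)" using f unfolding J_iff by blast
  have hf: "f holomorphic_on ball 0 1" using f J_iff holder_bounded_holomorphic by blast
  obtain Kp where "\<forall>C f m N. f holomorphic_on ball 0 1 \<longrightarrow> hb C (\<lambda>w. f w * B w ^ m) \<longrightarrow> hb (Kp * C) (\<lambda>w. f w * b N w ^ m)"
    using hb_partial by (elim exE conjE) (rule that)
  note fN = this[rule_format, OF hf C1]
  define C where "C = Kp * C1"
  have fN: "hb C (\<lambda>w. f w * b N w ^ n)" for N unfolding C_def by (rule fN)
  have fC: "hb C f" using fN[of 0] by simp
  have C: "C \<ge> 0" by (rule holder_bounded_nonneg[OF fC])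
  obtain K3 where K3: "K3 > 0" and K3_all: "\<forall>C f z w. hb C f \<longrightarrow> z \<in> ball 0 1 \<longrightarrow> w \<in> ball 0 1 \<longrightarrow> norm (f w - tp f z w) \<le> K3 * C * norm (w - z) powr \<alpha>"
    using hb_taylor by (elim exE conjE) (rule that)
  obtain Q1 where Q1: "Q1 \<ge> 0" and Q1_all: "\<forall>C f x j l. (\<forall>N. hb C (\<lambda>w. f w * b N w ^ n)) \<longrightarrow> x \<in> ball 0 1 \<longrightarrow> 8 * (C0 + 1) * (1 - norm x) \<le> 1 \<longrightarrow>
    norm (x - z j) \<le> (1 - norm x) / 2 \<longrightarrow> l \<noteq> j \<longrightarrow> norm (z j - z l) \<le> C0 * (1 - norm (z j)) \<longrightarrow>
    jet_norm n f x (1 - norm x) \<le> Q1 * (C * (1 - norm x) powr \<alpha>)"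
    using jet_norm_bound_near_zero[OF C0] by (elim exE conjE) (rule that)
  obtain Q2 \<epsilon> where Q2: "Q2 \<ge> 0" and \<epsilon>: "0 < \<epsilon>" "\<epsilon> < 1" and Q2_all: "\<forall>C f x. (\<forall>N. hb C (\<lambda>w. f w * b N w ^ n)) \<longrightarrow> x \<in> ball 0 1 \<longrightarrow> 16 * (1 - norm x) \<le> 1 \<longrightarrow>
    (\<forall>j. (1 - norm x) / 2 < norm (x - z j)) \<longrightarrow> norm (B x) < \<epsilon> \<longrightarrow>
    jet_norm n f x (1 - norm x) \<le> Q2 * (C * (1 - norm x) powr \<alpha>)"
    using jet_norm_bound_away_from_zeros by (elim exE conjE) (rule that)
  \<comment> \<open>Below \<open>\<kappa>\<close> the thresholds of both jet bounds hold, as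
    \<open>C0 \<ge> 1\<close>. Above it \<open>1 - norm x\<close> is bounded below, and the global
    bound of \<open>f\<close> has the required form with the constant
    \<open>C * \<kappa> powr (- \<alpha>)\<close>.\<close>
  define \<kappa> where "\<kappa> = 1 / (8 * (C0 + 1))"
  have \<kappa>: "\<kappa> > 0" using C0 by (simp add: \<kappa>_def)
  define C' where "C' = (Q1 + Q2 + K3) * C + C * \<kappa> powr (- \<alpha>)"
  have C'0: "C' \<ge> 0" unfolding C'_def using Q1 Q2 K3 C by (intro add_nonneg_nonneg mult_nonneg_nonneg) auto
  have "norm (f u) \<le> C' * (1 - norm x) powr \<alpha>" if x: "x \<in> ball 0 1" and Bx: "norm (B x) < \<epsilon>" and u: "u \<in> ball x ((1 - norm x) / 2)" for x u
  proof -
    define \<delta> where "\<delta> = 1 - norm x"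
    have \<delta>: "\<delta> > 0" using x by (simp add: \<delta>_def)
    have "ball x ((1 - norm x) / 2) \<subseteq> ball 0 1" by (rule ball_shrink_subset[OF x]) (use x in simp)
    hence ud: "u \<in> ball 0 1" using u by blast
    have p0: "0 \<le> \<delta> powr \<alpha>" by simp
    have D: "C' * \<delta> powr \<alpha> = Q1 * (C * \<delta> powr \<alpha>) + Q2 * (C * \<delta> powr \<alpha>) + K3 * C * \<delta> powr \<alpha> + C * (\<kappa> powr (- \<alpha>) * \<delta> powr \<alpha>)"
      by (simp add: C'_def algebra_simps)
    have nonneg: "0 \<le> Q1 * (C * \<delta> powr \<alpha>)" "0 \<le> Q2 * (C * \<delta> powr \<alpha>)" "0 \<le> K3 * C * \<delta> powr \<alpha>" "0 \<le> C * (\<kappa> powr (- \<alpha>) * \<delta> powr \<alpha>)"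
      using Q1 Q2 K3 C by auto
    have "norm (f u) \<le> C' * \<delta> powr \<alpha>"
    proof (cases "\<delta> \<le> \<kappa>")
      case False
      have "1 = \<kappa> powr (- \<alpha>) * \<kappa> powr \<alpha>" using \<kappa> by (simp flip: powr_add)
      also have "\<dots> \<le> \<kappa> powr (- \<alpha>) * \<delta> powr \<alpha>" using False \<kappa> n_less by (intro mult_left_mono powr_mono2) auto
      finally have "C * 1 \<le> C * (\<kappa> powr (- \<alpha>) * \<delta> powr \<alpha>)" using C by (intro mult_left_mono) auto
      moreover have "norm (f u) \<le> C" using fC ud by (simp add: holder_bounded_def)
      ultimately show ?thesis unfolding D using nonneg by linarith
    next
      case True
      hence s1: "8 * (C0 + 1) * \<delta> \<le> 1" using C0 by (simp add: \<kappa>_def le_divide_eq mult.commute)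
      have "16 * \<delta> \<le> 8 * (C0 + 1) * \<delta>" using C0 \<delta> by (intro mult_right_mono) auto
      hence s2: "16 * \<delta> \<le> 1" using s1 by linarith
      have M: "jet_norm n f x \<delta> \<le> Q1 * (C * \<delta> powr \<alpha>) + Q2 * (C * \<delta> powr \<alpha>)"
      proof (cases "\<exists>j. norm (x - z j) \<le> \<delta> / 2")
        case True
        then obtain j where j: "norm (x - z j) \<le> \<delta> / 2" by blast
        obtain l where l: "l \<noteq> j" "norm (z j - z l) \<le> C0 * (1 - norm (z j))" using near by blast
        have "jet_norm n f x \<delta> \<le> Q1 * (C * \<delta> powr \<alpha>)"
          unfolding \<delta>_def by (rule Q1_all[rule_format, OF fN x _ _ l]) (use s1 j in \<open>simp_all add: \<delta>_def\<close>)
        thus ?thesis using nonneg by linarith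
      next
        case False
        hence away: "\<delta> / 2 < norm (x - z j)" for j by (simp add: not_le)
        have "jet_norm n f x \<delta> \<le> Q2 * (C * \<delta> powr \<alpha>)"
          unfolding \<delta>_def by (rule Q2_all[rule_format, OF fN x _ _ Bx]) (use s2 away in \<open>simp_all add: \<delta>_def\<close>)
        thus ?thesis using nonneg by linarith
      qed
      have ux: "norm (u - x) \<le> 1 * \<delta>" using u \<delta> by (simp add: dist_norm norm_minus_commute \<delta>_def)
      have "norm (tp f x u) \<le> 1 ^ n * jet_norm n f x \<delta>" by (rule norm_taylor_poly_le[OF ux]) (use \<delta> in auto)
      moreover have "norm (f u - tp f x u) \<le> K3 * C * norm (u - x) powr \<alpha>" by (rule K3_all[rule_format, OF fC x ud])
      moreover have "K3 * C * norm (u - x) powr \<alpha> \<le> K3 * C * \<delta> powr \<alpha>"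
        using K3 C ux n_less by (intro mult_left_mono powr_mono2) auto
      moreover have "norm (f u) \<le> norm (tp f x u) + norm (f u - tp f x u)" using norm_triangle_sub[of "f u" "tp f x u"] by simp
      ultimately show ?thesis unfolding D using M nonneg by simp
    qed
    thus ?thesis by (simp only: \<delta>_def)
  qed
  thus ?thesis using \<epsilon> C'0 by (intro exI[of _ \<epsilon>] exI[of _ C']) auto
qed

lemma J_n_ideal_subspace:
  assumes C0: "1 \<le> C0" and near: "\<And>j. \<exists>l. l \<noteq> j \<and> norm (z j - z l) \<le> C0 * (1 - norm (z j))"
  shows "ideal_subspace_of_A \<alpha> (J_ideal \<alpha> B n)"
  unfolding ideal_subspace_of_A_def
proof (intro conjI ballI impI)
  show "linear_subspace_of_A \<alpha> (J_ideal \<alpha> B n)" using J_is_ideal[of n] unfolding ideal_of_A_def by (elim conjE)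
  fix f g assume f: "f \<in> J_ideal \<alpha> B n" and g: "g \<in> A_space \<alpha>" and le: "\<forall>w\<in>ball 0 1. norm (g w) \<le> norm (f w)"
  obtain \<epsilon> C' where \<epsilon>: "0 < \<epsilon>" "\<epsilon> < 1" and C': "0 \<le> C'" and small: "\<forall>x\<in>ball 0 1. norm (B x) < \<epsilon> \<longrightarrow>
      (\<forall>u\<in>ball x ((1 - norm x) / 2). norm (f u) \<le> C' * (1 - norm x) powr \<alpha>)"
    using J_n_small_where_B_small[OF f C0 near] by (elim exE conjE) (rule that)
  obtain D where D: "hb D g" using g unfolding A_space_iff by blast
  define C where "C = max C' D"
  have C: "0 \<le> C" using C' by (simp add: C_def)
  have gC: "hb C g" by (rule holder_bounded_mono[OF D]) (simp add: C_def)
  obtain K where K: "\<forall>z N g. (\<forall>j. norm (z j) < 1) \<longrightarrow> hb C g \<longrightarrow>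
     (\<forall>w\<in>ball 0 1. norm (finite_blaschke z 0 N w) < \<epsilon> \<longrightarrow> (\<forall>u\<in>ball w ((1 - norm w) / 2). norm (g u) \<le> C * (1 - norm w) powr \<alpha>)) \<longrightarrow>
     hb K (\<lambda>w. g w * finite_blaschke z 0 N w ^ n)"
    using hb_mult_blaschke_power[OF \<epsilon> C, of n] by (elim exE) (rule that)
  have "hb K (\<lambda>w. g w * b N w ^ n)" for N
  proof (rule K[rule_format, OF zj gC])
    fix w u assume w: "w \<in> ball 0 1" and bw: "norm (b N w) < \<epsilon>" and u: "u \<in> ball w ((1 - norm w) / 2)"
    have w1: "norm w < 1" using w by simp
    have "norm (blaschke_product (\<lambda>j. z (j + N)) w) \<le> 1"
      by (rule norm_blaschke_product_le_1[OF blaschke_sequence_shift[OF bs] w1])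
    hence "norm (b N w) * norm (blaschke_product (\<lambda>j. z (j + N)) w) \<le> norm (b N w)" by (intro mult_left_le) auto
    \<comment> \<open>The tail has modulus at most \<open>1\<close>, so \<open>B\<close> is small
      wherever a finite product is. The smallness known for \<open>B\<close> thus serves all
      \<open>b N\<close> with one constant \<open>K\<close>.\<close>
    hence "norm (B w) \<le> norm (b N w)" unfolding blaschke_product_split[OF bs w1, of N] norm_mult .
    hence Bw: "norm (B w) < \<epsilon>" using bw by linarith
    have "ball w ((1 - norm w) / 2) \<subseteq> ball 0 1" by (rule ball_shrink_subset[OF w]) (use w in simp)
    hence "norm (g u) \<le> norm (f u)" using le u by blast
    also have "\<dots> \<le> C' * (1 - norm w) powr \<alpha>" using small w Bw u by blast
    also have "\<dots> \<le> C * (1 - norm w) powr \<alpha>" by (intro mult_right_mono) (auto simp: C_def)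
    finally show "norm (g u) \<le> C * (1 - norm w) powr \<alpha>" .
  qed
  hence "hb K (\<lambda>w. g w * B w ^ n)"
  proof (rule hb_limit)
    fix w :: complex assume "w \<in> ball 0 1"
    hence "(\<lambda>N. b N w) \<longlonglongrightarrow> B w" by (intro finite_blaschke_tendsto[OF bs]) simp
    thus "(\<lambda>N. g w * b N w ^ n) \<longlonglongrightarrow> g w * B w ^ n" by (intro tendsto_mult tendsto_const tendsto_power)
  qed
  thus "g \<in> J_ideal \<alpha> B n" using D unfolding J_iff by blast
qed

lemma near_zero_of_bounded:
  assumes bd: "\<And>j. sep_dist z j / (1 - norm (z j)) \<le> M"
  shows "\<exists>l. l \<noteq> j \<and> norm (z j - z l) \<le> (\<bar>M\<bar> + 1) * (1 - norm (z j))"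
proof -
  have p: "0 < 1 - norm (z j)" using zj by simp
  have "sep_dist z j \<le> M * (1 - norm (z j))" using bd[of j] p by (simp add: divide_le_eq)
  \<comment> \<open>The infimum may not be attained, so a strict inequality is needed;
    \<open>\<bar>M\<bar> + 1\<close> also is a constant at least \<open>1\<close>, as
    \<open>J_n_ideal_subspace\<close> asks.\<close>
  also have "\<dots> < (\<bar>M\<bar> + 1) * (1 - norm (z j))" using p by (intro mult_strict_right_mono) auto
  finally have "Inf ((\<lambda>l. norm (z j - z l)) ` (UNIV - {j})) < (\<bar>M\<bar> + 1) * (1 - norm (z j))" by (simp only: sep_dist_def)
  moreover have "Suc j \<in> UNIV - {j}" by simp
  hence "(\<lambda>l. norm (z j - z l)) ` (UNIV - {j}) \<noteq> {}" by blast
  ultimately obtain y where "y \<in> (\<lambda>l. norm (z j - z l)) ` (UNIV - {j})" "y < (\<bar>M\<bar> + 1) * (1 - norm (z j))"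
    using cInf_lessD by meson
  thus ?thesis by (auto intro: less_imp_le)
qed

lemma J_ideal_cong:
  assumes "\<And>w. w \<in> ball 0 1 \<Longrightarrow> B' w = B w" shows "J_ideal \<alpha> B' k = J_ideal \<alpha> B k"
proof -
  have "hb C (\<lambda>w. f w * B' w ^ k) \<longleftrightarrow> hb C (\<lambda>w. f w * B w ^ k)" for C f
    by (rule iffI; erule holder_bounded_cong) (simp_all add: assms)
  thus ?thesis by (simp add: J_ideal_def A_space_iff)
qed

end

section \<open>The equivalence of the five conditions\<close>

lemma SUP_ereal_eq_infinity_iff:
  fixes r :: "nat \<Rightarrow> real"
  shows "(SUP j. ereal (r j)) = \<infinity> \<longleftrightarrow> \<not> (\<exists>M. \<forall>j. r j \<le> M)"
proof
  assume inf: "(SUP j. ereal (r j)) = \<infinity>"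
  show "\<not> (\<exists>M. \<forall>j. r j \<le> M)"
  proof
    assume "\<exists>M. \<forall>j. r j \<le> M"
    then obtain M where "\<forall>j. r j \<le> M" by blast
    hence "(SUP j. ereal (r j)) \<le> ereal M" by (intro SUP_least) simp
    thus False using inf by simp
  qed
next
  assume unb: "\<not> (\<exists>M. \<forall>j. r j \<le> M)"
  show "(SUP j. ereal (r j)) = \<infinity>"
  proof (rule SUP_PInfty)
    fix m :: nat
    obtain j where "\<not> r j \<le> real m" using unb by blast
    thus "\<exists>i\<in>UNIV. ereal (real m) \<le> ereal (r i)" by (intro bexI[of _ j]) auto
  qed
qed

theorem theorem1p1:
  fixes n :: nat and \<alpha> :: real and B :: "complex \<Rightarrow> complex" and z :: "nat \<Rightarrow> complex"
  assumes "n \<ge> 1" and "real n < \<alpha>" and "\<alpha> < real n + 1"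
    and "A_interpolating_blaschke_product n \<alpha> B z"
  shows "((\<forall>k\<in>{1..n}. nonideal_ideal_of_A \<alpha> (J_ideal \<alpha> B k))
            \<longleftrightarrow> (\<forall>k\<in>{1..n}. J_ideal \<alpha> B (k + 1) \<subset> J_ideal \<alpha> B k)) \<and>
         ((\<forall>k\<in>{1..n}. J_ideal \<alpha> B (k + 1) \<subset> J_ideal \<alpha> B k)
            \<longleftrightarrow> nonideal_ideal_of_A \<alpha> (J_ideal \<alpha> B n)) \<and>
         (nonideal_ideal_of_A \<alpha> (J_ideal \<alpha> B n)
            \<longleftrightarrow> J_ideal \<alpha> B (n + 1) \<noteq> J_ideal \<alpha> B n) \<and>
         (J_ideal \<alpha> B (n + 1) \<noteq> J_ideal \<alpha> B n
            \<longleftrightarrow> (SUP j. ereal (sep_dist z j / (1 - norm (z j)))) = \<infinity>)"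
proof -
  have bs: "blaschke_sequence z" and BB: "\<forall>w\<in>ball 0 1. B w = blaschke_product z w"
    and inj: "inj z" and E: "A_interpolating_set n \<alpha> (closure (range z))"
    using assms(4) unfolding A_interpolating_blaschke_product_def by auto
  interpret holder_blaschke n \<alpha> z
    using assms(1-3) bs by unfold_locales
  have J: "J_ideal \<alpha> B k = J_ideal \<alpha> (blaschke_product z) k" for k
    by (rule J_ideal_cong) (use BB in blast)
  define S where "S k = J_ideal \<alpha> (blaschke_product z) k" for k
  \<comment> \<open>All conditions are compared with boundedness of the ratio. If it is unbounded,
    every inclusion is proper, and each proper inclusion makes its larger ideal nonideal. The index
    \<open>n\<close> alone leads back: if the ratio is bounded, the ideal of index \<open>n\<close>
    is an ideal subspace.\<close>
  define bounded_ratio where "bounded_ratio = (\<exists>M. \<forall>j. sep_dist z j / (1 - norm (z j)) \<le> M)"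
  have v: "(SUP j. ereal (sep_dist z j / (1 - norm (z j)))) = \<infinity> \<longleftrightarrow> \<not> bounded_ratio"
    unfolding bounded_ratio_def by (rule SUP_ereal_eq_infinity_iff)
  have n: "n \<in> {1..n}" using assms(1) by simp
  have v_ii: "S (k + 1) \<subset> S k" if "\<not> bounded_ratio" "k \<in> {1..n}" for k
    using J_eq_imp_bounded[OF inj E, of k] J_Suc_subset[of k] that unfolding S_def bounded_ratio_def by auto
  have proper_nonideal: "nonideal_ideal_of_A \<alpha> (S k)" if "S (k + 1) \<noteq> S k" "k \<in> {1..n}" for k
    unfolding S_def by (rule J_nonideal) (use that in \<open>auto simp: S_def\<close>)
  have iii_v: "\<not> bounded_ratio" if "nonideal_ideal_of_A \<alpha> (S n)"
  proof
    assume "bounded_ratio"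
    then obtain M where M: "\<And>j. sep_dist z j / (1 - norm (z j)) \<le> M" unfolding bounded_ratio_def by blast
    have "ideal_subspace_of_A \<alpha> (S n)" unfolding S_def
      by (rule J_n_ideal_subspace[of "\<bar>M\<bar> + 1", OF _ near_zero_of_bounded[OF M]]) simp
    thus False using that by (simp add: nonideal_ideal_of_A_def)
  qed
  have "(\<forall>k\<in>{1..n}. nonideal_ideal_of_A \<alpha> (S k)) \<longleftrightarrow> \<not> bounded_ratio"
    using v_ii proper_nonideal iii_v n by blast
  moreover have "(\<forall>k\<in>{1..n}. S (k + 1) \<subset> S k) \<longleftrightarrow> \<not> bounded_ratio"
    using v_ii proper_nonideal[of n] iii_v n by blast
  moreover have "nonideal_ideal_of_A \<alpha> (S n) \<longleftrightarrow> \<not> bounded_ratio"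
    using v_ii[of n] proper_nonideal[of n] iii_v n by blast
  moreover have "S (n + 1) \<noteq> S n \<longleftrightarrow> \<not> bounded_ratio"
    using v_ii[of n] proper_nonideal[of n] iii_v n by blast
  ultimately show ?thesis unfolding J v S_def by blast
qed

end
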